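(* Let $G$ be a purely parabolic discrete group in $\mathrm{PSL}(3,\mathbb{C})$. Then $G$ is either virtually unipotent or it contains a subgroup of finite index which is conjugate to $$\left\{\begin{bmatrix}1&w&0\\0&1&0\\0&0&\eta(w)\end{bmatrix}: w\in W\right\},$$ with $W$ a discrete additive subgroup of $\mathbb{C}$ and $\eta:W\to\mathbb{S}^1$ a group morphism.
   Context: Square brackets around an invertible matrix denote its class in $\mathrm{PSL}(3,\mathbb{C})$. An element of $\mathrm{PSL}(3,\mathbb{C})$ is parabolic if its lifts to $\mathrm{SL}(3,\mathbb{C})$ are non-diagonalizable with all eigenvalues of modulus $1$. A group is purely parabolic if all its elements other than the identity are parabolic. Virtually unipotent means having a finite-index subgroup all of whose elements have a unipotent lift to $\mathrm{SL}(3,\mathbb{C})$. *)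

theory Defs
  imports "HOL-Analysis.Analysis" "HOL-Algebra.Coset"
begin

section \<open>Matrices\<close>

definition mat_eigenvalue :: "complex^'n^'n \<Rightarrow> complex \<Rightarrow> bool" where
  "mat_eigenvalue A k \<longleftrightarrow> (\<exists>v. v \<noteq> 0 \<and> A *v v = k *s v)"

definition diagonalizable :: "complex^'n^'n \<Rightarrow> bool" where
  "diagonalizable A \<longleftrightarrow>
     (\<exists>P D :: complex^'n^'n.
        invertible P \<and> (\<forall>i j. i \<noteq> j \<longrightarrow> D $ i $ j = 0) \<and> A = P ** D ** matrix_inv P)"

text \<open>\<open>A - I\<close> is nilpotent. The powers are written with \<open>^^\<close> because \<open>^\<close> is not
  available for the matrix product.\<close>

definition unipotent :: "complex^'n^'n \<Rightarrow> bool" where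
  "unipotent A \<longleftrightarrow> (\<exists>k. (((**) (A - mat 1)) ^^ k) (mat 1) = 0)"


section \<open>The topological group PSL(3,C)\<close>

definition SL3 :: "(complex^3^3) monoid" where
  "SL3 = \<lparr>carrier = {A. det A = 1}, mult = (**), one = mat 1\<rparr>"

definition SL3_scalars :: "(complex^3^3) set" where
  "SL3_scalars = {mat c | c. c ^ 3 = 1}"

text \<open>An element of PSL(3,C) is a coset of the scalar matrices in SL(3,C), so it is
  literally the set of its lifts to SL(3,C).\<close>

definition PSL3 :: "(complex^3^3) set monoid" where
  "PSL3 = SL3 Mod SL3_scalars"

text \<open>The class of an invertible matrix, whose determinant need not be 1: the set of its
  scalar multiples of determinant 1.\<close>

definition PSL3_class :: "complex^3^3 \<Rightarrow> (complex^3^3) set" where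
  "PSL3_class A = {B \<in> carrier SL3. \<exists>c. B = mat c ** A}"

text \<open>The quotient topology: the preimage of a set \<open>U\<close> of classes under the projection
  from SL(3,C) is \<open>\<Union>U\<close>.\<close>

definition PSL3_topology :: "(complex^3^3) set topology" where
  "PSL3_topology =
     topology (\<lambda>U. U \<subseteq> carrier PSL3 \<and> openin (top_of_set (carrier SL3)) (\<Union>U))"

definition discrete_subgroup_PSL3 :: "(complex^3^3) set set \<Rightarrow> bool" where
  "discrete_subgroup_PSL3 G \<longleftrightarrow>
     subgroup G PSL3 \<and> subtopology PSL3_topology G = discrete_topology G"

definition parabolic :: "(complex^3^3) set \<Rightarrow> bool" where
  "parabolic g \<longleftrightarrow>
     (\<forall>A\<in>g. \<not> diagonalizable A \<and> (\<forall>k. mat_eigenvalue A k \<longrightarrow> cmod k = 1))"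

definition purely_parabolic :: "(complex^3^3) set set \<Rightarrow> bool" where
  "purely_parabolic G \<longleftrightarrow> (\<forall>g\<in>G. g \<noteq> \<one>\<^bsub>PSL3\<^esub> \<longrightarrow> parabolic g)"

definition finite_index_subgroup :: "'a set \<Rightarrow> 'a set \<Rightarrow> 'a monoid \<Rightarrow> bool" where
  "finite_index_subgroup H G M \<longleftrightarrow>
     subgroup H (M\<lparr>carrier := G\<rparr>) \<and> finite (rcosets\<^bsub>M\<lparr>carrier := G\<rparr>\<^esub> H)"

definition virtually_unipotent :: "(complex^3^3) set set \<Rightarrow> bool" where
  "virtually_unipotent G \<longleftrightarrow>
     (\<exists>H. finite_index_subgroup H G PSL3 \<and> (\<forall>h\<in>H. \<exists>A\<in>h. unipotent A))"

definition conjugate_in :: "'a monoid \<Rightarrow> 'a set \<Rightarrow> 'a set \<Rightarrow> bool" where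
  "conjugate_in M H K \<longleftrightarrow>
     (\<exists>g\<in>carrier M. (\<lambda>h. g \<otimes>\<^bsub>M\<^esub> h \<otimes>\<^bsub>M\<^esub> inv\<^bsub>M\<^esub> g) ` H = K)"


section \<open>The groups in the conclusion\<close>

definition complex_add :: "complex monoid" where
  "complex_add = \<lparr>carrier = UNIV, mult = (+), one = 0\<rparr>"

definition unit_circle :: "complex monoid" where
  "unit_circle = \<lparr>carrier = {z. cmod z = 1}, mult = (*), one = 1\<rparr>"

definition translation_family :: "complex set \<Rightarrow> (complex \<Rightarrow> complex) \<Rightarrow> (complex^3^3) set set" where
  "translation_family W \<eta> =
     {PSL3_class (vector [vector [1, w, 0],
                          vector [0, 1, 0],
                          vector [0, 0, \<eta> w]]) | w. w \<in> W}"


section \<open>Well-definedness\<close>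

lemma mat_scale_left: "mat c ** (A :: complex^3^3) = (\<chi> i j. c * A $ i $ j)"
  unfolding matrix_matrix_mult_def mat_def vec_eq_iff by (simp add: forall_3 sum_3)

lemma mat_scale_right: "(A :: complex^3^3) ** mat c = (\<chi> i j. c * A $ i $ j)"
  unfolding matrix_matrix_mult_def mat_def vec_eq_iff by (simp add: forall_3 sum_3)

lemma mat_mult_mat: "mat a ** (mat b :: complex^3^3) = mat (a * b)"
  unfolding mat_scale_left by (simp add: mat_def vec_eq_iff)

lemma mat_commute: "mat c ** (A :: complex^3^3) = A ** mat c"
  unfolding mat_scale_left mat_scale_right ..

lemma det_mat3: "det (mat c :: complex^3^3) = c ^ 3"
  by (simp add: det_3 mat_def power3_eq_cube)

lemma group_SL3: "group SL3"
proof (rule groupI)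
  fix A assume "A \<in> carrier SL3"
  then have A: "det A = 1" by (simp add: SL3_def)
  then obtain B where B: "B ** A = mat 1" "A ** B = mat 1"
    using invertible_det_nz[of A] unfolding invertible_def by auto
  have "det B = 1" using arg_cong[OF B(1), of det] A by (simp add: det_mul)
  with B show "\<exists>B\<in>carrier SL3. B \<otimes>\<^bsub>SL3\<^esub> A = \<one>\<^bsub>SL3\<^esub>" by (auto simp: SL3_def)
qed (auto simp: SL3_def det_mul matrix_mul_assoc)

lemma normal_SL3_scalars: "SL3_scalars \<lhd> SL3"
proof -
  interpret group SL3 by (rule group_SL3)
  have sub: "subgroup SL3_scalars SL3"
  proof (rule subgroupI)
    show "SL3_scalars \<subseteq> carrier SL3" by (auto simp: SL3_scalars_def SL3_def det_mat3)
    show "SL3_scalars \<noteq> {}" unfolding SL3_scalars_def by (auto intro: exI[of _ 1])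
    fix A assume "A \<in> SL3_scalars"
    then obtain c where c: "A = mat c" "c ^ 3 = 1" by (auto simp: SL3_scalars_def)
    have "c \<noteq> 0" using c(2) by auto
    have "inv\<^bsub>SL3\<^esub> A = mat (inverse c)"
      by (rule inv_equality)
        (use c \<open>c \<noteq> 0\<close> in \<open>auto simp: SL3_def det_mat3 mat_mult_mat power_inverse\<close>)
    then show "inv\<^bsub>SL3\<^esub> A \<in> SL3_scalars"
      using c unfolding SL3_scalars_def by (auto simp: power_inverse intro!: exI[of _ "inverse c"])
  next
    fix A B assume "A \<in> SL3_scalars" "B \<in> SL3_scalars"
    then obtain a b where "A = mat a" "a ^ 3 = 1" "B = mat b" "b ^ 3 = 1"
      by (auto simp: SL3_scalars_def)
    then show "A \<otimes>\<^bsub>SL3\<^esub> B \<in> SL3_scalars"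
      unfolding SL3_scalars_def
      by (auto simp: SL3_def mat_mult_mat power_mult_distrib intro!: exI[of _ "a * b"])
  qed
  show ?thesis
  proof (rule normalI[OF sub], intro ballI)
    fix A
    have "C \<otimes>\<^bsub>SL3\<^esub> A = A \<otimes>\<^bsub>SL3\<^esub> C" if "C \<in> SL3_scalars" for C
      using that by (auto simp: SL3_scalars_def SL3_def mat_commute)
    then show "SL3_scalars #>\<^bsub>SL3\<^esub> A = A <#\<^bsub>SL3\<^esub> SL3_scalars"
      unfolding r_coset_def l_coset_def by auto
  qed
qed

lemma group_PSL3: "group PSL3"
  unfolding PSL3_def by (rule normal.factorgroup_is_group[OF normal_SL3_scalars])

lemma PSL3_class_eq_coset:
  assumes B: "B \<in> carrier SL3" and c: "c \<noteq> 0" and BA: "B = mat c ** A"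
  shows "PSL3_class A = SL3_scalars #>\<^bsub>SL3\<^esub> B"
proof -
  have A: "mat d ** A = mat (d / c) ** B" for d
    unfolding BA using c by (simp add: matrix_mul_assoc mat_mult_mat)
  have det: "det (mat d ** B) = d ^ 3" for d
    using B by (simp add: det_mul det_mat3 SL3_def)
  have "C \<in> PSL3_class A \<longleftrightarrow> C \<in> SL3_scalars #>\<^bsub>SL3\<^esub> B" for C
  proof
    assume "C \<in> PSL3_class A"
    then obtain d where d: "C = mat (d / c) ** B" "det C = 1"
      by (auto simp: PSL3_class_def SL3_def A)
    with det[of "d / c"] have "(d / c) ^ 3 = 1" by metis
    with d(1) show "C \<in> SL3_scalars #>\<^bsub>SL3\<^esub> B"
      unfolding r_coset_def SL3_scalars_def by (auto simp: SL3_def)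
  next
    assume "C \<in> SL3_scalars #>\<^bsub>SL3\<^esub> B"
    then obtain d where d: "C = mat d ** B" "d ^ 3 = 1"
      unfolding r_coset_def SL3_scalars_def by (auto simp: SL3_def)
    have "C = mat (d * c) ** A" unfolding d(1) A[of "d * c"] using c by simp
    moreover have "det C = 1" unfolding d(1) det by (rule d(2))
    ultimately show "C \<in> PSL3_class A" by (auto simp: PSL3_class_def SL3_def)
  qed
  then show ?thesis by blast
qed

lemma PSL3_class_in_PSL3:
  assumes "invertible A"
  shows "PSL3_class A \<in> carrier PSL3"
proof -
  have d: "det A \<noteq> 0" using assms invertible_det_nz by blast
  obtain c where c: "c ^ 3 = inverse (det A)"
    using exists_complex_root[of 3 "inverse (det A)"] by (metis zero_neq_numeral)
  have "c \<noteq> 0" using c d by auto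
  have B: "mat c ** A \<in> carrier SL3" using c d by (simp add: SL3_def det_mul det_mat3)
  have "PSL3_class A = SL3_scalars #>\<^bsub>SL3\<^esub> (mat c ** A)"
    by (rule PSL3_class_eq_coset[OF B \<open>c \<noteq> 0\<close> refl])
  with B show ?thesis
    unfolding PSL3_def FactGroup_def RCOSETS_def partial_object.simps by blast
qed

lemma openin_PSL3_topology:
  "openin PSL3_topology U \<longleftrightarrow>
     U \<subseteq> carrier PSL3 \<and> openin (top_of_set (carrier SL3)) (\<Union>U)"
proof -
  let ?P = "\<lambda>U. U \<subseteq> carrier PSL3 \<and> openin (top_of_set (carrier SL3)) (\<Union>U)"
  have disj: "g = h" if "g \<in> carrier PSL3" "h \<in> carrier PSL3" "A \<in> g" "A \<in> h" for g h A
    using group.rcos_disjoint[OF group_SL3 normal_imp_subgroup[OF normal_SL3_scalars]] that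
    unfolding PSL3_def FactGroup_def by (auto simp: pairwise_def disjnt_def)
  have "istopology ?P"
    unfolding istopology_def
  proof (intro conjI allI impI)
    fix S T assume ST: "?P S" "?P T"
    then show "S \<inter> T \<subseteq> carrier PSL3" by auto
    have "\<Union>(S \<inter> T) = \<Union>S \<inter> \<Union>T" using ST disj by blast
    with ST show "openin (top_of_set (carrier SL3)) (\<Union>(S \<inter> T))" by (auto intro: openin_Int)
  next
    fix K assume K: "\<forall>S\<in>K. ?P S"
    then show "\<Union>K \<subseteq> carrier PSL3" by auto
    have eq: "\<Union>(\<Union>K) = \<Union>(Union ` K)" by blast
    from K show "openin (top_of_set (carrier SL3)) (\<Union>(\<Union>K))"
      unfolding eq by (intro openin_Union) blast
  qed
  then show ?thesis unfolding PSL3_topology_def by simp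
qed

lemma group_complex_add: "group complex_add"
proof (rule groupI)
  fix x assume "x \<in> carrier complex_add"
  show "\<exists>y\<in>carrier complex_add. y \<otimes>\<^bsub>complex_add\<^esub> x = \<one>\<^bsub>complex_add\<^esub>"
    by (rule bexI[of _ "- x"]) (auto simp: complex_add_def)
qed (auto simp: complex_add_def)

lemma group_unit_circle: "group unit_circle"
proof (rule groupI)
  fix x assume "x \<in> carrier unit_circle"
  then have "cmod x = 1" by (simp add: unit_circle_def)
  moreover from this have "x \<noteq> 0" by auto
  ultimately show "\<exists>y\<in>carrier unit_circle. y \<otimes>\<^bsub>unit_circle\<^esub> x = \<one>\<^bsub>unit_circle\<^esub>"
    by (intro bexI[of _ "inverse x"]) (auto simp: unit_circle_def norm_inverse)
qed (auto simp: unit_circle_def norm_mult)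

end

theory Submission
  imports Defs "HOL-Computational_Algebra.Fundamental_Theorem_Algebra"
begin

text \<open>
  Lift \<open>G\<close> to the group \<open>\<Gamma>\<close> of all unimodular multiples of its lifts (\<open>parabolic_lifts\<close>). All
  eigenvalues of elements of \<open>\<Gamma>\<close> are unimodular, the diagonalizable elements are scalar, and the
  identity is isolated modulo scalars. The proof has two parts.

  \<^emph>\<open>The group is triangular\<close> (\<open>upper_triangularizable\<close>). An irreducible matrix group with bounded traces is
  bounded, because the trace form on the algebra that it spans is nondegenerate
  (\<open>bounded_of_bounded_traces\<close>). A bounded group with unimodular eigenvalues consists of
  diagonalizable matrices, since Jordan blocks have unbounded powers. So an irreducible \<open>\<Gamma>\<close> would consist of
  scalars, which is absurd, and up to transposition there is an invariant line
  (\<open>exists_common_eigenvector\<close>). If the quotient by this line were irreducible, it would be bounded, and the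
  eigenvalue on the line would have to occur on the quotient too, because otherwise the element
  would be diagonalizable (\<open>block_corner_eigenvalue\<close>). After normalization every element then has the
  eigenvalue 1 on the two-dimensional quotient, and a group of such matrices has an invariant line after all
  (\<open>common_eigenvector_2\<close>).

  \<^emph>\<open>Triangular groups.\<close> A triangular element has two equal diagonal entries, as it is
  diagonalizable otherwise. So \<open>\<Gamma>\<close> is the union of the kernels of the three quotients of diagonal
  entries, and either the diagonal takes finitely many values up to scalars, in which case \<open>G\<close> is
  virtually unipotent, or one of the quotients is trivial on all of \<open>\<Gamma>\<close>
  (\<open>finite_or_constant_of_three_characters\<close>). In the second case the remaining quotient takes infinitely many
  values, and some element \<open>g0\<close> has a value close to but different from 1. Iterated commutators
  of \<open>g0\<close> with the unipotent elements contract to the identity, so by discreteness they become trivial.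
  This leaves so few unipotent elements that all of \<open>\<Gamma>\<close> preserves the generalized eigenspaces of
  \<open>g0\<close>, which is the normal form of the conclusion (\<open>near_one_aac\<close>, \<open>near_one_aba\<close>, and a
  transposition for the third case). The subgroup in the conclusion is then \<open>G\<close> itself.

  In the normal form the rotation part is a function of the translation part, because an element with trivial
  translation part is diagonal, and the translation parts form a discrete group because the rotation parts
  lie in a compact one (\<open>shifts_bounded_away\<close>).
\<close>

section \<open>Conjugation, eigenvalues and diagonalizability\<close>

lemma matrix_inv_left: "invertible P \<Longrightarrow> matrix_inv P ** P = mat 1"
  and matrix_inv_right: "invertible P \<Longrightarrow> P ** matrix_inv P = mat 1"
  unfolding invertible_def matrix_inv_def by (metis (mono_tags, lifting) someI_ex)+

definition conj_by :: "complex^'n^'n \<Rightarrow> complex^'n^'n \<Rightarrow> complex^'n^'n" where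
  "conj_by P A = matrix_inv P ** A ** P"

lemma conj_by_mul:
  assumes "invertible P"
  shows "conj_by P (A ** B) = conj_by P A ** conj_by P B"
proof -
  have "conj_by P A ** conj_by P B = matrix_inv P ** A ** (P ** matrix_inv P) ** B ** P"
    by (simp add: conj_by_def matrix_mul_assoc)
  then show ?thesis
    by (simp add: conj_by_def matrix_mul_assoc matrix_inv_right[OF assms])
qed

lemma mult_conj_by: "invertible P \<Longrightarrow> P ** conj_by P A = A ** P"
  by (simp add: conj_by_def matrix_mul_assoc matrix_inv_right)

lemma conj_by_eqI: "invertible P \<Longrightarrow> A ** P = P ** B \<Longrightarrow> conj_by P A = B"
  by (metis conj_by_def matrix_inv_left matrix_mul_assoc matrix_mul_lid)

lemma conj_by_one: "invertible P \<Longrightarrow> conj_by P (mat 1) = mat 1"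
  by (rule conj_by_eqI) auto

lemma mult_mat_commute: "mat c ** (A :: complex^'n^'n) = A ** mat c"
  by (simp add: vec_eq_iff matrix_matrix_mult_def mat_def if_distrib if_distribR mult.commute cong: if_cong)

lemma mat_mult_vec: "mat c *v (v :: complex^'n) = c *s v"
  by (simp add: vec_eq_iff matrix_vector_mult_def mat_def if_distrib if_distribR cong: if_cong)

lemma conj_by_mat: "invertible P \<Longrightarrow> conj_by P (mat c) = mat c"
  by (rule conj_by_eqI) (auto simp: mult_mat_commute)

lemma conj_by_conj_by:
  assumes "invertible P" "invertible Q"
  shows "conj_by Q (conj_by P A) = conj_by (P ** Q) A"
proof -
  have "A ** (P ** Q) = P ** Q ** conj_by Q (conj_by P A)"
    by (metis assms matrix_mul_assoc mult_conj_by)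
  then show ?thesis
    using conj_by_eqI[OF invertible_mult[OF assms]] by metis
qed

lemma conj_by_scale: "conj_by P (mat c ** A) = mat c ** conj_by P A"
  unfolding conj_by_def by (metis matrix_mul_assoc mult_mat_commute)

lemma conj_by_diff: "conj_by P (A - B) = conj_by P A - conj_by P B"
  by (simp add: conj_by_def vec_eq_iff matrix_matrix_mult_def sum_subtractf right_diff_distrib left_diff_distrib)

lemma det_conj_by: "invertible P \<Longrightarrow> det (conj_by P A) = det A"
  using arg_cong[OF mult_conj_by[of P A], of det] by (auto simp: det_mul invertible_det_nz)

lemma invertible_transpose_inv:
  fixes P :: "complex^'n^'n"
  assumes "invertible P" shows "invertible (transpose (matrix_inv P))"
proof -
  have "det (matrix_inv P) * det P = 1"
    using arg_cong[OF matrix_inv_left[OF assms], of det] by (simp add: det_mul)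
  then show ?thesis by (auto simp: invertible_det_nz)
qed

lemma mat_eigenvalue_iff: "mat_eigenvalue A k \<longleftrightarrow> det (A - mat k) = 0"
proof -
  have "det (A - mat k) \<noteq> 0 \<longleftrightarrow> (\<forall>v. (A - mat k) *v v = 0 \<longrightarrow> v = 0)"
    using invertible_det_nz[of "A - mat k"] invertible_left_inverse[of "A - mat k"]
      matrix_left_invertible_ker[of "A - mat k"] by simp
  then show ?thesis
    unfolding mat_eigenvalue_def
    by (auto simp: matrix_vector_mult_diff_rdistrib mat_mult_vec)
qed

lemma mat_eigenvalue_conj_by:
  "invertible P \<Longrightarrow> mat_eigenvalue (conj_by P A) k \<longleftrightarrow> mat_eigenvalue A k"
  by (metis mat_eigenvalue_iff conj_by_diff conj_by_mat det_conj_by)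

lemma mat_eigenvalue_transpose: "mat_eigenvalue (transpose A) k \<longleftrightarrow> mat_eigenvalue A k"
proof -
  have "transpose A - mat k = transpose (A - mat k)"
    by (auto simp: transpose_def vec_eq_iff mat_def)
  then show ?thesis by (simp add: mat_eigenvalue_iff)
qed

lemma diagonalizableI:
  fixes A P D :: "complex^'n^'n"
  assumes "invertible P" "A ** P = P ** D" "\<And>i j. i \<noteq> j \<Longrightarrow> D $ i $ j = 0"
  shows "diagonalizable A"
proof -
  have "A = P ** D ** matrix_inv P"
    by (metis assms(1,2) matrix_inv_right matrix_mul_assoc matrix_mul_rid)
  then show ?thesis using assms(1,3) unfolding diagonalizable_def by blast
qed

lemma diagonalizable_conj_by:
  fixes A :: "complex^'n^'n"
  assumes P: "invertible P" shows "diagonalizable (conj_by P A) \<longleftrightarrow> diagonalizable A"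
proof
  assume "diagonalizable (conj_by P A)"
  then obtain Q D :: "complex^'n^'n" where Q: "invertible Q" and D: "\<And>i j. i \<noteq> j \<Longrightarrow> D $ i $ j = 0"
    and e: "conj_by P A = Q ** D ** matrix_inv Q" unfolding diagonalizable_def by blast
  have "A ** (P ** Q) = P ** conj_by P A ** Q"
    by (simp add: P matrix_mul_assoc mult_conj_by)
  also have "\<dots> = P ** Q ** D" 
    by (metis Q e matrix_inv_left matrix_mul_assoc matrix_mul_rid)
  finally show "diagonalizable A" using diagonalizableI[OF invertible_mult[OF P Q]] D by blast
next
  assume "diagonalizable A"
  then obtain Q D :: "complex^'n^'n" where Q: "invertible Q" and D: "\<And>i j. i \<noteq> j \<Longrightarrow> D $ i $ j = 0"
    and e: "A = Q ** D ** matrix_inv Q" unfolding diagonalizable_def by blast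
  have i: "invertible (matrix_inv P)"
    using P invertible_def matrix_inv_left matrix_inv_right by blast
  have "conj_by P A ** (matrix_inv P ** Q) = matrix_inv P ** A ** (P ** matrix_inv P) ** Q"
    by (simp add: conj_by_def matrix_mul_assoc)
  also have "\<dots> = matrix_inv P ** Q ** D"
    by (metis P Q e matrix_inv_left matrix_inv_right matrix_mul_assoc matrix_mul_rid)
  finally show "diagonalizable (conj_by P A)"
    using diagonalizableI[OF invertible_mult[OF i Q]] D by blast
qed

lemma diagonalizable_transpose:
  fixes A :: "complex^'n^'n"
  assumes "diagonalizable (transpose A)" shows "diagonalizable A"
proof -
  obtain Q D :: "complex^'n^'n" where Q: "invertible Q" and D: "\<And>i j. i \<noteq> j \<Longrightarrow> D $ i $ j = 0"
    and e: "transpose A = Q ** D ** matrix_inv Q" using assms unfolding diagonalizable_def by blast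
  have i: "invertible (transpose (matrix_inv Q))"
    by (rule invertible_transpose_inv[OF Q])
  have 1: "matrix_inv Q ** transpose A = D ** matrix_inv Q"
    by (metis Q e matrix_inv_left matrix_mul_assoc matrix_mul_lid)
  have "A ** transpose (matrix_inv Q) = transpose (matrix_inv Q) ** transpose D"
    using arg_cong[OF 1, of transpose] by (simp add: matrix_transpose_mul)
  then show ?thesis
    by (rule diagonalizableI[OF i]) (auto simp: D transpose_def)
qed

text \<open>Transposition turns conjugation by \<open>P\<close> into conjugation by the contragredient of \<open>P\<close>. This is what
  lets statements about invariant lines be used for invariant planes.\<close>

lemma transpose_conj_by:
  assumes P: "invertible P"
  shows "transpose (conj_by P A) = conj_by (transpose (matrix_inv P)) (transpose A)"
    and "invertible (transpose (matrix_inv P))"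
proof -
  show i: "invertible (transpose (matrix_inv P))"
    by (rule invertible_transpose_inv[OF P])
  have "conj_by P A ** matrix_inv P = matrix_inv P ** A"
    by (simp add: conj_by_def matrix_mul_assoc[symmetric] matrix_inv_right[OF P])
  from arg_cong[OF this, of transpose]
  show "transpose (conj_by P A) = conj_by (transpose (matrix_inv P)) (transpose A)"
    by (intro conj_by_eqI[OF i, symmetric]) (simp add: matrix_transpose_mul)
qed


section \<open>Upper triangular matrices of size three\<close>

definition utri :: "complex \<Rightarrow> complex \<Rightarrow> complex \<Rightarrow> complex \<Rightarrow> complex \<Rightarrow> complex \<Rightarrow> complex^3^3" where
  "utri a b c x y z = vector [vector [a, x, z], vector [0, b, y], vector [0, 0, c]]"

lemma utri_nth [simp]:
  "utri a b c x y z $ 1 $ 1 = a" "utri a b c x y z $ 1 $ 2 = x" "utri a b c x y z $ 1 $ 3 = z"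
  "utri a b c x y z $ 2 $ 1 = 0" "utri a b c x y z $ 2 $ 2 = b" "utri a b c x y z $ 2 $ 3 = y"
  "utri a b c x y z $ 3 $ 1 = 0" "utri a b c x y z $ 3 $ 2 = 0" "utri a b c x y z $ 3 $ 3 = c"
  by (simp_all add: utri_def)

lemma utri_mult:
  "utri a b c x y z ** utri a' b' c' x' y' z' =
     utri (a * a') (b * b') (c * c') (a * x' + x * b') (b * y' + y * c') (a * z' + x * y' + z * c')"
  by (simp add: vec_eq_iff forall_3 matrix_matrix_mult_def sum_3)

lemma mat_eq_utri: "mat c = utri c c c 0 0 0"
  by (simp add: vec_eq_iff forall_3 mat_def)

lemma utri_eq_iff:
  "utri a b c x y z = utri a' b' c' x' y' z' \<longleftrightarrow>
     a = a' \<and> b = b' \<and> c = c' \<and> x = x' \<and> y = y' \<and> z = z'"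
  by (auto simp: vec_eq_iff forall_3)

lemma scale_utri: "mat k ** utri a b c x y z = utri (k*a) (k*b) (k*c) (k*x) (k*y) (k*z)"
  by (simp add: mat_eq_utri utri_mult)

lemma det_utri: "det (utri a b c x y z) = a * b * c"
  by (simp add: det_3)

lemma invertible_utri: "a \<noteq> 0 \<Longrightarrow> b \<noteq> 0 \<Longrightarrow> c \<noteq> 0 \<Longrightarrow> invertible (utri a b c x y z)"
  by (simp add: invertible_det_nz det_utri)

definition upper :: "complex^3^3 \<Rightarrow> bool" where
  "upper A \<longleftrightarrow> A $ 2 $ 1 = 0 \<and> A $ 3 $ 1 = 0 \<and> A $ 3 $ 2 = 0"

lemma upper_eq_utri:
  "upper A \<Longrightarrow> A = utri (A$1$1) (A$2$2) (A$3$3) (A$1$2) (A$2$3) (A$1$3)"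
  by (simp add: upper_def vec_eq_iff forall_3)

lemma mat_eigenvalue_utri:
  "mat_eigenvalue (utri a b c x y z) k \<longleftrightarrow> k = a \<or> k = b \<or> k = c"
proof -
  have "utri a b c x y z - mat k = utri (a-k) (b-k) (c-k) x y z"
    by (simp add: vec_eq_iff forall_3 mat_def)
  then show ?thesis by (auto simp: mat_eigenvalue_iff det_utri)
qed

lemma utri_diagonal: "\<forall>i j. i \<noteq> j \<longrightarrow> utri a b c 0 0 0 $ i $ j = 0"
  by (simp add: forall_3)

lemma diagonalizable_utri_distinct:
  assumes "a \<noteq> b" "b \<noteq> c" "a \<noteq> c"
  shows "diagonalizable (utri a b c x y z)"
proof (rule diagonalizableI)
  let ?q = "y / (c - b)"
  show "invertible (utri 1 1 1 (x / (b - a)) ?q ((x * ?q + z) / (c - a)))"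
    by (rule invertible_utri) auto
  show "utri a b c x y z ** utri 1 1 1 (x / (b - a)) ?q ((x * ?q + z) / (c - a)) =
        utri 1 1 1 (x / (b - a)) ?q ((x * ?q + z) / (c - a)) ** utri a b c 0 0 0"
    using assms by (simp add: utri_mult utri_eq_iff divide_simps) (simp add: algebra_simps)
  show "\<And>i j. i \<noteq> j \<Longrightarrow> utri a b c 0 0 0 $ i $ j = 0"
    using utri_diagonal by blast
qed

lemma invertible_mat_one: "invertible (mat 1 :: complex^'n^'n)"
  by (simp add: invertible_det_nz)

lemma diagonalizable_utri_diag: "diagonalizable (utri a b c 0 0 0)"
  by (rule diagonalizableI[OF invertible_mat_one]) (use utri_diagonal in auto)

section \<open>Adapted bases\<close>

text \<open>The complex bilinear cross product, without conjugation: \<open>cross u v\<close> is the covector whose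
  kernel is the plane through \<open>u\<close> and \<open>v\<close>.\<close>

definition cross :: "complex^3 \<Rightarrow> complex^3 \<Rightarrow> complex^3" where
  "cross u v = vector [u$2 * v$3 - u$3 * v$2, u$3 * v$1 - u$1 * v$3, u$1 * v$2 - u$2 * v$1]"

lemma cross_nth [simp]:
  "cross u v $ 1 = u$2 * v$3 - u$3 * v$2" "cross u v $ 2 = u$3 * v$1 - u$1 * v$3"
  "cross u v $ 3 = u$1 * v$2 - u$2 * v$1"
  by (simp_all add: cross_def)

lemma cross_eq_0_imp_parallel:
  assumes "cross u v = 0" "u \<noteq> 0" shows "\<exists>k. v = k *s u"
proof -
  have e: "u$2 * v$3 = u$3 * v$2" "u$3 * v$1 = u$1 * v$3" "u$1 * v$2 = u$2 * v$1"
    using assms(1) by (auto simp: vec_eq_iff forall_3)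
  consider "u$1 \<noteq> 0" | "u$2 \<noteq> 0" | "u$3 \<noteq> 0"
    using assms(2) by (auto simp: vec_eq_iff forall_3)
  then show ?thesis
  proof cases
    case 1
    have "v = (v$1 / u$1) *s u" using 1 e by (simp add: vec_eq_iff forall_3 field_simps)
    then show ?thesis by blast
  next
    case 2
    have "v = (v$2 / u$2) *s u" using 2 e by (simp add: vec_eq_iff forall_3 field_simps)
    then show ?thesis by blast
  next
    case 3
    have "v = (v$3 / u$3) *s u" using 3 e by (simp add: vec_eq_iff forall_3 field_simps)
    then show ?thesis by blast
  qed
qed

lemma axis_mult_nth: "(A *v axis j 1) $ i = (A :: complex^'n^'n) $ i $ j"
  by (simp add: matrix_vector_mult_def axis_def if_distrib cong: if_cong)

lemma axis_one_nth: "axis j (1 :: complex) $ i = (if i = j then 1 else 0)"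
  by (simp add: axis_def)

lemma exists_basis_with_first_vector:
  assumes "v \<noteq> 0"
  shows "\<exists>P :: complex^3^3. invertible P \<and> P *v axis 1 1 = v"
proof -
  consider "v$1 \<noteq> 0" | "v$2 \<noteq> 0" | "v$3 \<noteq> 0"
    using assms by (auto simp: vec_eq_iff forall_3)
  then show ?thesis
  proof cases
    case 1
    show ?thesis
      by (rule exI[of _ "vector [vector [v$1, 0, 0], vector [v$2, 1, 0], vector [v$3, 0, 1]]"])
        (use 1 in \<open>auto simp: invertible_det_nz det_3 axis_mult_nth vec_eq_iff forall_3\<close>)
  next
    case 2
    show ?thesis
      by (rule exI[of _ "vector [vector [v$1, 1, 0], vector [v$2, 0, 0], vector [v$3, 0, 1]]"])
        (use 2 in \<open>auto simp: invertible_det_nz det_3 axis_mult_nth vec_eq_iff forall_3\<close>)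
  next
    case 3
    show ?thesis
      by (rule exI[of _ "vector [vector [v$1, 1, 0], vector [v$2, 0, 1], vector [v$3, 0, 0]]"])
        (use 3 in \<open>auto simp: invertible_det_nz det_3 axis_mult_nth vec_eq_iff forall_3\<close>)
  qed
qed

lemma conj_by_vec: "invertible P \<Longrightarrow> P *v (conj_by P A *v u) = A *v (P *v u)"
  by (simp add: matrix_vector_mul_assoc mult_conj_by)

lemma conj_by_vec_eq:
  assumes "invertible P" "A *v (P *v u) = P *v w"
  shows "conj_by P A *v u = w"
  by (metis assms conj_by_vec matrix_inv_left matrix_vector_mul_assoc matrix_vector_mul_lid)

definition block :: "complex^3^3 \<Rightarrow> bool" where
  "block A \<longleftrightarrow> A $ 2 $ 1 = 0 \<and> A $ 3 $ 1 = 0"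

text \<open>The action on the quotient by the first basis vector. It is kept as a matrix of size three,
  with zero first row and column, so that the argument on traces below applies to it as well.\<close>

definition lower_block :: "complex^3^3 \<Rightarrow> complex^3^3" where
  "lower_block A = (\<chi> i j. if i = 1 \<or> j = 1 then 0 else A $ i $ j)"

lemma lower_block_nth [simp]:
  "lower_block A $ 1 $ j = 0" "lower_block A $ i $ 1 = 0"
  "lower_block A $ 2 $ 2 = A $ 2 $ 2" "lower_block A $ 2 $ 3 = A $ 2 $ 3"
  "lower_block A $ 3 $ 2 = A $ 3 $ 2" "lower_block A $ 3 $ 3 = A $ 3 $ 3"
  by (simp_all add: lower_block_def)

lemma lower_block_mult:
  "block A \<Longrightarrow> block B \<Longrightarrow> lower_block (A ** B) = lower_block A ** lower_block B"
  by (simp add: vec_eq_iff forall_3 matrix_matrix_mult_def sum_3 block_def)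

lemma lower_block_scale: "lower_block (mat c ** A) = mat c ** lower_block A"
  by (simp add: vec_eq_iff forall_3 matrix_matrix_mult_def sum_3 mat_def)

lemma block_conj_by:
  assumes P: "invertible P" "P *v axis 1 1 = v" and v: "A *v v = k *s v"
  shows "block (conj_by P A)"
proof -
  have "conj_by P A *v axis 1 1 = k *s axis 1 1"
    by (rule conj_by_vec_eq[OF P(1)]) (simp add: P(2) v vector_scalar_commute)
  then have "conj_by P A $ i $ 1 = (k *s axis 1 1) $ i" for i by (metis axis_mult_nth)
  then show ?thesis by (simp add: block_def axis_one_nth)
qed

text \<open>If \<open>A\<close> preserves the line of the first basis vector and \<open>w\<close> is an eigenvector of \<open>A\<close> on the
  quotient, then \<open>A\<close> preserves the flag spanned by the first basis vector and \<open>w\<close>.\<close>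

lemma upper_conj_by:
  assumes A: "block A" and w: "lower_block A *v w = k *s w" "w $ 1 = 0"
    and P: "invertible P" "P *v axis 1 1 = axis 1 1" "P *v axis 2 1 = w"
  shows "upper (conj_by P A)"
proof -
  have "conj_by P A *v axis 1 1 = A$1$1 *s axis 1 1"
    by (rule conj_by_vec_eq[OF P(1)])
      (use A in \<open>simp add: P vector_scalar_commute vec_eq_iff forall_3 axis_mult_nth block_def axis_one_nth\<close>)
  then have 1: "conj_by P A $ i $ 1 = (A$1$1 *s axis 1 1) $ i" for i by (metis axis_mult_nth)
  have w': "A$2$2 * w$2 + A$2$3 * w$3 = k * w$2" "A$3$2 * w$2 + A$3$3 * w$3 = k * w$3"
    using w by (simp_all add: vec_eq_iff forall_3 matrix_vector_mult_def sum_3)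
  let ?x = "A$1$2 * w$2 + A$1$3 * w$3"
  have "conj_by P A *v axis 2 1 = ?x *s axis 1 1 + k *s axis 2 1"
  proof (rule conj_by_vec_eq[OF P(1)])
    have "P *v (?x *s axis 1 1 + k *s axis 2 1) = ?x *s axis 1 1 + k *s w"
      by (simp add: P vector_scalar_commute matrix_vector_right_distrib)
    also have "\<dots> = A *v w"
      using w' w(2) A
      by (simp add: vec_eq_iff forall_3 matrix_vector_mult_def sum_3 axis_one_nth block_def)
    finally show "A *v (P *v axis 2 1) = P *v (?x *s axis 1 1 + k *s axis 2 1)"
      by (simp add: P)
  qed
  then have "conj_by P A $ i $ 2 = (?x *s axis 1 1 + k *s axis 2 1) $ i" for i
    by (metis axis_mult_nth)
  with 1 show ?thesis by (simp add: upper_def axis_one_nth)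
qed

text \<open>The basis depends on \<open>w\<close> only, so that a common eigenvector of the lower blocks of a whole set
  of matrices makes all of them upper triangular at once.\<close>

lemma exists_basis_with_second_vector:
  assumes "w \<noteq> 0" "w $ 1 = 0"
  shows "\<exists>P :: complex^3^3. invertible P \<and> P *v axis 1 1 = axis 1 1 \<and> P *v axis 2 1 = w"
proof -
  consider "w$2 \<noteq> 0" | "w$3 \<noteq> 0"
    using assms by (auto simp: vec_eq_iff forall_3)
  then show ?thesis
  proof cases
    case 1
    show ?thesis
      by (rule exI[of _ "vector [vector [1, 0, 0], vector [0, w$2, 0], vector [0, w$3, 1]]"])
        (use 1 assms in \<open>auto simp: invertible_det_nz det_3 axis_mult_nth vec_eq_iff forall_3 axis_one_nth\<close>)
  next
    case 2
    show ?thesis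
      by (rule exI[of _ "vector [vector [1, 0, 0], vector [0, w$2, 1], vector [0, w$3, 0]]"])
        (use 2 assms in \<open>auto simp: invertible_det_nz det_3 axis_mult_nth vec_eq_iff forall_3 axis_one_nth\<close>)
  qed
qed

lemma exists_eigenvalue_3: "\<exists>k. mat_eigenvalue (A :: complex^3^3) k"
proof -
  have "\<exists>b c d. \<forall>k. det (A - mat k) = b + c * k + d * k^2 - k^3"
    by (rule exI[of _ "det A"],
        rule exI[of _ "A$1$2 * A$2$1 + A$1$3 * A$3$1 + A$2$3 * A$3$2
          - A$1$1 * A$2$2 - A$1$1 * A$3$3 - A$2$2 * A$3$3"], rule exI[of _ "A$1$1 + A$2$2 + A$3$3"])
      (simp add: det_3 mat_def power2_eq_square power3_eq_cube algebra_simps)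
  then obtain b c d where e: "det (A - mat k) = b + c * k + d * k^2 - k^3" for k by blast
  obtain k where "poly [:b, c, d, -1:] k = 0"
    using basic_cqe_conv2[of "[:d, -1:]" b c] by auto
  then have "det (A - mat k) = 0"
    unfolding e by (simp add: power2_eq_square power3_eq_cube algebra_simps)
  then show ?thesis by (auto simp: mat_eigenvalue_iff)
qed

lemma exists_lower_block_eigenvector:
  "\<exists>w k. w \<noteq> 0 \<and> w $ 1 = 0 \<and> lower_block A *v w = k *s w"
proof -
  let ?t = "A$2$2 - A$3$3"
  obtain k where k: "(A$2$2 - k) * (A$3$3 - k) = A$2$3 * A$3$2"
  proof
    define r where "r = csqrt (?t^2 + 4 * A$2$3 * A$3$2)"
    have r: "r * r = ?t * ?t + 4 * A$2$3 * A$3$2"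
      unfolding r_def by (metis power2_csqrt power2_eq_square)
    show "(A$2$2 - (A$2$2 + A$3$3 + r)/2) * (A$3$3 - (A$2$2 + A$3$3 + r)/2) = A$2$3 * A$3$2"
      using r by (simp add: field_simps)
  qed
  define M :: "complex^3^3"
    where "M = vector [vector [1, 0, 0], vector [0, A$2$2 - k, A$2$3], vector [0, A$3$2, A$3$3 - k]]"
  have "mat_eigenvalue M 0"
    using k by (simp add: mat_eigenvalue_iff det_3 M_def)
  then obtain w where w: "w \<noteq> 0" "M *v w = 0 *s w"
    unfolding mat_eigenvalue_def by blast
  then have "lower_block A *v w = k *s w" "w $ 1 = 0"
    by (simp_all add: M_def vec_eq_iff forall_3 matrix_vector_mult_def sum_3 algebra_simps)
  with w(1) show ?thesis by blast
qed

lemma exists_upper_conj_by: "\<exists>P. invertible P \<and> upper (conj_by P A)"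
proof -
  obtain k v where v: "v \<noteq> 0" "A *v v = k *s v"
    using exists_eigenvalue_3 unfolding mat_eigenvalue_def by blast
  obtain P :: "complex^3^3" where P: "invertible P" "P *v axis 1 1 = v"
    using exists_basis_with_first_vector[OF v(1)] by blast
  obtain w l where w: "w \<noteq> 0" "w $ 1 = 0" "lower_block (conj_by P A) *v w = l *s w"
    using exists_lower_block_eigenvector by blast
  obtain Q :: "complex^3^3" where Q: "invertible Q" "Q *v axis 1 1 = axis 1 1" "Q *v axis 2 1 = w"
    using exists_basis_with_second_vector[OF w(1,2)] by blast
  have "upper (conj_by Q (conj_by P A))"
    by (rule upper_conj_by[OF block_conj_by[OF P v(2)] w(3,2) Q])
  then show ?thesis
    using conj_by_conj_by[OF P(1) Q(1)] invertible_mult[OF P(1) Q(1)] by metis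
qed

lemma trace_conj_by: "invertible P \<Longrightarrow> trace (conj_by P A) = trace A"
  by (metis conj_by_def matrix_inv_right matrix_mul_assoc matrix_mul_lid trace_mul_sym)

text \<open>A triangular form of \<open>A\<close> exhibits its trace as a sum of three eigenvalues.\<close>

lemma norm_trace_le:
  fixes A :: "complex^3^3"
  assumes "\<And>k. mat_eigenvalue A k \<Longrightarrow> cmod k \<le> 1"
  shows "cmod (trace A) \<le> 3"
proof -
  obtain P where P: "invertible P" "upper (conj_by P A)" using exists_upper_conj_by by blast
  obtain a b c x y z where e: "conj_by P A = utri a b c x y z"
    using upper_eq_utri[OF P(2)] by blast
  have "cmod a \<le> 1" "cmod b \<le> 1" "cmod c \<le> 1"
    using assms mat_eigenvalue_conj_by[OF P(1), of A] mat_eigenvalue_utri unfolding e by metis+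
  moreover have "trace A = a + b + c"
    using trace_conj_by[OF P(1), of A] unfolding e by (simp add: trace_def sum_3)
  moreover have "cmod (a + b + c) \<le> cmod a + cmod b + cmod c"
    using norm_triangle_ineq[of "a + b" c] norm_triangle_ineq[of a b] by linarith
  ultimately show ?thesis by simp
qed


section \<open>Jordan chains\<close>

definition jordan_chain :: "complex^3^3 \<Rightarrow> bool" where
  "jordan_chain A \<longleftrightarrow> (\<exists>k u w. w \<noteq> 0 \<and> A *v w = k *s w \<and> A *v u = k *s u + w)"

lemma jordan_chain_conj_by:
  assumes "invertible P" "jordan_chain (conj_by P A)" shows "jordan_chain A"
proof -
  obtain k u w where w: "w \<noteq> 0" "conj_by P A *v w = k *s w" "conj_by P A *v u = k *s u + w"
    using assms(2) unfolding jordan_chain_def by blast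
  have "P *v w \<noteq> 0"
    by (metis assms(1) invertible_left_inverse matrix_left_invertible_ker w(1))
  moreover have "A *v (P *v w) = k *s (P *v w)"
    by (metis assms(1) conj_by_vec vector_scalar_commute w(2))
  moreover have "A *v (P *v u) = k *s (P *v u) + P *v w"
    by (metis assms(1) conj_by_vec vector_scalar_commute w(3) matrix_vector_right_distrib)
  ultimately show ?thesis unfolding jordan_chain_def by blast
qed

lemma utri_vec: "utri a b c x y z *v vector [\<upsilon>, \<upsilon>', \<upsilon>''] =
    vector [a * \<upsilon> + x * \<upsilon>' + z * \<upsilon>'', b * \<upsilon>' + y * \<upsilon>'', c * \<upsilon>'']"
  by (simp add: vec_eq_iff forall_3 matrix_vector_mult_def sum_3)

lemma jordan_chain_utriI:
  assumes "\<omega> \<noteq> 0 \<or> \<omega>' \<noteq> 0" "a * \<omega> + x * \<omega>' = k * \<omega>" "b * \<omega>' = k * \<omega>'"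
    "a * \<upsilon> + x * \<upsilon>' + z * \<upsilon>'' = k * \<upsilon> + \<omega>" "b * \<upsilon>' + y * \<upsilon>'' = k * \<upsilon>' + \<omega>'" "c * \<upsilon>'' = k * \<upsilon>''"
  shows "jordan_chain (utri a b c x y z)"
  unfolding jordan_chain_def
  by (rule exI[of _ k], rule exI[of _ "vector [\<upsilon>, \<upsilon>', \<upsilon>'']"], rule exI[of _ "vector [\<omega>, \<omega>', 0]"])
    (use assms in \<open>auto simp: utri_vec vec_eq_iff forall_3\<close>)

lemma diagonalizable_utriI:
  assumes "utri a b c x y z ** utri 1 1 1 p q r = utri 1 1 1 p q r ** utri a b c 0 0 0"
  shows "diagonalizable (utri a b c x y z)"
  by (rule diagonalizableI[OF _ assms]) (use utri_diagonal in \<open>auto intro: invertible_utri\<close>)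

text \<open>The cases are the coincidences among the three diagonal entries. In each of them one entry, or
  one combination of entries, above the diagonal decides: if it vanishes the eigenvectors span, and
  if it does not there is a Jordan chain of length two.\<close>

lemma diagonalizable_or_jordan_chain_utri:
  "diagonalizable (utri a b c x y z) \<or> jordan_chain (utri a b c x y z)"
proof -
  consider "a \<noteq> b" "b \<noteq> c" "a \<noteq> c" | "a = b" "x \<noteq> 0" | "a = b" "x = 0" "c = a" "y \<noteq> 0 \<or> z \<noteq> 0"
    | "a = b" "x = 0" "c = a" "y = 0" "z = 0" | "a = b" "x = 0" "c \<noteq> a"
    | "a \<noteq> b" "b = c" "y \<noteq> 0" | "a \<noteq> b" "b = c" "y = 0"
    | "a \<noteq> b" "a = c" "x * y + (a - b) * z \<noteq> 0" | "a \<noteq> b" "a = c" "x * y + (a - b) * z = 0"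
    by metis
  then show ?thesis
  proof cases
    case 1 then show ?thesis using diagonalizable_utri_distinct by blast
  next
    case 2 show ?thesis
      by (rule disjI2, rule jordan_chain_utriI[where k=a and \<omega>=x and \<omega>'=0 and \<upsilon>=0 and \<upsilon>'=1 and \<upsilon>''=0]) (use 2 in auto)
  next
    case 3 show ?thesis
      by (rule disjI2, rule jordan_chain_utriI[where k=a and \<omega>=z and \<omega>'=y and \<upsilon>=0 and \<upsilon>'=0 and \<upsilon>''=1]) (use 3 in auto)
  next
    case 4 then show ?thesis using diagonalizable_utri_diag by simp
  next
    case 5 show ?thesis
      by (rule disjI1, rule diagonalizable_utriI[where p=0 and q="y/(c-a)" and r="z/(c-a)"])
        (use 5 in \<open>simp add: utri_mult utri_eq_iff field_simps\<close>)
  next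
    case 6 show ?thesis
      by (rule disjI2, rule jordan_chain_utriI[where k=b and \<omega>="x*y/(b-a)" and \<omega>'=y
            and \<upsilon>="(x*y/(b-a)-z)/(a-b)" and \<upsilon>'=0 and \<upsilon>''=1])
        (use 6 in \<open>simp_all add: divide_simps\<close>, simp_all add: algebra_simps)
  next
    case 7 show ?thesis
      by (rule disjI1, rule diagonalizable_utriI[where p="x/(b-a)" and q=0 and r="z/(b-a)"])
        (use 7 in \<open>simp add: utri_mult utri_eq_iff divide_simps\<close>, simp add: algebra_simps)
  next
    case 8
    then have "x*(y/(a-b)) + z \<noteq> 0" by (simp add: divide_simps mult.commute)
    with 8(1,2) show ?thesis
      by (intro disjI2, rule_tac jordan_chain_utriI[where k=a and \<omega>="x*(y/(a-b))+z" and \<omega>'=0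
            and \<upsilon>=0 and \<upsilon>'="y/(a-b)" and \<upsilon>''=1])
        (simp_all add: divide_simps, simp_all add: algebra_simps)
  next
    case 9 
    then have "z = - (x * y / (a - b))" by (simp add: divide_simps add_eq_0_iff mult.commute)
    with 9(1,2) show ?thesis
      by (intro disjI1 diagonalizable_utriI[where p="x/(b-a)" and q="y/(a-b)" and r=0])
        (simp add: utri_mult utri_eq_iff divide_simps, simp add: algebra_simps)
  qed
qed

lemma diagonalizable_or_jordan_chain: "diagonalizable A \<or> jordan_chain A"
proof -
  obtain P where P: "invertible P" "upper (conj_by P A)" using exists_upper_conj_by by blast
  show ?thesis
    using diagonalizable_or_jordan_chain_utri upper_eq_utri[OF P(2)]
      jordan_chain_conj_by[OF P(1)] diagonalizable_conj_by[OF P(1)] by metis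
qed

lemma bounded_linear_mult_vec: "bounded_linear (\<lambda>h :: complex^3^3. h *v u)"
  unfolding linear_conv_bounded_linear[symmetric]
  by (rule linearI) (simp_all add: vec_eq_iff matrix_vector_mult_def sum_3 algebra_simps)

text \<open>Along a Jordan chain with unimodular eigenvalue the powers of \<open>A\<close> grow linearly, so that
  a matrix with such a chain cannot lie in a bounded semigroup.\<close>

lemma diagonalizable_of_bounded_powers:
  fixes A :: "complex^3^3"
  assumes S: "bounded S" "\<And>g h. g \<in> S \<Longrightarrow> h \<in> S \<Longrightarrow> g ** h \<in> S" and A: "A \<in> S"
    and ev: "\<And>k. mat_eigenvalue A k \<Longrightarrow> cmod k = 1"
  shows "diagonalizable A"
proof (rule ccontr)
  assume "\<not> diagonalizable A"
  then obtain k u w where w: "w \<noteq> 0" "A *v w = k *s w" "A *v u = k *s u + w"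
    using diagonalizable_or_jordan_chain[of A] unfolding jordan_chain_def by blast
  have k: "cmod k = 1" using w ev unfolding mat_eigenvalue_def by blast
  \<comment> \<open>The witness is the power of \<open>A\<close> with exponent \<open>n + 1\<close>.\<close>
  have pow: "\<exists>h\<in>S. h *v u = k ^ Suc n *s u + (of_nat (Suc n) * k ^ n) *s w" for n
  proof (induction n)
    case 0
    then show ?case using A w by auto
  next
    case (Suc n)
    then obtain h where h: "h \<in> S" "h *v u = k ^ Suc n *s u + (of_nat (Suc n) * k ^ n) *s w" by blast
    have "(A ** h) *v u = A *v (h *v u)" by (simp add: matrix_vector_mul_assoc)
    also have "\<dots> = k ^ Suc n *s (A *v u) + (of_nat (Suc n) * k ^ n) *s (A *v w)"
      unfolding h(2) by (simp only: matrix_vector_right_distrib vector_scalar_commute)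
    also have "\<dots> = k ^ Suc (Suc n) *s u + (of_nat (Suc (Suc n)) * k ^ Suc n) *s w"
      unfolding w by (simp add: vec_eq_iff algebra_simps)
    finally show ?case using S(2)[OF A h(1)] by blast
  qed
  obtain i where i: "w $ i \<noteq> 0" using w(1) by (auto simp: vec_eq_iff)
  have "bounded ((\<lambda>h. h *v u) ` S)"
    by (rule bounded_linear_image[OF S(1) bounded_linear_mult_vec])
  then obtain B where B: "\<And>h. h \<in> S \<Longrightarrow> norm (h *v u) \<le> B" by (auto simp: bounded_iff)
  have "of_nat (Suc n) * cmod (w $ i) \<le> B + cmod (u $ i)" for n
  proof -
    obtain h where h: "h \<in> S" "h *v u = k ^ Suc n *s u + (of_nat (Suc n) * k ^ n) *s w"
      using pow by blast
    have "of_nat (Suc n) * k ^ n * w $ i = (h *v u) $ i - k ^ Suc n * u $ i"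
      unfolding h(2) by simp
    then have "cmod (of_nat (Suc n) * k ^ n * w $ i) \<le> cmod ((h *v u) $ i) + cmod (k ^ Suc n * u $ i)"
      by (metis norm_triangle_ineq4)
    moreover have "cmod ((h *v u) $ i) \<le> B"
      using B[OF h(1)] Finite_Cartesian_Product.norm_nth_le[of "h *v u" i] by linarith
    moreover have "cmod (of_nat (Suc n) * k ^ n * w $ i) = of_nat (Suc n) * cmod (w $ i)"
      "cmod (k ^ Suc n * u $ i) = cmod (u $ i)"
      by (simp_all only: norm_mult norm_power k norm_of_nat) simp_all
    ultimately show ?thesis by linarith
  qed
  moreover obtain n where "B + cmod (u $ i) < of_nat n * cmod (w $ i)"
    using reals_Archimedean3[of "cmod (w $ i)"] i by auto
  ultimately have "of_nat (Suc n) * cmod (w $ i) < of_nat n * cmod (w $ i)"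
    by (meson le_less_trans)
  then show False by (simp add: algebra_simps)
qed

section \<open>Matrix semigroups with bounded traces\<close>

text \<open>By Newton's identities the characteristic polynomial of \<open>c\<close> is \<open>X ^ 3\<close>, so that 1 is
  not a root of it.\<close>

lemma det_minus_one_of_traces_zero:
  fixes c :: "complex^3^3"
  assumes "trace c = 0" "trace (c ** c) = 0" "trace (c ** c ** c) = 0"
  shows "det (c - mat 1) \<noteq> 0"
proof -
  have "6 * det (c - mat 1) = trace c ^ 3 - 3 * trace c * trace (c ** c) + 2 * trace (c ** c ** c)
      - 3 * (trace c ^ 2 - trace (c ** c)) + 6 * trace c - 6"
    by (simp add: det_3 trace_def sum_3 matrix_matrix_mult_def mat_def) algebra
  then show ?thesis using assms by auto
qed

lemma scaleR_mult_3:
  fixes A B :: "complex^3^3"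
  shows "(r *\<^sub>R A) ** B = r *\<^sub>R (A ** B)" "A ** (r *\<^sub>R B) = r *\<^sub>R (A ** B)"
  by (simp_all add: vec_eq_iff matrix_matrix_mult_def scaleR_sum_right)

lemma matrix_add_rdistrib: "(A + B) ** C = A ** C + B ** (C :: complex^3^3)"
  by (simp add: vec_eq_iff matrix_matrix_mult_def sum.distrib distrib_right)

lemma span_mult_closed:
  fixes S :: "(complex^3^3) set"
  assumes S: "\<And>a b. a \<in> S \<Longrightarrow> b \<in> S \<Longrightarrow> a ** b \<in> S" and a: "a \<in> span S" and b: "b \<in> span S"
  shows "a ** b \<in> span S"
proof -
  have 1: "s ** b \<in> span S" if s: "s \<in> S" for s
    using b
  proof (induction rule: span_induct)
    case base
    show ?case
      unfolding subspace_def mem_Collect_eq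
      by (auto simp: matrix_add_ldistrib scaleR_mult_3 span_add span_scale span_zero)
  next
    case (step t)
    then show ?case using S[OF s] span_base by blast
  qed
  show ?thesis
    using a
  proof (induction rule: span_induct)
    case base
    show ?case
      unfolding subspace_def mem_Collect_eq
      by (auto simp: matrix_add_rdistrib scaleR_mult_3 span_add span_scale span_zero)
  next
    case (step t)
    then show ?case by (rule 1)
  qed
qed

lemma scale_eq_scaleR:
  fixes A :: "complex^3^3"
  shows "mat x ** A = Re x *\<^sub>R A + Im x *\<^sub>R (mat \<i> ** A)"
  unfolding mat_scale_left by (simp add: vec_eq_iff complex_eq_iff)

lemma span_scale_closed:
  fixes S :: "(complex^3^3) set"
  assumes S: "\<And>a. a \<in> S \<Longrightarrow> mat \<i> ** a \<in> S" and a: "a \<in> span S"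
  shows "mat x ** a \<in> span S"
proof -
  have "mat \<i> ** a \<in> span S"
    using a
  proof (induction rule: span_induct)
    case base
    show ?case
      unfolding subspace_def mem_Collect_eq
      by (auto simp: matrix_add_ldistrib scaleR_mult_3 span_add span_scale span_zero)
  next
    case (step t)
    then show ?case using S span_base by blast
  qed
  then show ?thesis unfolding scale_eq_scaleR[of x a] using a by (intro span_add span_scale)
qed

text \<open>Let \<open>A\<close> be the real span of \<open>S\<close>; it is a complex algebra. The trace form \<open>(a, b) \<mapsto> Re (trace (a ** b))\<close>
  is nondegenerate on \<open>A\<close>: if \<open>a \<noteq> 0\<close> were in its radical, the last hypothesis gives \<open>b\<close> such
  that \<open>c = b ** a\<close> has the eigenvalue 1, while \<open>c\<close> is again in the radical, whence
  \<open>c\<close>, \<open>c ^ 2\<close>, \<open>c ^ 3\<close> have trace 0. Therefore an element \<open>s\<close> of \<open>S\<close> is determined, linearly and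
  hence with a bound, by its trace products with a basis of \<open>A\<close> taken from \<open>S\<close>; these are
  traces of elements of \<open>S\<close>. The last hypothesis holds when \<open>A\<close> acts irreducibly: choose \<open>v\<close> with
  \<open>a *v v \<noteq> 0\<close> and then \<open>b\<close> that moves \<open>a *v v\<close> back to \<open>v\<close>.\<close>

lemma bounded_of_bounded_traces:
  fixes S :: "(complex^3^3) set"
  assumes mult: "\<And>a b. a \<in> S \<Longrightarrow> b \<in> S \<Longrightarrow> a ** b \<in> S"
    and scal: "\<And>a. a \<in> S \<Longrightarrow> mat \<i> ** a \<in> S"
    and tr: "\<And>a. a \<in> S \<Longrightarrow> cmod (trace a) \<le> C"
    and irr: "\<And>a. a \<in> span S \<Longrightarrow> a \<noteq> 0 \<Longrightarrow> \<exists>b\<in>span S. \<exists>v. v \<noteq> 0 \<and> (b ** a) *v v = v"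
  shows "bounded S"
proof -
  have lin: "linear (\<lambda>t. Re (trace (a ** t)))" for a :: "complex^3^3"
    by (rule linearI) (simp_all add: matrix_add_ldistrib scaleR_mult_3 trace_add,
        simp add: trace_def sum_3 algebra_simps)
  have lin': "linear (\<lambda>t. Re (trace (t ** a)))" for a :: "complex^3^3"
    by (rule linearI) (simp_all add: matrix_add_rdistrib scaleR_mult_3 trace_add,
        simp add: trace_def sum_3 algebra_simps)
  have nondeg: "a = 0" if a: "a \<in> span S" and z: "\<And>s. s \<in> S \<Longrightarrow> Re (trace (a ** s)) = 0" for a
  proof (rule ccontr)
    assume "a \<noteq> 0"
    then obtain b v where b: "b \<in> span S" and v: "v \<noteq> 0" "(b ** a) *v v = v"
      using irr[OF a] by blast
    have re: "Re (trace (a ** t)) = 0" if "t \<in> span S" for t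
      using linear_eq_on_span[OF lin, of "\<lambda>_. 0"] z that module_hom_zero by blast
    have tz: "trace (a ** t) = 0" if t: "t \<in> span S" for t
    proof -
      have "trace (a ** (mat \<i> ** t)) = \<i> * trace (a ** t)"
      proof -
        have "a ** (mat \<i> ** t) = mat \<i> ** (a ** t)" by (metis mat_commute matrix_mul_assoc)
        then show ?thesis
          by (simp add: mat_scale_left[of \<i> "a ** t"] trace_def sum_distrib_left)
      qed
      then have "Im (trace (a ** t)) = 0" using re[OF span_scale_closed[OF scal t], of \<i>] by simp
      with re[OF t] show ?thesis by (simp add: complex_eq_iff)
    qed
    define c where "c = b ** a"
    have sp: "p ** q \<in> span S" if "p \<in> span S" "q \<in> span S" for p q
      using span_mult_closed[of S p q] mult that by blast
    have "trace c = 0" unfolding c_def using tz[OF b] trace_mul_sym by metis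
    moreover have "trace (c ** c) = 0"
      using tz[OF sp[OF sp[OF b a] b]] trace_mul_sym[of b "a ** b ** a"]
      by (simp add: c_def matrix_mul_assoc)
    moreover have "trace (c ** c ** c) = 0"
      using tz[OF sp[OF sp[OF sp[OF sp[OF b a] b] a] b]] trace_mul_sym[of b "a ** b ** a ** b ** a"]
      by (simp add: c_def matrix_mul_assoc)
    ultimately have "\<not> mat_eigenvalue c 1"
      using det_minus_one_of_traces_zero mat_eigenvalue_iff by blast
    moreover have "mat_eigenvalue c 1"
      unfolding mat_eigenvalue_def using v by (auto simp: c_def)
    ultimately show False by blast
  qed
  obtain B where B: "B \<subseteq> S" "independent B" "S \<subseteq> span B"
    using maximal_independent_subset by blast
  have fB: "finite B" using B(2) independent_imp_finite by blast
  define L where "L a = (\<Sum>b\<in>B. Re (trace (a ** b)) *\<^sub>R b)" for a :: "complex^3^3"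
  have "linear L"
    unfolding L_def
    by (intro linear_compose_sum ballI linearI)
      (simp_all add: linear_add[OF lin'] linear_scale[OF lin'] scaleR_left_distrib)
  then have bl: "bounded_linear L" using linear_conv_bounded_linear by blast
  have inj: "\<forall>a\<in>span S. L a = 0 \<longrightarrow> a = 0"
  proof (intro ballI impI)
    fix a assume a: "a \<in> span S" "L a = 0"
    have "\<forall>b\<in>B. Re (trace (a ** b)) = 0"
      using a(2) B(2) fB unfolding L_def by (auto dest: independentD)
    then have "Re (trace (a ** s)) = 0" if "s \<in> span B" for s
      using linear_eq_on_span[OF lin, of "\<lambda>_. 0"] that module_hom_zero by blast
    then show "a = 0" using nondeg[OF a(1)] B(3) by blast
  qed
  obtain e where e: "e > 0" "\<And>x. x \<in> span S \<Longrightarrow> e * norm x \<le> norm (L x)"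
    using injective_imp_isometric[OF closed_subspace[OF subspace_span] subspace_span bl inj] by blast
  have "norm s \<le> (\<Sum>b\<in>B. C * norm b) / e" if s: "s \<in> S" for s
  proof -
    have "norm (L s) \<le> (\<Sum>b\<in>B. norm (Re (trace (s ** b)) *\<^sub>R b))"
      unfolding L_def by (rule norm_sum)
    also have "\<dots> \<le> (\<Sum>b\<in>B. C * norm b)"
    proof (rule sum_mono)
      fix b assume "b \<in> B"
      then have "cmod (trace (s ** b)) \<le> C" using B(1) mult[OF s] tr by blast
      then have "\<bar>Re (trace (s ** b))\<bar> \<le> C" using abs_Re_le_cmod order_trans by blast
      then show "norm (Re (trace (s ** b)) *\<^sub>R b) \<le> C * norm b" by (simp add: mult_right_mono)
    qed
    finally have "e * norm s \<le> (\<Sum>b\<in>B. C * norm b)" using e(2)[OF span_base[OF s]] by linarith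
    then show ?thesis using e(1) by (simp add: field_simps)
  qed
  then show ?thesis by (auto simp: bounded_iff)
qed


section \<open>Groups of lifts\<close>

text \<open>The group of all unimodular multiples of the lifts of a purely parabolic discrete group. Having all
  unimodular scalars in \<open>\<Gamma>\<close> makes its real span a complex space, and it allows one diagonal
  entry of a triangular element to be normalized to 1. Discreteness is stated with sequences and modulo
  scalars, the form in which it survives conjugation and is applied to iterated commutators.\<close>

locale parabolic_lifts =
  fixes \<Gamma> :: "(complex^3^3) set"
  assumes scalars: "cmod c = 1 \<Longrightarrow> mat c \<in> \<Gamma>"
    and mult_closed: "g \<in> \<Gamma> \<Longrightarrow> h \<in> \<Gamma> \<Longrightarrow> g ** h \<in> \<Gamma>"
    and inverses: "g \<in> \<Gamma> \<Longrightarrow> \<exists>h\<in>\<Gamma>. g ** h = mat 1"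
    and diagonalizable_imp_scalar: "g \<in> \<Gamma> \<Longrightarrow> diagonalizable g \<Longrightarrow> \<exists>c. g = mat c"
    and eigenvalue_norm: "g \<in> \<Gamma> \<Longrightarrow> mat_eigenvalue g k \<Longrightarrow> cmod k = 1"
    and no_limit: "(\<And>n. X n \<in> \<Gamma>) \<Longrightarrow> X \<longlonglongrightarrow> mat 1 \<Longrightarrow> \<exists>n c. X n = mat c"

lemma tendsto_mult_mult:
  fixes X :: "nat \<Rightarrow> complex^3^3"
  assumes "X \<longlonglongrightarrow> A" shows "(\<lambda>n. B ** X n ** C) \<longlonglongrightarrow> B ** A ** C"
  unfolding matrix_matrix_mult_def
  by (intro vec_tendstoI) (auto intro!: tendsto_intros tendsto_vec_nth assms)

lemma parabolic_lifts_conj_by: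
  assumes "parabolic_lifts \<Gamma>" and P: "invertible P"
  shows "parabolic_lifts (conj_by P ` \<Gamma>)"
proof -
  interpret parabolic_lifts \<Gamma> by fact
  show ?thesis
  proof
    fix c :: complex assume "cmod c = 1"
    then show "mat c \<in> conj_by P ` \<Gamma>"
      using scalars conj_by_mat[OF P] by (metis image_eqI)
  next
    fix g h assume "g \<in> conj_by P ` \<Gamma>" "h \<in> conj_by P ` \<Gamma>"
    then show "g ** h \<in> conj_by P ` \<Gamma>"
      using mult_closed by (auto simp: conj_by_mul[OF P, symmetric])
  next
    fix g assume "g \<in> conj_by P ` \<Gamma>"
    then obtain g' h where "g = conj_by P g'" "g' \<in> \<Gamma>" "h \<in> \<Gamma>" "g' ** h = mat 1"
      using inverses by blast
    then show "\<exists>h\<in>conj_by P ` \<Gamma>. g ** h = mat 1"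
      using conj_by_mul[OF P] conj_by_one[OF P] by (metis image_eqI)
  next
    fix g assume "g \<in> conj_by P ` \<Gamma>" "diagonalizable g"
    then show "\<exists>c. g = mat c"
      using diagonalizable_imp_scalar diagonalizable_conj_by[OF P] conj_by_mat[OF P] by (metis imageE)
  next
    fix g k assume "g \<in> conj_by P ` \<Gamma>" "mat_eigenvalue g k"
    then show "cmod k = 1" using eigenvalue_norm mat_eigenvalue_conj_by[OF P] by blast
  next
    fix X assume X: "\<And>n. X n \<in> conj_by P ` \<Gamma>" "X \<longlonglongrightarrow> mat 1"
    define Y where "Y n = P ** X n ** matrix_inv P" for n
    have Y: "Y n \<in> \<Gamma> \<and> X n = conj_by P (Y n)" for n
    proof -
      obtain g where g: "g \<in> \<Gamma>" "X n = conj_by P g" using X(1) by blast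
      have "Y n = g"
        unfolding Y_def g(2) mult_conj_by[OF P]
        by (simp add: matrix_mul_assoc[symmetric] matrix_inv_right[OF P])
      with g show ?thesis by simp
    qed
    have "Y \<longlonglongrightarrow> P ** mat 1 ** matrix_inv P"
      unfolding Y_def by (rule tendsto_mult_mult[OF X(2)])
    then have "Y \<longlonglongrightarrow> mat 1" by (simp add: matrix_inv_right[OF P])
    then obtain n c where "Y n = mat c" using no_limit Y by blast
    then show "\<exists>n c. X n = mat c" using Y conj_by_mat[OF P] by metis
  qed
qed

lemma parabolic_lifts_transpose:
  assumes "parabolic_lifts \<Gamma>"
  shows "parabolic_lifts (transpose ` \<Gamma>)"
proof -
  interpret parabolic_lifts \<Gamma> by fact
  show ?thesis
  proof
    fix c :: complex assume "cmod c = 1"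
    then show "mat c \<in> transpose ` \<Gamma>"
      using scalars transpose_mat by (metis image_eqI)
  next
    fix g h assume "g \<in> transpose ` \<Gamma>" "h \<in> transpose ` \<Gamma>"
    then show "g ** h \<in> transpose ` \<Gamma>"
      using mult_closed by (auto simp: matrix_transpose_mul[symmetric])
  next
    fix g assume "g \<in> transpose ` \<Gamma>"
    then obtain g' h where g: "g = transpose g'" "g' \<in> \<Gamma>" "h \<in> \<Gamma>" "g' ** h = mat 1"
      using inverses by blast
    then have "h ** g' = mat 1" using matrix_left_right_inverse by blast
    then have "g ** transpose h = mat 1"
      unfolding g(1) by (metis matrix_transpose_mul transpose_mat)
    then show "\<exists>h\<in>transpose ` \<Gamma>. g ** h = mat 1" using g(3) by blast
  next
    fix g assume "g \<in> transpose ` \<Gamma>" "diagonalizable g"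
    then obtain g' where g: "g = transpose g'" "g' \<in> \<Gamma>" "diagonalizable g'"
      using diagonalizable_transpose by blast
    then obtain c where "g' = mat c" using diagonalizable_imp_scalar by blast
    then show "\<exists>c. g = mat c" using g(1) transpose_mat by metis
  next
    fix g k assume "g \<in> transpose ` \<Gamma>" "mat_eigenvalue g k"
    then show "cmod k = 1" using eigenvalue_norm mat_eigenvalue_transpose by blast
  next
    fix X assume X: "\<And>n. X n \<in> transpose ` \<Gamma>" "X \<longlonglongrightarrow> mat 1"
    have 1: "transpose (X n) \<in> \<Gamma>" for n using X(1)[of n] by auto
    have "(\<lambda>n. transpose (X n)) \<longlonglongrightarrow> transpose (mat 1)"
      unfolding transpose_def
      by (intro vec_tendstoI) (auto intro!: tendsto_vec_nth X(2))
    then have 2: "(\<lambda>n. transpose (X n)) \<longlonglongrightarrow> mat 1" by simp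
    obtain n c where "transpose (X n) = mat c" using no_limit[OF 1 2] by blast
    then have "X n = mat c" by (metis transpose_mat transpose_transpose)
    then show "\<exists>n c. X n = mat c" by blast
  qed
qed

section \<open>Reducibility\<close>

lemma transpose_nth: "transpose A $ i $ j = A $ j $ i"
  by (simp add: transpose_def)

context parabolic_lifts begin

lemma mat_one_in: "mat 1 \<in> \<Gamma>"
  by (rule scalars) simp

lemma scale_closed: "cmod c = 1 \<Longrightarrow> g \<in> \<Gamma> \<Longrightarrow> mat c ** g \<in> \<Gamma>"
  by (simp add: scalars mult_closed)

lemma scalar_of_bounded:
  assumes "bounded \<Gamma>" "g \<in> \<Gamma>" shows "\<exists>c. g = mat c"
proof (rule diagonalizable_imp_scalar[OF assms(2)])
  show "diagonalizable g"
    by (rule diagonalizable_of_bounded_powers[OF assms(1) _ assms(2)])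
      (use mult_closed eigenvalue_norm assms(2) in auto)
qed

lemma norm_trace: "g \<in> \<Gamma> \<Longrightarrow> cmod (trace g) \<le> 3"
  using eigenvalue_norm by (intro norm_trace_le) auto

text \<open>Reducibility. Suppose that no vector and no covector is an eigenvector of all of \<open>\<Gamma>\<close>. The orbit
  of every nonzero vector \<open>w\<close> spans: with \<open>y = g *v w\<close> off the line of \<open>w\<close>, the
  covector \<open>cross w y\<close> does not vanish on the whole orbit, because otherwise every transpose would map it to a
  covector that kills \<open>w\<close> and \<open>y\<close>, that is, to a multiple of itself. So \<open>\<Gamma>\<close> acts irreducibly and,
  its traces being bounded by 3, it is bounded. But then all elements are diagonalizable, hence scalar.\<close>

lemma exists_common_eigenvector:
  "(\<exists>v. v \<noteq> 0 \<and> (\<forall>g\<in>\<Gamma>. \<exists>k. g *v v = k *s v)) \<or>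
   (\<exists>v. v \<noteq> 0 \<and> (\<forall>g\<in>\<Gamma>. \<exists>k. transpose g *v v = k *s v))"
proof (rule ccontr)
  assume neg: "\<not> ?thesis"
  have ev: "\<exists>g\<in>\<Gamma>. \<forall>k. g *v v \<noteq> k *s v" if "v \<noteq> 0" for v using neg that by blast
  have ev': "\<exists>g\<in>\<Gamma>. \<forall>k. transpose g *v v \<noteq> k *s v" if "v \<noteq> 0" for v using neg that by blast
  have "bounded \<Gamma>"
  proof (rule bounded_of_bounded_traces[where C = 3])
    show "mat \<i> ** a \<in> \<Gamma>" if "a \<in> \<Gamma>" for a using that by (simp add: scale_closed)
    then have sc: "mat x ** a \<in> span \<Gamma>" if "a \<in> \<Gamma>" for x a
      using span_scale_closed[OF _ span_base[OF that]] by blast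
    fix a assume "a \<in> span \<Gamma>" "a \<noteq> 0"
    then obtain u where u: "a *v u \<noteq> 0" by (metis matrix_eq matrix_vector_mult_0)
    define w where "w = a *v u"
    have w: "w \<noteq> 0" using u by (simp add: w_def)
    obtain g where g: "g \<in> \<Gamma>" "\<And>k. g *v w \<noteq> k *s w" using ev[OF w] by blast
    define y where "y = g *v w"
    define c where "c = cross w y"
    have c: "c \<noteq> 0" using cross_eq_0_imp_parallel[of w y] g(2) w by (auto simp: c_def y_def)
    obtain f where f: "f \<in> \<Gamma>" "\<And>k. transpose f *v c \<noteq> k *s c" using ev'[OF c] by blast
    have "\<exists>h\<in>\<Gamma>. c$1 * (h *v w)$1 + c$2 * (h *v w)$2 + c$3 * (h *v w)$3 \<noteq> 0"
    proof (rule ccontr)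
      assume "\<not> ?thesis"
      then have z: "c$1 * (h *v w)$1 + c$2 * (h *v w)$2 + c$3 * (h *v w)$3 = 0" if "h \<in> \<Gamma>" for h
        using that by blast
      define p where "p = transpose f *v c"
      have dot: "p$1 * x$1 + p$2 * x$2 + p$3 * x$3 =
          c$1 * (f *v x)$1 + c$2 * (f *v x)$2 + c$3 * (f *v x)$3" for x
        by (simp add: p_def vector_matrix_mult_def matrix_vector_mult_def sum_3 algebra_simps transpose_nth)
      have "p$1 * w$1 + p$2 * w$2 + p$3 * w$3 = 0" using dot z[OF f(1)] by metis
      moreover have "p$1 * y$1 + p$2 * y$2 + p$3 * y$3 = 0"
        using dot z[OF mult_closed[OF f(1) g(1)]] by (metis y_def matrix_vector_mul_assoc)
      \<comment> \<open>The expansion of the double vector product \<open>cross (cross w y) p\<close>.\<close>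
      moreover have "cross c p = (p$1 * w$1 + p$2 * w$2 + p$3 * w$3) *s y
          - (p$1 * y$1 + p$2 * y$2 + p$3 * y$3) *s w"
        by (simp add: c_def vec_eq_iff forall_3 algebra_simps)
      ultimately have "cross c p = 0" by simp
      then obtain k where "p = k *s c" using cross_eq_0_imp_parallel c by blast
      then show False using f(2)[of k] p_def by metis
    qed
    then obtain h where h: "h \<in> \<Gamma>"
      "c$1 * (h *v w)$1 + c$2 * (h *v w)$2 + c$3 * (h *v w)$3 \<noteq> 0" by blast
    define M :: "complex^3^3" where
      "M = transpose (vector [w, y, h *v w])"
    have "det M \<noteq> 0"
    proof -
      have "det M = c$1 * (h *v w)$1 + c$2 * (h *v w)$2 + c$3 * (h *v w)$3"
        unfolding M_def det_transpose by (simp add: det_3 c_def algebra_simps)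
      then show ?thesis using h(2) by simp
    qed
    then obtain N where N: "M ** N = mat 1"
      using invertible_det_nz invertible_right_inverse by blast
    define x where "x = N *v u"
    have "M *v x = u" by (simp add: x_def matrix_vector_mul_assoc N)
    define b where "b = mat (x$1) ** mat 1 + mat (x$2) ** g + mat (x$3) ** h"
    have "b \<in> span \<Gamma>" unfolding b_def by (intro span_add sc mat_one_in g h)
    moreover have "(b ** a) *v u = u"
    proof -
      have "(b ** a) *v u = b *v w" by (simp add: w_def matrix_vector_mul_assoc)
      also have "\<dots> = x$1 *s w + x$2 *s y + x$3 *s (h *v w)"
        by (simp add: b_def y_def matrix_vector_mult_add_rdistrib
            matrix_vector_mul_assoc[symmetric] mat_mult_vec)
      also have "\<dots> = M *v x"
        by (simp add: M_def vec_eq_iff forall_3 vector_matrix_mult_def sum_3 algebra_simps transpose_nth)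
      finally show ?thesis by (simp add: \<open>M *v x = u\<close>)
    qed
    moreover have "u \<noteq> 0" using u by auto
    ultimately show "\<exists>b\<in>span \<Gamma>. \<exists>v. v \<noteq> 0 \<and> (b ** a) *v v = v" by blast
  qed (use mult_closed norm_trace in auto)
  then have "\<exists>k. g *v axis 1 1 = k *s axis 1 1" if "g \<in> \<Gamma>" for g
    using scalar_of_bounded[OF _ that] mat_mult_vec by metis
  moreover have "axis 1 1 \<noteq> (0 :: complex^3)" by (simp add: axis_eq_0_iff)
  ultimately show False using neg by blast
qed

end

lemma parallel_2:
  fixes z x :: "complex^2"
  assumes "z$1 * x$2 = z$2 * x$1" "z \<noteq> 0" shows "\<exists>k. x = k *s z"
proof (cases "z$1 = 0")
  case True
  then have "z$2 \<noteq> 0" using assms(2) by (auto simp: vec_eq_iff forall_2)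
  then have "x = (x$2 / z$2) *s z" using assms(1) True by (simp add: vec_eq_iff forall_2)
  then show ?thesis by blast
next
  case False
  then have "x = (x$1 / z$1) *s z" using assms(1) by (simp add: vec_eq_iff forall_2 field_simps)
  then show ?thesis by blast
qed

text \<open>All elements are unipotent. If \<open>N = A - 1 \<noteq> 0\<close>, then comparing the traces of \<open>A ** B\<close> and \<open>B\<close> gives
  \<open>trace (N ** B) = 0\<close>. Since \<open>N\<close> has rank one and square zero, this says that \<open>B\<close> preserves the
  image of \<open>N\<close>.\<close>

lemma common_eigenvector_2_unipotent:
  fixes M :: "(complex^2^2) set"
  assumes mult: "\<And>A B. A \<in> M \<Longrightarrow> B \<in> M \<Longrightarrow> A ** B \<in> M"
    and tr: "\<And>A. A \<in> M \<Longrightarrow> trace A = 2" and det: "\<And>A. A \<in> M \<Longrightarrow> det A = 1"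
  shows "\<exists>w. w \<noteq> 0 \<and> (\<forall>A\<in>M. \<exists>k. A *v w = k *s w)"
proof (cases "\<forall>A\<in>M. A = mat 1")
  case True
  then have "\<forall>A\<in>M. A *v axis 1 1 = 1 *s axis 1 1" by (auto simp: matrix_vector_mul_lid)
  then show ?thesis by (metis axis_eq_0_iff zero_neq_one)
next
  case False
  then obtain A where A: "A \<in> M" "A \<noteq> mat 1" by blast
  define a b c where "a = A$1$1 - 1" and "b = A$1$2" and "c = A$2$1"
  have d: "A$2$2 = 1 - a" using tr[OF A(1)] by (simp add: trace_def sum_2 a_def algebra_simps)
  have A11: "A$1$1 = 1 + a" by (simp add: a_def)
  have abc: "a * a = - b * c"
    using det[OF A(1)] by (simp add: det_2 d A11 b_def c_def algebra_simps eq_neg_iff_add_eq_0)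
  have nz: "a \<noteq> 0 \<or> b \<noteq> 0 \<or> c \<noteq> 0"
    using A(2) d A11 by (auto simp: vec_eq_iff forall_2 mat_def b_def c_def)
  have key: "a * B$1$1 + b * B$2$1 + c * B$1$2 - a * B$2$2 = 0" if B: "B \<in> M" for B
  proof -
    have "(1 + a) * B$1$1 + b * B$2$1 + (c * B$1$2 + (1 - a) * B$2$2) = 2" "B$1$1 + B$2$2 = 2"
      using tr[OF mult[OF A(1) B]] tr[OF B]
      by (simp_all add: trace_def sum_2 matrix_matrix_mult_def d A11 b_def c_def)
    moreover have "a * B$1$1 + b * B$2$1 + c * B$1$2 - a * B$2$2 =
        (1 + a) * B$1$1 + b * B$2$1 + (c * B$1$2 + (1 - a) * B$2$2) - (B$1$1 + B$2$2)"
      by (simp add: algebra_simps)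
    ultimately show ?thesis by simp
  qed
  show ?thesis
  proof (cases "c = 0")
    case True
    then have "a = 0" "b \<noteq> 0" using abc nz by auto
    then have "B$2$1 = 0" if "B \<in> M" for B using key[OF that] True by simp
    then have "B *v axis 1 1 = B$1$1 *s axis 1 1" if "B \<in> M" for B
      using that by (simp add: vec_eq_iff forall_2 axis_mult_nth axis_one_nth)
    then show ?thesis by (metis axis_eq_0_iff zero_neq_one)
  next
    case False
    define w :: "complex^2" where "w = vector [a, c]"
    have w: "w \<noteq> 0" using False by (simp add: w_def vec_eq_iff forall_2)
    have "\<exists>k. B *v w = k *s w" if B: "B \<in> M" for B
    proof (rule parallel_2[OF _ w])
      have 1: "a * B$1$1 + c * B$1$2 = a * B$2$2 - b * B$2$1"
        using key[OF B] by (simp add: algebra_simps)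
      have "b * c = - (a * a)" using abc by simp
      then have "c * (a * B$2$2 - b * B$2$1) = a * (a * B$2$1 + c * B$2$2)" by algebra
      then have "c * (a * B$1$1 + c * B$1$2) = a * (a * B$2$1 + c * B$2$2)" unfolding 1 .
      then show "w$1 * (B *v w)$2 = w$2 * (B *v w)$1"
        by (simp add: w_def matrix_vector_mult_def sum_2 algebra_simps)
    qed
    with w show ?thesis by blast
  qed
qed

text \<open>The hypothesis on the trace says that 1 is an eigenvalue of every element, so that \<open>M\<close> has the traces of
  a sum of two characters. Unless all elements are unipotent, some \<open>A\<close> has the eigenvalues 1 and \<open>\<alpha> \<noteq> 1\<close>. In the eigenbasis of \<open>A\<close>,
  the traces of \<open>B\<close> and \<open>A ** B\<close> determine the diagonal of \<open>B\<close>, namely \<open>1\<close> and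
  \<open>det B\<close>, and then one of its off-diagonal entries vanishes. The product of an upper and a lower triangular
  element with nonzero off-diagonal entries would have both of them nonzero, and thus all elements are
  triangular on the same side.\<close>

lemma common_eigenvector_2:
  fixes M :: "(complex^2^2) set"
  assumes mult: "\<And>A B. A \<in> M \<Longrightarrow> B \<in> M \<Longrightarrow> A ** B \<in> M"
    and tr: "\<And>A. A \<in> M \<Longrightarrow> trace A = 1 + det A" and det: "\<And>A. A \<in> M \<Longrightarrow> det A \<noteq> 0"
  shows "\<exists>w. w \<noteq> 0 \<and> (\<forall>A\<in>M. \<exists>k. A *v w = k *s w)"
proof (cases "\<forall>A\<in>M. det A = 1")
  case True
  then show ?thesis using common_eigenvector_2_unipotent[OF mult] tr by simp
next
  case False
  then obtain A where A: "A \<in> M" "det A \<noteq> 1" by blast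
  define \<alpha> where "\<alpha> = det A"
  have tA: "A$1$1 + A$2$2 = 1 + (A$1$1 * A$2$2 - A$1$2 * A$2$1)"
    using tr[OF A(1)] by (simp add: trace_def sum_2 det_2)
  have "det (A - mat 1) = 0" "det (A - mat \<alpha>) = 0"
    unfolding \<alpha>_def det_2 using tA by (simp_all add: mat_def, algebra+)
  then obtain z x where z: "z \<noteq> 0" "A *v z = 1 *s z" and x: "x \<noteq> 0" "A *v x = \<alpha> *s x"
    unfolding mat_eigenvalue_iff[symmetric] mat_eigenvalue_def by blast
  define P :: "complex^2^2" where "P = transpose (vector [z, x])"
  have "det P \<noteq> 0"
  proof
    assume "det P = 0"
    then obtain k where k: "x = k *s z"
      using parallel_2[OF _ z(1), of x] by (auto simp: P_def det_2 transpose_nth algebra_simps)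
    then have "\<alpha> *s x = x" using x(2) z(2) by (simp add: vector_scalar_commute)
    then show False using x(1) A(2) by (auto simp: \<alpha>_def vec_eq_iff)
  qed
  then have P: "invertible P" by (simp add: invertible_det_nz)
  have P1: "P *v axis 1 1 = z" "P *v axis 2 1 = x"
    by (simp_all add: vec_eq_iff forall_2 axis_mult_nth P_def transpose_def)
  have "conj_by P A *v axis 1 1 = axis 1 1" "conj_by P A *v axis 2 1 = \<alpha> *s axis 2 1"
    by (rule conj_by_vec_eq[OF P], simp add: P1 z x vector_scalar_commute)+
  then have D: "conj_by P A $ i $ 1 = axis 1 1 $ i" "conj_by P A $ i $ 2 = (\<alpha> *s axis 2 1) $ i" for i
    by (metis axis_mult_nth)+
  let ?c = "conj_by P"
  have sd: "?c B $ 1 $ 1 = 1" "?c B $ 2 $ 2 = det B" "?c B $ 1 $ 2 * ?c B $ 2 $ 1 = 0"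
    if B: "B \<in> M" for B
  proof -
    have t1: "?c B $ 1 $ 1 + ?c B $ 2 $ 2 = 1 + det B"
      using trace_conj_by[OF P, of B] tr[OF B] by (simp add: trace_def sum_2)
    have "trace (?c (A ** B)) = 1 + \<alpha> * det B"
      using trace_conj_by[OF P, of "A ** B"] tr[OF mult[OF A(1) B]] by (simp add: det_mul \<alpha>_def)
    then have t2: "?c B $ 1 $ 1 + \<alpha> * ?c B $ 2 $ 2 = 1 + \<alpha> * det B"
      unfolding conj_by_mul[OF P]
      by (simp add: trace_def sum_2 matrix_matrix_mult_def D axis_one_nth)
    have "(\<alpha> - 1) * (?c B $ 2 $ 2 - det B) = 0" using t1 t2 by algebra
    then show 2: "?c B $ 2 $ 2 = det B" using A(2) by (simp add: \<alpha>_def)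
    with t1 show 1: "?c B $ 1 $ 1 = 1" by simp
    show "?c B $ 1 $ 2 * ?c B $ 2 $ 1 = 0"
      using det_conj_by[OF P, of B] by (simp add: det_2 1 2)
  qed
  have "(\<forall>B\<in>M. ?c B $ 2 $ 1 = 0) \<or> (\<forall>B\<in>M. ?c B $ 1 $ 2 = 0)"
  proof (rule ccontr)
    assume "\<not> ?thesis"
    then obtain B C where B: "B \<in> M" "?c B $ 2 $ 1 \<noteq> 0" and C: "C \<in> M" "?c C $ 1 $ 2 \<noteq> 0" by blast
    have "?c B $ 1 $ 2 = 0" "?c C $ 2 $ 1 = 0" using sd(3) B C by (metis mult_eq_0_iff)+
    then have "?c (B ** C) $ 1 $ 2 = ?c C $ 1 $ 2" "?c (B ** C) $ 2 $ 1 = ?c B $ 2 $ 1"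
      unfolding conj_by_mul[OF P]
      by (simp_all add: matrix_matrix_mult_def sum_2 sd(1) B(1) C(1))
    then show False using sd(3)[OF mult[OF B(1) C(1)]] B(2) C(2) by simp
  qed
  then show ?thesis
  proof
    assume z0: "\<forall>B\<in>M. ?c B $ 2 $ 1 = 0"
    have "B *v z = 1 *s z" if "B \<in> M" for B
    proof -
      have "?c B *v axis 1 1 = axis 1 1"
        using z0 sd(1) that by (simp add: vec_eq_iff forall_2 axis_mult_nth axis_one_nth)
      then show ?thesis using conj_by_vec[OF P, of B "axis 1 1"] by (simp add: P1)
    qed
    with z(1) show ?thesis by blast
  next
    assume z0: "\<forall>B\<in>M. ?c B $ 1 $ 2 = 0"
    have "B *v x = det B *s x" if "B \<in> M" for B
    proof -
      have "?c B *v axis 2 1 = det B *s axis 2 1"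
        using z0 sd(2) that by (simp add: vec_eq_iff forall_2 axis_mult_nth axis_one_nth)
      then show ?thesis
        using conj_by_vec[OF P, of B "axis 2 1"] by (simp add: P1 vector_scalar_commute)
    qed
    with x(1) show ?thesis by blast
  qed
qed


context parabolic_lifts begin

text \<open>If the quotient by the first basis vector has no invariant line, then the trace argument applies
  to the action on this quotient.\<close>

lemma bounded_lower_blocks:
  assumes block: "\<And>g. g \<in> \<Gamma> \<Longrightarrow> block g"
    and neg: "\<And>w. w \<noteq> 0 \<Longrightarrow> w $ 1 = 0 \<Longrightarrow> \<exists>g\<in>\<Gamma>. \<forall>k. lower_block g *v w \<noteq> k *s w"
  shows "bounded (lower_block ` \<Gamma>)"
proof (rule bounded_of_bounded_traces[where C = 4])
  let ?S = "lower_block ` \<Gamma>"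
  show "a ** b \<in> ?S" if "a \<in> ?S" "b \<in> ?S" for a b
    using that mult_closed block by (auto simp: lower_block_mult[symmetric])
  show sc: "mat \<i> ** a \<in> ?S" if "a \<in> ?S" for a
    using that scale_closed[of \<i>] by (auto simp: lower_block_scale[symmetric])
  have sc: "mat x ** lower_block g \<in> span ?S" if "g \<in> \<Gamma>" for x g
    using span_scale_closed[OF sc span_base] that by blast
  show "cmod (trace a) \<le> 4" if a: "a \<in> ?S" for a
  proof -
    obtain g where g: "g \<in> \<Gamma>" "a = lower_block g" using a by blast
    \<comment> \<open>The trace of the lower block differs from that of \<open>g\<close> by a unimodular number, whence the bound \<open>3 + 1\<close>.\<close>
    have "mat_eigenvalue g (g$1$1)"
      unfolding mat_eigenvalue_iff using block[OF g(1)] by (simp add: det_3 mat_def block_def)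
    then have "cmod (g$1$1) = 1" using eigenvalue_norm g(1) by blast
    moreover have "trace a = trace g - g$1$1" by (simp add: g(2) trace_def sum_3)
    ultimately show ?thesis
      using norm_triangle_ineq4[of "trace g" "g$1$1"] norm_trace[OF g(1)] by simp
  qed
  fix a assume a: "a \<in> span ?S" "a \<noteq> 0"
  have row: "\<forall>j. a $ 1 $ j = 0 \<and> a $ j $ 1 = 0"
    using a(1)
  proof (induction rule: span_induct)
    case base
    show ?case by (auto simp: subspace_def)
  qed auto
  obtain u where u: "a *v u \<noteq> 0" using a(2) by (metis matrix_eq matrix_vector_mult_0)
  define v w where "v = (u - u$1 *s axis 1 1)" and "w = a *v v"
  have v1: "v $ 1 = 0" by (simp add: v_def axis_one_nth)
  have "w = a *v u"
    using row by (simp add: w_def v_def vec_eq_iff matrix_vector_mult_def sum_3 axis_one_nth)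
  then have "w \<noteq> 0" using u by simp
  moreover from this have "v \<noteq> 0" by (auto simp: w_def)
  moreover have "w $ 1 = 0" using row by (simp add: w_def matrix_vector_mult_def)
  ultimately have w: "w \<noteq> 0" "w $ 1 = 0" "v \<noteq> 0" by auto
  obtain g where g: "g \<in> \<Gamma>" "\<And>k. lower_block g *v w \<noteq> k *s w" using neg w by blast
  define y where "y = lower_block g *v w"
  have y1: "y $ 1 = 0" by (simp add: y_def matrix_vector_mult_def)
  define d where "d = w$2 * y$3 - w$3 * y$2"
  have d: "d \<noteq> 0"
  proof
    assume "d = 0"
    then have "cross w y = 0" using y1 w(2) by (simp add: vec_eq_iff forall_3 d_def)
    then obtain k where "y = k *s w" using cross_eq_0_imp_parallel w(1) by blast
    then show False using g(2)[of k] y_def by metis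
  qed
  \<comment> \<open>Cramer's rule for \<open>v = p *s w + q *s y\<close> in the plane of the last two coordinates.\<close>
  define p q where "p = (v$2 * y$3 - v$3 * y$2) / d" and "q = (w$2 * v$3 - w$3 * v$2) / d"
  define b where "b = mat p ** lower_block (mat 1) + mat q ** lower_block g"
  have "b \<in> span ?S" unfolding b_def by (intro span_add sc mat_one_in g)
  moreover have "(b ** a) *v v = v"
  proof -
    have "(b ** a) *v v = b *v w" by (simp add: w_def matrix_vector_mul_assoc)
    also have "\<dots> = p *s (lower_block (mat 1) *v w) + q *s y"
      by (simp add: b_def y_def matrix_vector_mult_add_rdistrib
          matrix_vector_mul_assoc[symmetric] mat_mult_vec)
    also have "lower_block (mat 1) *v w = w"
      using w(2) by (simp add: vec_eq_iff forall_3 matrix_vector_mult_def sum_3 mat_def)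
    also have "p *s w + q *s y = v"
    proof -
      have "p * w$2 + q * y$2 = v$2" "p * w$3 + q * y$3 = v$3"
        unfolding p_def q_def using d by (simp_all add: divide_simps, simp_all add: d_def algebra_simps)
      then show ?thesis using w(2) y1 v1 by (simp add: vec_eq_iff forall_3)
    qed
    finally show ?thesis .
  qed
  ultimately show "\<exists>b\<in>span ?S. \<exists>v. v \<noteq> 0 \<and> (b ** a) *v v = v" using w(3) by blast
qed

text \<open>The corner entry \<open>g$1$1\<close> is an eigenvalue of the lower block of \<open>g\<close>. If it were not, then \<open>g\<close> would be
  conjugate to the direct sum of its corner and its lower block. The powers of this sum are bounded, so \<open>g\<close>
  would be diagonalizable and hence scalar.\<close>

lemma block_corner_eigenvalue:
  assumes block: "\<And>g. g \<in> \<Gamma> \<Longrightarrow> block g" and bdd: "bounded (lower_block ` \<Gamma>)" and g: "g \<in> \<Gamma>"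
  shows "(g$2$2 - g$1$1) * (g$3$3 - g$1$1) = g$2$3 * g$3$2"
proof (rule ccontr)
  assume neq: "\<not> ?thesis"
  define D where "D = (g$2$2 - g$1$1) * (g$3$3 - g$1$1) - g$2$3 * g$3$2"
  have D: "D \<noteq> 0" using neq by (simp add: D_def)
  \<comment> \<open>The row vector \<open>(s, t)\<close> solves \<open>(s, t) (A - g$1$1) = (g$1$2, g$1$3)\<close>, with \<open>A\<close> the lower block and \<open>D\<close> the determinant of the system.\<close>
  define s t where "s = (g$1$2 * (g$3$3 - g$1$1) - g$1$3 * g$3$2) / D"
    and "t = (g$1$3 * (g$2$2 - g$1$1) - g$1$2 * g$2$3) / D"
  define P where "P = utri 1 1 1 s 0 t"
  have P: "invertible P" by (simp add: P_def invertible_utri)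
  define h where "h = utri (g$1$1) 0 0 0 0 0 + lower_block g"
  have "g$1$2 = s * g$2$2 + t * g$3$2 - g$1$1 * s" "g$1$3 = s * g$2$3 + t * g$3$3 - g$1$1 * t"
    unfolding s_def t_def using D by (simp_all add: divide_simps, simp_all add: D_def algebra_simps)
  then have "g ** P = P ** h"
    using block[OF g]
    by (simp add: vec_eq_iff forall_3 matrix_matrix_mult_def sum_3 P_def h_def block_def algebra_simps)
  then have h: "conj_by P g = h" by (rule conj_by_eqI[OF P])
  define S where "S = {utri c 0 0 0 0 0 + lower_block k | c k. cmod c = 1 \<and> k \<in> \<Gamma>}"
  have "bounded_linear (\<lambda>c. utri c 0 0 0 0 0)"
    unfolding linear_conv_bounded_linear[symmetric]
    by (rule linearI) (simp_all add: vec_eq_iff forall_3)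
  then have b1: "bounded ((\<lambda>c. utri c 0 0 0 0 0) ` sphere 0 1)"
    by (intro bounded_linear_image) auto
  have "S \<subseteq> (\<Union>x\<in>(\<lambda>c. utri c 0 0 0 0 0) ` sphere 0 1. \<Union>y\<in>lower_block ` \<Gamma>. {x + y})"
  proof
    fix p assume "p \<in> S"
    then obtain c k where p: "p = utri c 0 0 0 0 0 + lower_block k" "cmod c = 1" "k \<in> \<Gamma>"
      unfolding S_def by blast
    then have "utri c 0 0 0 0 0 \<in> (\<lambda>c. utri c 0 0 0 0 0) ` sphere 0 1" by auto
    with p show "p \<in> (\<Union>x\<in>(\<lambda>c. utri c 0 0 0 0 0) ` sphere 0 1. \<Union>y\<in>lower_block ` \<Gamma>. {x + y})"
      by blast
  qed
  then have bS: "bounded S"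
    by (rule bounded_subset[OF bounded_sums[OF b1 bdd]])
  have "diagonalizable h"
  proof (rule diagonalizable_of_bounded_powers[OF bS])
    fix p q assume "p \<in> S" "q \<in> S"
    then obtain c k c' k' where *: "p = utri c 0 0 0 0 0 + lower_block k" "cmod c = 1" "k \<in> \<Gamma>"
      "q = utri c' 0 0 0 0 0 + lower_block k'" "cmod c' = 1" "k' \<in> \<Gamma>" unfolding S_def by blast
    have "p ** q = utri (c * c') 0 0 0 0 0 + lower_block (k ** k')"
      using block[OF *(3)] block[OF *(6)] unfolding *(1,4)
      by (simp add: vec_eq_iff forall_3 matrix_matrix_mult_def sum_3 block_def)
    moreover have "cmod (c * c') = 1" "k ** k' \<in> \<Gamma>" using * mult_closed by (auto simp: norm_mult)
    ultimately show "p ** q \<in> S" unfolding S_def by blast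
  next
    have "mat_eigenvalue g (g$1$1)"
      unfolding mat_eigenvalue_iff using block[OF g] by (simp add: det_3 mat_def block_def)
    then have "cmod (g$1$1) = 1" using eigenvalue_norm g by blast
    then show "h \<in> S" unfolding S_def h_def using g by blast
    show "cmod k = 1" if "mat_eigenvalue h k" for k
      using that eigenvalue_norm[OF g] mat_eigenvalue_conj_by[OF P, of g] h by simp
  qed
  then have "diagonalizable g" using diagonalizable_conj_by[OF P, of g] h by simp
  then obtain c where "g = mat c" using diagonalizable_imp_scalar g by blast
  then show False using D by (simp add: D_def mat_def)
qed

text \<open>After division by the corner entry, 1 is an eigenvalue of all lower blocks, and they have a common
  eigenvector by the two-dimensional lemma.\<close>

lemma lower_block_eigenvector:
  assumes block: "\<And>g. g \<in> \<Gamma> \<Longrightarrow> block g"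
  shows "\<exists>w. w \<noteq> 0 \<and> w $ 1 = 0 \<and> (\<forall>g\<in>\<Gamma>. \<exists>k. lower_block g *v w = k *s w)"
proof (rule ccontr)
  assume neg: "\<not> ?thesis"
  then have bdd: "bounded (lower_block ` \<Gamma>)"
    by (intro bounded_lower_blocks) (use block in auto)
  have ev: "(g$2$2 - g$1$1) * (g$3$3 - g$1$1) = g$2$3 * g$3$2" if "g \<in> \<Gamma>" for g
    using block_corner_eigenvalue[of g] block bdd that by blast
  define m where "m g = (vector [vector [g$2$2, g$2$3], vector [g$3$2, g$3$3]] :: complex^2^2)"
    for g :: "complex^3^3"
  define M where "M = m ` {g\<in>\<Gamma>. g$1$1 = 1}"
  have "\<exists>w. w \<noteq> 0 \<and> (\<forall>A\<in>M. \<exists>k. A *v w = k *s w)"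
  proof (rule common_eigenvector_2)
    fix A B assume "A \<in> M" "B \<in> M"
    then obtain g h where g: "A = m g" "g \<in> \<Gamma>" "g$1$1 = 1" "B = m h" "h \<in> \<Gamma>" "h$1$1 = 1"
      unfolding M_def by blast
    have "A ** B = m (g ** h)" "(g ** h) $ 1 $ 1 = 1"
      using block[OF g(2)] block[OF g(5)] g
      by (auto simp: m_def vec_eq_iff forall_2 matrix_matrix_mult_def sum_2 sum_3 block_def)
    then show "A ** B \<in> M" unfolding M_def using mult_closed g by blast
  next
    fix A assume "A \<in> M"
    then obtain g where g: "A = m g" "g \<in> \<Gamma>" "g$1$1 = 1" unfolding M_def by blast
    show "trace A = 1 + det A"
      using ev[OF g(2)] by (simp add: g m_def trace_def sum_2 det_2 algebra_simps)
    have "\<not> mat_eigenvalue g 0" using eigenvalue_norm g(2) by fastforce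
    then show "det A \<noteq> 0"
      using block[OF g(2)] g(3) unfolding mat_eigenvalue_iff g(1)
      by (auto simp: m_def det_2 det_3 mat_def block_def)
  qed
  then obtain w where w: "w \<noteq> 0" "\<And>A. A \<in> M \<Longrightarrow> \<exists>k. A *v w = k *s w" by blast
  define x :: "complex^3" where "x = vector [0, w$1, w$2]"
  have "x \<noteq> 0" "x $ 1 = 0" using w(1) by (auto simp: x_def vec_eq_iff forall_2 forall_3)
  moreover have "\<exists>k. lower_block g *v x = k *s x" if g: "g \<in> \<Gamma>" for g
  proof -
    have "mat_eigenvalue g (g$1$1)"
      unfolding mat_eigenvalue_iff using block[OF g] by (simp add: det_3 mat_def block_def)
    then have 1: "cmod (g$1$1) = 1" using eigenvalue_norm g by blast
    then have 2: "g$1$1 \<noteq> 0" by auto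
    let ?h = "mat (inverse (g$1$1)) ** g"
    have "?h \<in> \<Gamma>" using scale_closed g 1 by (simp add: norm_inverse)
    moreover have "?h$1$1 = 1" using 2 by (simp add: mat_scale_left)
    ultimately have "m ?h \<in> M" unfolding M_def by blast
    then obtain k where k: "m ?h *v w = k *s w" using w(2) by blast
    have "lower_block g *v x = (g$1$1 * k) *s x"
      using k 2 unfolding mat_scale_left m_def
      by (simp add: vec_eq_iff forall_2 forall_3 matrix_vector_mult_def sum_2 sum_3 x_def field_simps)
    then show ?thesis by blast
  qed
  ultimately show False using neg by blast
qed

lemma upper_conj_of_common_eigenvector:
  assumes v: "v \<noteq> 0" "\<And>g. g \<in> \<Gamma> \<Longrightarrow> \<exists>k. g *v v = k *s v"
  shows "\<exists>P. invertible P \<and> (\<forall>g\<in>\<Gamma>. upper (conj_by P g))"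
proof -
  obtain P :: "complex^3^3" where P: "invertible P" "P *v axis 1 1 = v"
    using exists_basis_with_first_vector[OF v(1)] by blast
  interpret C: parabolic_lifts "conj_by P ` \<Gamma>"
    by (rule parabolic_lifts_conj_by[OF _ P(1)]) (rule parabolic_lifts_axioms)
  have block: "block g" if "g \<in> conj_by P ` \<Gamma>" for g
    using that block_conj_by[OF P] v(2) by blast
  obtain w where w: "w \<noteq> 0" "w $ 1 = 0" "\<And>g. g \<in> conj_by P ` \<Gamma> \<Longrightarrow> \<exists>k. lower_block g *v w = k *s w"
    using C.lower_block_eigenvector[OF block] by blast
  obtain Q :: "complex^3^3" where Q: "invertible Q" "Q *v axis 1 1 = axis 1 1" "Q *v axis 2 1 = w"
    using exists_basis_with_second_vector[OF w(1,2)] by blast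
  have "upper (conj_by (P ** Q) g)" if g: "g \<in> \<Gamma>" for g
  proof -
    obtain k where k: "lower_block (conj_by P g) *v w = k *s w" using w(3) g by blast
    have "upper (conj_by Q (conj_by P g))"
      by (rule upper_conj_by[OF _ k w(2) Q]) (use block g in blast)
    then show ?thesis by (simp add: conj_by_conj_by[OF P(1) Q(1)])
  qed
  then show ?thesis using invertible_mult[OF P(1) Q(1)] by blast
qed

end

text \<open>The reversal of the basis. It turns lower triangular matrices back into upper triangular ones
  after a transposition.\<close>

definition flip :: "complex^3^3" where
  "flip = vector [vector [0, 0, 1], vector [0, 1, 0], vector [1, 0, 0]]"

lemma invertible_flip: "invertible flip"
  by (simp add: invertible_det_nz det_3 flip_def)

lemma conj_by_flip_transpose:
  "conj_by flip (transpose (utri a b c x y z)) = utri c b a y x z"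
  by (rule conj_by_eqI[OF invertible_flip])
    (simp add: vec_eq_iff forall_3 matrix_matrix_mult_def sum_3 transpose_nth flip_def)

context parabolic_lifts begin

lemma upper_triangularizable: "\<exists>P. invertible P \<and> (\<forall>g\<in>\<Gamma>. upper (conj_by P g))"
  using exists_common_eigenvector
proof
  assume "\<exists>v. v \<noteq> 0 \<and> (\<forall>g\<in>\<Gamma>. \<exists>k. g *v v = k *s v)"
  then show ?thesis using upper_conj_of_common_eigenvector by blast
next
  assume ev: "\<exists>v. v \<noteq> 0 \<and> (\<forall>g\<in>\<Gamma>. \<exists>k. transpose g *v v = k *s v)"
  interpret T: parabolic_lifts "transpose ` \<Gamma>"
    by (rule parabolic_lifts_transpose) (rule parabolic_lifts_axioms)
  obtain P where P: "invertible P" "\<And>g. g \<in> \<Gamma> \<Longrightarrow> upper (conj_by P (transpose g))"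
    using T.upper_conj_of_common_eigenvector ev by blast
  let ?Q = "transpose (matrix_inv P)"
  note Q = transpose_conj_by(2)[OF P(1)]
  have "upper (conj_by (?Q ** flip) g)" if g: "g \<in> \<Gamma>" for g
  proof -
    obtain a b c x y z where e: "conj_by P (transpose g) = utri a b c x y z"
      using upper_eq_utri[OF P(2)[OF g]] by blast
    have "conj_by ?Q g = transpose (utri a b c x y z)"
      using transpose_conj_by(1)[OF P(1), of "transpose g"] e by simp
    then have "conj_by (?Q ** flip) g = utri c b a y x z"
      using conj_by_conj_by[OF Q invertible_flip, of g] conj_by_flip_transpose by simp
    then show ?thesis by (simp add: upper_def)
  qed
  then show ?thesis using invertible_mult[OF Q invertible_flip] by blast
qed

end

section \<open>Upper triangular groups\<close>

lemma tendsto_utri: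
  assumes "(a \<longlongrightarrow> a') F" "(b \<longlongrightarrow> b') F" "(c \<longlongrightarrow> c') F" "(x \<longlongrightarrow> x') F" "(y \<longlongrightarrow> y') F" "(z \<longlongrightarrow> z') F"
  shows "((\<lambda>n. utri (a n) (b n) (c n) (x n) (y n) (z n)) \<longlongrightarrow> utri a' b' c' x' y' z') F"
proof -
  have "\<forall>i j. ((\<lambda>n. utri (a n) (b n) (c n) (x n) (y n) (z n) $ i $ j) \<longlongrightarrow> utri a' b' c' x' y' z' $ i $ j) F"
    using assms by (simp add: forall_3)
  then show ?thesis by (intro vec_tendstoI) auto
qed

text \<open>The idea is that a group is not a union of three subgroups of infinite index; here any two of
  \<open>r = 1\<close>, \<open>s = 1\<close> and \<open>r * s = 1\<close> hold together in \<open>(1, 1)\<close> only. If none of them holds everywhere, then \<open>I\<close> contains nontrivial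
  elements \<open>(1, t)\<close> and \<open>(s, 1)\<close>, and multiplication by these leaves only four
  possibilities for any element.\<close>

lemma finite_or_constant_of_three_characters:
  fixes I :: "(complex \<times> complex) set"
  assumes mult: "\<And>r s r' s'. (r, s) \<in> I \<Longrightarrow> (r', s') \<in> I \<Longrightarrow> (r * r', s * s') \<in> I"
    and three: "\<And>r s. (r, s) \<in> I \<Longrightarrow> r = 1 \<or> s = 1 \<or> r * s = 1"
  shows "finite I \<or> (\<forall>(r, s)\<in>I. r = 1) \<or> (\<forall>(r, s)\<in>I. s = 1) \<or> (\<forall>(r, s)\<in>I. r * s = 1)"
proof (rule ccontr)
  assume neg: "\<not> ?thesis"
  then obtain r1 s1 r2 s2 r3 s3 where
    i: "(r1, s1) \<in> I" "r1 \<noteq> 1" "(r2, s2) \<in> I" "s2 \<noteq> 1" "(r3, s3) \<in> I" "r3 * s3 \<noteq> 1" by blast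
  have "\<exists>s t. (1, t) \<in> I \<and> t \<noteq> 1 \<and> (s, 1) \<in> I \<and> s \<noteq> 1"
  proof (cases "r3 = 1")
    case True
    have "s1 = 1 \<or> r1 * s1 = 1" using three[OF i(1)] i(2) by blast
    then show ?thesis
    proof
      assume 1: "r1 * s1 = 1"
      have m: "(r1, s1 * s3) \<in> I" using mult[OF i(1,5)] True by simp
      have "r1 * (s1 * s3) = s3" using 1 by (simp flip: mult.assoc)
      then have "s1 * s3 = 1" using three[OF m] i(2,6) True by (metis mult_1)
      then have "(r1, 1) \<in> I" "(1, s3) \<in> I" "s3 \<noteq> 1" using m i(5,6) True by auto
      then show ?thesis using i(2) by blast
    qed (use i True in auto)
  next
    case False
    then have "s3 = 1" using three[OF i(5)] i(6) by blast
    have "r2 = 1 \<or> r2 * s2 = 1" using three[OF i(3)] i(4) by blast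
    then show ?thesis
    proof
      assume 1: "r2 * s2 = 1"
      have m: "(r3 * r2, s2) \<in> I" using mult[OF i(5,3)] \<open>s3 = 1\<close> by simp
      have "r3 * r2 * s2 = r3" using 1 by (simp add: mult.assoc)
      then have "r3 * r2 = 1" using three[OF m] i(4) False by metis
      then have "(1, s2) \<in> I" "(r3, 1) \<in> I" using m i(5) \<open>s3 = 1\<close> by auto
      then show ?thesis using i(4) False by blast
    qed (use i False \<open>s3 = 1\<close> in auto)
  qed
  then obtain s t where st: "(1, t) \<in> I" "t \<noteq> 1" "(s, 1) \<in> I" "s \<noteq> 1" by blast
  have "I \<subseteq> {(1, 1), (1, inverse s), (inverse t, 1), (t, inverse t)}"
  proof
    fix p assume p: "p \<in> I"
    obtain r q where e: "p = (r, q)" by fastforce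
    have 1: "r * s = 1 \<or> q = 1 \<or> r * s * q = 1" using three[OF mult[OF p[unfolded e] st(3)]] by simp
    have 2: "r = 1 \<or> q * t = 1 \<or> r * (q * t) = 1" using three[OF mult[OF p[unfolded e] st(1)]] by simp
    consider "r = 1" "q = 1" | "r = 1" "q \<noteq> 1" | "r \<noteq> 1" "q = 1" | "r \<noteq> 1" "q \<noteq> 1" "r * q = 1"
      using three[OF p[unfolded e]] by blast
    then show "p \<in> {(1, 1), (1, inverse s), (inverse t, 1), (t, inverse t)}"
    proof cases
      case 2
      then have "s * q = 1" using 1 st(4) by auto
      then show ?thesis using 2 by (simp add: e inverse_unique)
    next
      case 3
      then have "r * t = 1" using \<open>r = 1 \<or> q * t = 1 \<or> r * (q * t) = 1\<close> st(2) by auto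
      then have "t * r = 1" by (simp add: mult.commute)
      then show ?thesis using 3 by (simp add: e inverse_unique)
    next
      case 4
      have "r * (q * t) = t" using 4(3) by (simp flip: mult.assoc)
      then have "q * t = 1" using 2 4(1) st(2) by metis
      moreover from this have "r = t" using \<open>r * (q * t) = t\<close> by simp
      moreover have "t * q = 1" using \<open>q * t = 1\<close> by (simp add: mult.commute)
      ultimately show ?thesis by (simp add: e inverse_unique)
    qed (simp add: e)
  qed
  then have "finite I" by (rule finite_subset) simp
  then show False using neg by blast
qed

locale upper_lifts = parabolic_lifts +
  assumes upper: "g \<in> \<Gamma> \<Longrightarrow> upper g"
begin

lemma right_cancel_in:
  assumes "v \<in> \<Gamma>" "t ** v \<in> \<Gamma>" shows "t \<in> \<Gamma>"
proof -
  obtain v' where v': "v' \<in> \<Gamma>" "v ** v' = mat 1" using inverses assms(1) by blast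
  have "t = (t ** v) ** v'" by (simp add: matrix_mul_assoc[symmetric] v')
  then show ?thesis using mult_closed[OF assms(2) v'(1)] by simp
qed

lemma obtain_utri:
  assumes "g \<in> \<Gamma>" obtains a b c x y z where "g = utri a b c x y z"
  using upper_eq_utri[OF upper[OF assms]] that by blast

lemma diag_norm:
  assumes "utri a b c x y z \<in> \<Gamma>"
  shows "cmod a = 1" "cmod b = 1" "cmod c = 1" "a \<noteq> 0" "b \<noteq> 0" "c \<noteq> 0"
proof -
  show "cmod a = 1" "cmod b = 1" "cmod c = 1"
    using eigenvalue_norm[OF assms] by (auto simp: mat_eigenvalue_utri)
  then show "a \<noteq> 0" "b \<noteq> 0" "c \<noteq> 0" by auto
qed

text \<open>A triangular matrix with three different diagonal entries is diagonalizable.\<close>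

lemma two_diag_equal:
  assumes "utri a b c x y z \<in> \<Gamma>"
  shows "a = b \<or> b = c \<or> a = c"
proof (rule ccontr)
  assume neq: "\<not> ?thesis"
  then have "diagonalizable (utri a b c x y z)" using diagonalizable_utri_distinct by blast
  then obtain k where "utri a b c x y z = mat k" using diagonalizable_imp_scalar assms by blast
  then show False using neq by (simp add: mat_eq_utri utri_eq_iff)
qed

lemma normalize:
  assumes "utri a b c x y z \<in> \<Gamma>"
  shows "utri 1 (b/a) (c/a) (x/a) (y/a) (z/a) \<in> \<Gamma>"
proof -
  have "mat (inverse a) ** utri a b c x y z \<in> \<Gamma>"
    using scale_closed[OF _ assms, of "inverse a"] diag_norm[OF assms] by (simp add: norm_inverse)
  then show ?thesis
    using diag_norm[OF assms] by (simp add: scale_utri divide_inverse mult.commute)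
qed

text \<open>An infinite subset of the circle contains two distinct points at distance less than 1; their quotient
  is again a value of \<open>f\<close>.\<close>

lemma exists_near_one:
  assumes hom: "\<And>g h. g \<in> \<Gamma> \<Longrightarrow> h \<in> \<Gamma> \<Longrightarrow> f (g ** h) = f g * (f h :: complex)"
    and norm: "\<And>g. g \<in> \<Gamma> \<Longrightarrow> cmod (f g) = 1" and inf: "infinite (f ` \<Gamma>)"
  shows "\<exists>g\<in>\<Gamma>. f g \<noteq> 1 \<and> cmod (f g - 1) < 1"
proof -
  have "bounded (f ` \<Gamma>)" using norm by (auto simp: bounded_iff)
  then have "\<not> uniform_discrete (f ` \<Gamma>)"
    using inf uniform_discrete_finite_iff by blast
  then obtain g h where g: "g \<in> \<Gamma>" "h \<in> \<Gamma>" "f g \<noteq> f h" "dist (f g) (f h) < 1"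
    unfolding uniform_discrete_def using zero_less_one by blast
  obtain h' where h': "h' \<in> \<Gamma>" "h ** h' = mat 1" using inverses g(2) by blast
  have nz: "f k \<noteq> 0" if "k \<in> \<Gamma>" for k using norm[OF that] by auto
  have "f (mat 1) * f (mat 1) = f (mat 1)" using hom[OF mat_one_in mat_one_in] by simp
  then have "f (mat 1) = 1" using nz[OF mat_one_in] by simp
  then have fh: "f h * f h' = 1" using hom[OF g(2) h'(1)] h'(2) by simp
  have "f (g ** h') - 1 = (f g - f h) * f h'"
    using hom[OF g(1) h'(1)] fh by (simp add: algebra_simps)
  then have "cmod (f (g ** h') - 1) < 1" "f (g ** h') \<noteq> 1"
    using g(3,4) norm[OF h'(1)] nz[OF h'(1)] by (auto simp: norm_mult dist_norm)
  then show ?thesis using mult_closed[OF g(1) h'(1)] by blast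
qed

end

text \<open>Scalar multiples of the matrices in the family of the conclusion. Geometrically they combine
  a translation by \<open>w\<close> with a rotation by \<open>e\<close>.\<close>

definition screw_form :: "complex^3^3 \<Rightarrow> bool" where
  "screw_form g \<longleftrightarrow> (\<exists>k w e. g = mat k ** utri 1 1 e w 0 0)"

lemma cmod_inverse_minus_one:
  assumes "cmod e = 1" shows "cmod (inverse e - 1) = cmod (e - 1)"
proof -
  have "e \<noteq> 0" using assms by auto
  then have "inverse e - 1 = - (inverse e * (e - 1))" by (simp add: algebra_simps)
  then show ?thesis using assms by (simp only: norm_minus_cancel norm_mult norm_inverse) simp
qed


section \<open>Diagonal of type (a, a, c)\<close>

text \<open>The case in which the first two diagonal entries agree on the whole group and some element \<open>g0\<close> has its
  third entry \<open>e0\<close> close to, but different from, the other two.\<close>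

locale near_one_aac = upper_lifts +
  fixes e0 x0 y0 z0
  assumes diag_aac: "utri a b c x y z \<in> \<Gamma> \<Longrightarrow> a = b"
    and g0: "utri 1 1 e0 x0 y0 z0 \<in> \<Gamma>" "e0 \<noteq> 1" "cmod (e0 - 1) < 1"
begin

text \<open>Taking commutators with \<open>g0\<close> acts on the translations \<open>(y, z)\<close> by the linear map
  \<open>(y, z) \<mapsto> (d y, d z + q x0 y)\<close>, where \<open>q = 1 / e0\<close> and \<open>d = q - 1\<close>. As \<open>\<bar>d\<bar> < 1\<close>, the iterated
  commutators tend to the identity, and discreteness makes one of them trivial. The map is injective because
  \<open>e0 \<noteq> 1\<close>, so already the first translation is trivial.\<close>

lemma translation_trivial:
  assumes t: "utri 1 1 1 0 y z \<in> \<Gamma>"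
  shows "y = 0" "z = 0"
proof -
  define q d where "q = inverse e0" and "d = q - 1"
  have e0: "cmod e0 = 1" "e0 \<noteq> 0" using diag_norm[OF g0(1)] by auto
  have d: "cmod d < 1" using cmod_inverse_minus_one[OF e0(1)] g0(3) by (simp add: d_def q_def)
  have d0: "d \<noteq> 0" using g0(2) by (auto simp: d_def q_def)
  have step: "utri 1 1 1 0 (d * Y) (d * Z + q * x0 * Y) \<in> \<Gamma>" if u: "utri 1 1 1 0 Y Z \<in> \<Gamma>" for Y Z
  proof -
    have "utri 1 1 1 0 (q * Y) (q * (Z + x0 * Y)) ** utri 1 1 e0 x0 y0 z0 = utri 1 1 e0 x0 y0 z0 ** utri 1 1 1 0 Y Z"
      using e0(2) by (simp add: utri_mult utri_eq_iff q_def field_simps)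
    then have "utri 1 1 1 0 (q * Y) (q * (Z + x0 * Y)) \<in> \<Gamma>"
      using right_cancel_in[OF g0(1)] mult_closed[OF g0(1) u] by metis
    moreover have "utri 1 1 1 0 (d * Y) (d * Z + q * x0 * Y) ** utri 1 1 1 0 Y Z
        = utri 1 1 1 0 (q * Y) (q * (Z + x0 * Y))"
      by (simp add: utri_mult utri_eq_iff d_def algebra_simps)
    ultimately show ?thesis using right_cancel_in[OF u] by metis
  qed
  have it: "utri 1 1 1 0 (d ^ n * y) (d ^ n * z + of_nat n * d ^ n * (q * x0 * y / d)) \<in> \<Gamma>" for n
  proof (induction n)
    case (Suc n)
    have "d * (d ^ n * z + of_nat n * d ^ n * (q * x0 * y / d)) + q * x0 * (d ^ n * y)
        = d ^ Suc n * z + of_nat (Suc n) * d ^ Suc n * (q * x0 * y / d)"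
      using d0 by (simp add: field_simps)
    moreover have "d * (d ^ n * y) = d ^ Suc n * y" by simp
    ultimately show ?case using step[OF Suc] by metis
  qed (use t in simp)
  have "(\<lambda>n. utri 1 1 1 0 (d ^ n * y) (d ^ n * z + of_nat n * d ^ n * (q * x0 * y / d)))
      \<longlonglongrightarrow> utri 1 1 1 0 (0 * y) (0 * z + 0 * (q * x0 * y / d))"
    by (intro tendsto_utri tendsto_intros LIMSEQ_power_zero d powser_times_n_limit_0)
  then have "(\<lambda>n. utri 1 1 1 0 (d ^ n * y) (d ^ n * z + of_nat n * d ^ n * (q * x0 * y / d)))
      \<longlonglongrightarrow> mat 1"
    by (simp add: mat_eq_utri)
  from no_limit[OF it this] obtain n c where
    "utri 1 1 1 0 (d ^ n * y) (d ^ n * z + of_nat n * d ^ n * (q * x0 * y / d)) = mat c" by blast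
  then have "d ^ n * y = 0" "d ^ n * z + of_nat n * d ^ n * (q * x0 * y / d) = 0"
    by (simp_all add: mat_eq_utri utri_eq_iff)
  then show "y = 0" "z = 0" using d0 by auto
qed

text \<open>Every commutator with \<open>g0\<close> is a translation and hence trivial. The equations are the two
  nontrivial entries of the identity \<open>g0 ** h = h ** g0\<close>.\<close>

lemma commute_with_g0:
  assumes h: "utri 1 1 e x y z \<in> \<Gamma>"
  shows "y * (e0 - 1) = y0 * (e - 1)" "z + x0 * y + z0 * e = z0 + x * y0 + z * e0"
proof -
  have e: "e \<noteq> 0" "e0 \<noteq> 0" using diag_norm[OF h] diag_norm[OF g0(1)] by auto
  define Y where "Y = (y + y0 * e - (y0 + y * e0)) / (e * e0)"
  define Z where "Z = (z + x0 * y + z0 * e - (z0 + x * y0 + z * e0)) / (e * e0)"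
  have "utri 1 1 1 0 Y Z ** (utri 1 1 e x y z ** utri 1 1 e0 x0 y0 z0)
      = utri 1 1 e0 x0 y0 z0 ** utri 1 1 e x y z"
    using e by (simp add: utri_mult utri_eq_iff Y_def Z_def)
  then have "utri 1 1 1 0 Y Z \<in> \<Gamma>"
    using right_cancel_in mult_closed h g0(1) by metis
  then have "Y = 0" "Z = 0" using translation_trivial by blast+
  then show "y * (e0 - 1) = y0 * (e - 1)" "z + x0 * y + z0 * e = z0 + x * y0 + z * e0"
    using e by (auto simp: Y_def Z_def algebra_simps)
qed

lemma conj_special:
  "\<exists>P. invertible P \<and> (\<forall>g\<in>\<Gamma>. screw_form (conj_by P g))"
proof -
  \<comment> \<open>The vector \<open>(p, q, 1)\<close> is an eigenvector of \<open>g0\<close> for the simple eigenvalue \<open>e0\<close>. All elements commute with \<open>g0\<close> and hence share it.\<close>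
  define q p where "q = y0 / (e0 - 1)" and "p = (x0 * q + z0) / (e0 - 1)"
  define P where "P = utri 1 1 1 0 q p"
  have P: "invertible P" by (simp add: P_def invertible_utri)
  have e0: "e0 - 1 \<noteq> 0" using g0(2) by simp
  have "screw_form (conj_by P g)" if g: "g \<in> \<Gamma>" for g
  proof -
    obtain a b c x y z where 1: "g = utri a b c x y z" using obtain_utri[OF g] by blast
    have ab: "a = b" "a \<noteq> 0" using diag_aac[of a b c x y z] diag_norm(4)[of a b c x y z] g unfolding 1 by auto
    define e X Y Z where "e = c/a" and "X = x/a" and "Y = y/a" and "Z = z/a"
    have h: "utri 1 1 e X Y Z \<in> \<Gamma>"
      using normalize[of a b c x y z] g ab unfolding 1 e_def X_def Y_def Z_def by simp
    have ga: "g = mat a ** utri 1 1 e X Y Z"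
      using ab by (simp add: 1 scale_utri e_def X_def Y_def Z_def)
    have y: "q + Y = q * e"
      using commute_with_g0(1)[OF h] e0 by (simp add: q_def field_simps)
    have "(e0 - 1) * (p + X * q + Z) = (e0 - 1) * (p * e)"
    proof -
      have 2: "(e0 - 1) * q = y0" "(e0 - 1) * p = x0 * q + z0" using e0 by (simp_all add: q_def p_def)
      show ?thesis using commute_with_g0[OF h] 2 y by algebra
    qed
    then have z: "p + X * q + Z = p * e" using e0 by simp
    have "utri 1 1 e X Y Z ** P = P ** utri 1 1 e X 0 0"
      using y z by (simp add: P_def utri_mult utri_eq_iff algebra_simps)
    then have "conj_by P g = mat a ** utri 1 1 e X 0 0"
      unfolding ga conj_by_scale using conj_by_eqI[OF P] by metis
    then show ?thesis unfolding screw_form_def by blast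
  qed
  with P show ?thesis by blast
qed

end


section \<open>Diagonal of type (a, b, a)\<close>

text \<open>The case in which the outer diagonal entries agree on the whole group. The element \<open>g0\<close> is assumed to be already
  in a basis that separates its generalized eigenspaces.\<close>

locale near_one_aba = upper_lifts +
  fixes e0 z0
  assumes diag_aba: "utri a b c x y z \<in> \<Gamma> \<Longrightarrow> a = c"
    and g0: "utri 1 e0 1 0 0 z0 \<in> \<Gamma>" "e0 \<noteq> 1" "cmod (e0 - 1) < 1"
begin

text \<open>Taking the commutator with \<open>g0\<close> multiplies \<open>x\<close> by \<open>d = 1 / e0 - 1\<close> and \<open>y\<close> by \<open>f = e0 - 1\<close>, both of modulus
  less than 1, and it replaces the central coordinate by \<open>- d x y\<close>. So iterated commutators tend to the
  identity, and one of them is trivial by discreteness; as \<open>d\<close> and \<open>f\<close> are nonzero, this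
  forces \<open>x = y = 0\<close>.\<close>

lemma unipotents_central:
  assumes u: "utri 1 1 1 x y z \<in> \<Gamma>"
  shows "x = 0" "y = 0"
proof -
  define q d f where "q = inverse e0" and "d = q - 1" and "f = e0 - 1"
  have e0: "cmod e0 = 1" "e0 \<noteq> 0" using diag_norm[OF g0(1)] by auto
  have d: "cmod d < 1" using cmod_inverse_minus_one[OF e0(1)] g0(3) by (simp add: d_def q_def)
  have f: "cmod f < 1" using g0(3) by (simp add: f_def)
  have df: "cmod (d * f) < 1"
    unfolding norm_mult using mult_strict_mono[OF d f] by auto
  have d0: "d \<noteq> 0" "f \<noteq> 0" using g0(2) by (auto simp: d_def q_def f_def)
  have step: "utri 1 1 1 (d * X) (f * Y) (- d * X * Y) \<in> \<Gamma>" if v: "utri 1 1 1 X Y Z \<in> \<Gamma>" for X Y Z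
  proof -
    have "utri 1 1 1 (q * X) (e0 * Y) Z ** utri 1 e0 1 0 0 z0 = utri 1 e0 1 0 0 z0 ** utri 1 1 1 X Y Z"
      using e0(2) by (simp add: utri_mult utri_eq_iff q_def field_simps)
    then have "utri 1 1 1 (q * X) (e0 * Y) Z \<in> \<Gamma>"
      using right_cancel_in[OF g0(1)] mult_closed[OF g0(1) v] by metis
    moreover have "utri 1 1 1 (d * X) (f * Y) (- d * X * Y) ** utri 1 1 1 X Y Z
        = utri 1 1 1 (q * X) (e0 * Y) Z"
      by (simp add: utri_mult utri_eq_iff d_def f_def algebra_simps)
    ultimately show ?thesis using right_cancel_in[OF v] by metis
  qed
  have it: "utri 1 1 1 (d ^ Suc n * x) (f ^ Suc n * y) (- d * x * y * (d * f) ^ n) \<in> \<Gamma>" for n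
  proof (induction n)
    case 0
    then show ?case using step[OF u] by simp
  next
    case (Suc n)
    have "- d * (d ^ Suc n * x) * (f ^ Suc n * y) = - d * x * y * (d * f) ^ Suc n"
      by (simp add: power_mult_distrib)
    moreover have "d * (d ^ Suc n * x) = d ^ Suc (Suc n) * x" "f * (f ^ Suc n * y) = f ^ Suc (Suc n) * y"
      by simp_all
    ultimately show ?case using step[OF Suc] by metis
  qed
  have "(\<lambda>n. utri 1 1 1 (d ^ Suc n * x) (f ^ Suc n * y) (- d * x * y * (d * f) ^ n))
      \<longlonglongrightarrow> utri 1 1 1 (0 * x) (0 * y) (- d * x * y * 0)"
    by (intro tendsto_utri tendsto_intros LIMSEQ_power_zero LIMSEQ_Suc d f df)
  then have "(\<lambda>n. utri 1 1 1 (d ^ Suc n * x) (f ^ Suc n * y) (- d * x * y * (d * f) ^ n)) \<longlonglongrightarrow> mat 1"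
    by (simp add: mat_eq_utri)
  from no_limit[OF it this] obtain n c where
    "utri 1 1 1 (d ^ Suc n * x) (f ^ Suc n * y) (- d * x * y * (d * f) ^ n) = mat c" by blast
  then have "d ^ Suc n * x = 0" "f ^ Suc n * y = 0"
    by (simp_all add: mat_eq_utri utri_eq_iff del: power_Suc)
  then show "x = 0" "y = 0" using d0 by auto
qed

text \<open>The commutator of \<open>g0\<close> and \<open>h\<close> is unipotent, hence central by the previous lemma. Its
  coordinates \<open>X\<close> and \<open>Y\<close> are nonzero multiples of \<open>x\<close> and \<open>y\<close>, because \<open>e0 \<noteq> 1\<close>.\<close>

lemma offdiag_zero:
  assumes h: "utri 1 e 1 x y z \<in> \<Gamma>" shows "x = 0" "y = 0"
proof -
  have e: "e \<noteq> 0" "e0 \<noteq> 0" using diag_norm[OF h] diag_norm[OF g0(1)] by auto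
  define X Y where "X = (x - x * e0) / (e * e0)" and "Y = e0 * y - y"
  have "utri 1 1 1 X Y (- X * y) ** (utri 1 e 1 x y z ** utri 1 e0 1 0 0 z0)
      = utri 1 e0 1 0 0 z0 ** utri 1 e 1 x y z"
    using e by (simp add: utri_mult utri_eq_iff X_def Y_def)
  then have "utri 1 1 1 X Y (- X * y) \<in> \<Gamma>"
    using right_cancel_in mult_closed h g0(1) by metis
  then have "X = 0" "Y = 0" using unipotents_central by blast+
  then show "x = 0" "y = 0" using e g0(2) by (auto simp: X_def Y_def)
qed

lemma conj_special:
  "\<exists>P. invertible P \<and> (\<forall>g\<in>\<Gamma>. screw_form (conj_by P g))"
proof -
  define P :: "complex^3^3" where "P = vector [vector [1, 0, 0], vector [0, 0, 1], vector [0, 1, 0]]"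
  have P: "invertible P" by (simp add: P_def invertible_det_nz det_3)
  have "screw_form (conj_by P g)" if g: "g \<in> \<Gamma>" for g
  proof -
    obtain a b c x y z where 1: "g = utri a b c x y z" using obtain_utri[OF g] by blast
    have ac: "a = c" "a \<noteq> 0" using diag_aba[of a b c x y z] diag_norm(4)[of a b c x y z] g unfolding 1 by auto
    define e X Y Z where "e = b/a" and "X = x/a" and "Y = y/a" and "Z = z/a"
    have h: "utri 1 e 1 X Y Z \<in> \<Gamma>"
      using normalize[of a b c x y z] g ac unfolding 1 e_def X_def Y_def Z_def by simp
    have ga: "g = mat a ** utri 1 e 1 0 0 Z"
      using ac offdiag_zero[OF h] by (simp add: 1 scale_utri e_def X_def Y_def Z_def)
    have "utri 1 e 1 0 0 Z ** P = P ** utri 1 1 e Z 0 0"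
      by (simp add: vec_eq_iff forall_3 matrix_matrix_mult_def sum_3 P_def)
    then have "conj_by P g = mat a ** utri 1 1 e Z 0 0"
      unfolding ga conj_by_scale using conj_by_eqI[OF P] by metis
    then show ?thesis unfolding screw_form_def by blast
  qed
  with P show ?thesis by blast
qed

end

section \<open>Classification up to conjugacy\<close>

text \<open>The diagonal of a triangular matrix up to a common factor. On a group of triangular matrices it is a
  homomorphism that depends on the class in PSL(3,C) only, with the unipotent classes as its kernel.\<close>

definition diag_ratios :: "complex^3^3 \<Rightarrow> complex \<times> complex" where
  "diag_ratios g = (g$1$1 / g$2$2, g$2$2 / g$3$3)"

lemma diag_ratios_utri [simp]: "diag_ratios (utri a b c x y z) = (a / b, b / c)"
  by (simp add: diag_ratios_def)

lemma conj_by_unipotent_utri: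
  "conj_by (utri 1 1 1 p q 0) (utri a b c x y z) =
     utri a b c (x + (a - b) * p) (y + (b - c) * q) (x * q + z - p * (y + (b - c) * q))"
  by (rule conj_by_eqI) (simp_all add: invertible_utri utri_mult utri_eq_iff algebra_simps)

context upper_lifts begin

lemma diag_mult:
  assumes "g \<in> \<Gamma>" "h \<in> \<Gamma>"
  shows "(g ** h) $ 1 $ 1 = g$1$1 * h$1$1" "(g ** h) $ 2 $ 2 = g$2$2 * h$2$2"
    "(g ** h) $ 3 $ 3 = g$3$3 * h$3$3"
  using upper[OF assms(1)] upper[OF assms(2)]
  by (simp_all add: matrix_matrix_mult_def sum_3 upper_def)

lemma diag_norm':
  assumes "g \<in> \<Gamma>"
  shows "cmod (g$1$1) = 1" "cmod (g$2$2) = 1" "cmod (g$3$3) = 1"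
proof -
  obtain a b c x y z where "g = utri a b c x y z" using obtain_utri[OF assms] by blast
  then show "cmod (g$1$1) = 1" "cmod (g$2$2) = 1" "cmod (g$3$3) = 1"
    using diag_norm(1-3)[of a b c x y z] assms by auto
qed

lemma screw_of_aac:
  assumes eq: "\<And>g. g \<in> \<Gamma> \<Longrightarrow> g$1$1 = g$2$2" and inf: "infinite (diag_ratios ` \<Gamma>)"
  shows "\<exists>P. invertible P \<and> (\<forall>g\<in>\<Gamma>. screw_form (conj_by P g))"
proof -
  define f where "f g = g$3$3 / g$1$1" for g :: "complex^3^3"
  have "diag_ratios ` \<Gamma> \<subseteq> (\<lambda>e. (1, inverse e)) ` f ` \<Gamma>"
  proof
    fix p assume "p \<in> diag_ratios ` \<Gamma>"
    then obtain g where g: "g \<in> \<Gamma>" "p = diag_ratios g" by blast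
    have "g$2$2 \<noteq> 0" using diag_norm'(2)[OF g(1)] by auto
    then have "p = (1, inverse (f g))" using g eq[OF g(1)] by (simp add: diag_ratios_def f_def)
    then show "p \<in> (\<lambda>e. (1, inverse e)) ` f ` \<Gamma>" using g(1) by blast
  qed
  then have inf': "infinite (f ` \<Gamma>)" using inf finite_surj by blast
  have "\<exists>g\<in>\<Gamma>. f g \<noteq> 1 \<and> cmod (f g - 1) < 1"
    by (rule exists_near_one[OF _ _ inf'])
      (use diag_norm' in \<open>simp_all add: f_def diag_mult norm_divide\<close>)
  then obtain g where g: "g \<in> \<Gamma>" "f g \<noteq> 1" "cmod (f g - 1) < 1" by blast
  obtain a b c x y z where u: "g = utri a b c x y z" using obtain_utri[OF g(1)] by blast
  have ab: "a = b" "a \<noteq> 0" using eq[OF g(1)] diag_norm(4)[of a b c x y z] g(1) by (auto simp: u)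
  interpret near_one_aac \<Gamma> "c/a" "x/a" "y/a" "z/a"
  proof
    show "utri 1 1 (c/a) (x/a) (y/a) (z/a) \<in> \<Gamma>" using normalize[of a b c x y z] g(1) ab u by simp
    show "c/a \<noteq> 1" "cmod (c/a - 1) < 1" using g(2,3) by (auto simp: u f_def)
    show "a = b" if "utri a b c x y z \<in> \<Gamma>" for a b c x y z using eq[OF that] by simp
  qed
  show ?thesis by (rule conj_special)
qed

lemma upper_lifts_conj_by:
  "upper_lifts (conj_by (utri 1 1 1 p q 0) ` \<Gamma>)"
proof -
  interpret C: parabolic_lifts "conj_by (utri 1 1 1 p q 0) ` \<Gamma>"
    by (rule parabolic_lifts_conj_by) (auto intro: invertible_utri parabolic_lifts_axioms)
  show ?thesis
  proof
    fix g assume "g \<in> conj_by (utri 1 1 1 p q 0) ` \<Gamma>"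
    then obtain h where h: "h \<in> \<Gamma>" "g = conj_by (utri 1 1 1 p q 0) h" by blast
    obtain a b c x y z where "h = utri a b c x y z" using obtain_utri[OF h(1)] by blast
    then show "upper g" unfolding h(2) by (simp add: conj_by_unipotent_utri upper_def)
  qed
qed

lemma screw_of_aba:
  assumes eq: "\<And>g. g \<in> \<Gamma> \<Longrightarrow> g$1$1 = g$3$3" and inf: "infinite (diag_ratios ` \<Gamma>)"
  shows "\<exists>P. invertible P \<and> (\<forall>g\<in>\<Gamma>. screw_form (conj_by P g))"
proof -
  define f where "f g = g$2$2 / g$1$1" for g :: "complex^3^3"
  have "diag_ratios ` \<Gamma> \<subseteq> (\<lambda>e. (inverse e, e)) ` f ` \<Gamma>"
  proof
    fix p assume "p \<in> diag_ratios ` \<Gamma>"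
    then obtain g where g: "g \<in> \<Gamma>" "p = diag_ratios g" by blast
    then have "p = (inverse (f g), f g)" using eq[OF g(1)] by (simp add: diag_ratios_def f_def)
    then show "p \<in> (\<lambda>e. (inverse e, e)) ` f ` \<Gamma>" using g(1) by blast
  qed
  then have inf': "infinite (f ` \<Gamma>)" using inf finite_surj by blast
  have "\<exists>g\<in>\<Gamma>. f g \<noteq> 1 \<and> cmod (f g - 1) < 1"
    by (rule exists_near_one[OF _ _ inf'])
      (use diag_norm' in \<open>simp_all add: f_def diag_mult norm_divide\<close>)
  then obtain g where g: "g \<in> \<Gamma>" "f g \<noteq> 1" "cmod (f g - 1) < 1" by blast
  obtain a b c x y z where u: "g = utri a b c x y z" using obtain_utri[OF g(1)] by blast
  have ac: "a = c" "a \<noteq> 0" using eq[OF g(1)] diag_norm(4)[of a b c x y z] g(1) by (auto simp: u)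
  define e X Y Z where "e = b/a" and "X = x/a" and "Y = y/a" and "Z = z/a"
  have n: "utri 1 e 1 X Y Z \<in> \<Gamma>"
    using normalize[of a b c x y z] g(1) ac u by (simp add: e_def X_def Y_def Z_def)
  have e: "e \<noteq> 1" "cmod (e - 1) < 1" using g(2,3) by (auto simp: u f_def e_def)
  \<comment> \<open>Conjugation by \<open>utri 1 1 1 p q 0\<close> clears both entries next to the diagonal of the normalized \<open>g\<close>.\<close>
  define p q where "p = X / (e - 1)" and "q = Y / (1 - e)"
  let ?P = "utri 1 1 1 p q 0"
  have pq: "X + (1 - e) * p = 0" "Y + (e - 1) * q = 0"
    using e(1) by (simp_all add: p_def q_def field_simps)
  have P: "invertible ?P" by (simp add: invertible_utri)
  interpret C: upper_lifts "conj_by ?P ` \<Gamma>" by (rule upper_lifts_conj_by)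
  interpret C: near_one_aba "conj_by ?P ` \<Gamma>" e "X * q + Z"
  proof
    have "conj_by ?P (utri 1 e 1 X Y Z) = utri 1 e 1 0 0 (X * q + Z)"
      unfolding conj_by_unipotent_utri by (simp add: pq)
    then show "utri 1 e 1 0 0 (X * q + Z) \<in> conj_by ?P ` \<Gamma>" using n by (metis image_eqI)
    show "e \<noteq> 1" "cmod (e - 1) < 1" by (fact e)+
    fix a b c x y z assume "utri a b c x y z \<in> conj_by ?P ` \<Gamma>"
    then obtain h where h: "h \<in> \<Gamma>" "utri a b c x y z = conj_by ?P h" by blast
    obtain a' b' c' x' y' z' where "h = utri a' b' c' x' y' z'" using obtain_utri[OF h(1)] by blast
    then show "a = c" using h eq[OF h(1)] by (simp add: conj_by_unipotent_utri utri_eq_iff)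
  qed
  obtain Q where Q: "invertible Q"
    "\<And>g. g \<in> \<Gamma> \<Longrightarrow> screw_form (conj_by Q (conj_by ?P g))"
    using C.conj_special by blast
  have "screw_form (conj_by (?P ** Q) g)" if "g \<in> \<Gamma>" for g
    using Q(2)[OF that] unfolding conj_by_conj_by[OF P Q(1)] .
  then show ?thesis using invertible_mult[OF P Q(1)] by blast
qed

lemma upper_lifts_flip_transpose: "upper_lifts (conj_by flip ` transpose ` \<Gamma>)"
proof -
  interpret C: parabolic_lifts "conj_by flip ` transpose ` \<Gamma>"
    by (intro parabolic_lifts_conj_by parabolic_lifts_transpose invertible_flip parabolic_lifts_axioms)
  show ?thesis
  proof
    fix g assume "g \<in> conj_by flip ` transpose ` \<Gamma>"
    then obtain h where h: "h \<in> \<Gamma>" "g = conj_by flip (transpose h)" by blast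
    obtain a b c x y z where "h = utri a b c x y z" using obtain_utri[OF h(1)] by blast
    then show "upper g" unfolding h(2) by (simp add: conj_by_flip_transpose upper_def)
  qed
qed

text \<open>Transposing and reversing the basis exchanges the first and the third diagonal entry.\<close>

lemma screw_of_abb:
  assumes eq: "\<And>g. g \<in> \<Gamma> \<Longrightarrow> g$2$2 = g$3$3" and inf: "infinite (diag_ratios ` \<Gamma>)"
  shows "\<exists>P. invertible P \<and> (\<forall>g\<in>\<Gamma>. screw_form (conj_by P g))"
proof -
  let ?c = "\<lambda>g. conj_by flip (transpose g)"
  have im: "conj_by flip ` transpose ` \<Gamma> = ?c ` \<Gamma>" by (simp add: image_image)
  interpret C: upper_lifts "?c ` \<Gamma>" using upper_lifts_flip_transpose unfolding im .
  have r: "diag_ratios g = (\<lambda>(r, s). (inverse s, inverse r)) (diag_ratios (?c g))"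
    and d: "?c g $ 1 $ 1 = g$3$3" "?c g $ 2 $ 2 = g$2$2" if g: "g \<in> \<Gamma>" for g
  proof -
    obtain a b c x y z where "g = utri a b c x y z" using obtain_utri[OF g(1)] by blast
    then show "diag_ratios g = (\<lambda>(r, s). (inverse s, inverse r)) (diag_ratios (?c g))"
      "?c g $ 1 $ 1 = g$3$3" "?c g $ 2 $ 2 = g$2$2"
      by (simp_all add: conj_by_flip_transpose)
  qed
  have "diag_ratios ` \<Gamma> \<subseteq> (\<lambda>(r, s). (inverse s, inverse r)) ` diag_ratios ` ?c ` \<Gamma>"
    using r by (metis (no_types, lifting) image_eqI image_subsetI)
  then have inf': "infinite (diag_ratios ` ?c ` \<Gamma>)" using inf finite_surj by blast
  have "\<exists>P. invertible P \<and> (\<forall>g\<in>?c ` \<Gamma>. screw_form (conj_by P g))"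
    by (rule C.screw_of_aac[OF _ inf']) (use d eq in auto)
  then obtain P where P: "invertible P" "\<And>g. g \<in> \<Gamma> \<Longrightarrow> screw_form (conj_by P (?c g))" by blast
  note FP = invertible_mult[OF invertible_flip P(1)]
  let ?Q = "transpose (matrix_inv (flip ** P))"
  note Q = transpose_conj_by(2)[OF FP]
  \<comment> \<open>Transposing the result moves the entry \<open>w\<close> below the diagonal; exchanging the first two basis vectors moves it back.\<close>
  define R :: "complex^3^3" where "R = vector [vector [0, 1, 0], vector [1, 0, 0], vector [0, 0, 1]]"
  have R: "invertible R" by (simp add: R_def invertible_det_nz det_3)
  have "screw_form (conj_by (?Q ** R) g)" if g: "g \<in> \<Gamma>" for g
  proof -
    obtain k w e where s: "conj_by P (?c g) = mat k ** utri 1 1 e w 0 0"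
      using P(2)[OF g] unfolding screw_form_def by blast
    then have "conj_by (flip ** P) (transpose g) = mat k ** utri 1 1 e w 0 0"
      by (simp add: conj_by_conj_by[OF invertible_flip P(1)])
    then have "conj_by ?Q g = transpose (mat k ** utri 1 1 e w 0 0)"
      using transpose_conj_by(1)[OF FP, of "transpose g"] by simp
    also have "\<dots> ** R = R ** (mat k ** utri 1 1 e w 0 0)"
      unfolding scale_utri
      by (simp add: vec_eq_iff forall_3 matrix_matrix_mult_def sum_3 R_def transpose_nth)
    finally have "conj_by R (conj_by ?Q g) = mat k ** utri 1 1 e w 0 0"
      by (intro conj_by_eqI[OF R])
    then show ?thesis unfolding conj_by_conj_by[OF Q R] screw_form_def by blast
  qed
  then show ?thesis using invertible_mult[OF Q R] by blast
qed

lemma finite_ratios_or_screw: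
  "finite (diag_ratios ` \<Gamma>) \<or> (\<exists>P. invertible P \<and> (\<forall>g\<in>\<Gamma>. screw_form (conj_by P g)))"
proof (cases "finite (diag_ratios ` \<Gamma>)")
  case False
  have "finite (diag_ratios ` \<Gamma>) \<or> (\<forall>(r, s)\<in>diag_ratios ` \<Gamma>. r = 1) \<or>
    (\<forall>(r, s)\<in>diag_ratios ` \<Gamma>. s = 1) \<or> (\<forall>(r, s)\<in>diag_ratios ` \<Gamma>. r * s = 1)"
  proof (rule finite_or_constant_of_three_characters)
    fix r s r' s' assume "(r, s) \<in> diag_ratios ` \<Gamma>" "(r', s') \<in> diag_ratios ` \<Gamma>"
    then obtain g h where g: "g \<in> \<Gamma>" "h \<in> \<Gamma>" "(r, s) = diag_ratios g" "(r', s') = diag_ratios h"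
      by blast
    then have "(r * r', s * s') = diag_ratios (g ** h)"
      by (simp add: diag_ratios_def diag_mult)
    then show "(r * r', s * s') \<in> diag_ratios ` \<Gamma>" using mult_closed[OF g(1,2)] by blast
  next
    fix r s assume "(r, s) \<in> diag_ratios ` \<Gamma>"
    then obtain g where g: "g \<in> \<Gamma>" "(r, s) = diag_ratios g" by blast
    obtain a b c x y z where u: "g = utri a b c x y z" using obtain_utri[OF g(1)] by blast
    show "r = 1 \<or> s = 1 \<or> r * s = 1"
      using two_diag_equal[of a b c x y z] diag_norm(4-6)[of a b c x y z] g unfolding u by auto
  qed
  then consider "\<And>g. g \<in> \<Gamma> \<Longrightarrow> g$1$1 / g$2$2 = 1" | "\<And>g. g \<in> \<Gamma> \<Longrightarrow> g$2$2 / g$3$3 = 1"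
    | "\<And>g. g \<in> \<Gamma> \<Longrightarrow> g$1$1 / g$2$2 * (g$2$2 / g$3$3) = 1"
    using False unfolding diag_ratios_def by blast
  then show ?thesis
  proof cases
    case 1
    have "g$1$1 = g$2$2" if "g \<in> \<Gamma>" for g using 1[OF that] by (metis divide_eq_1_iff)
    then show ?thesis using screw_of_aac[OF _ False] by blast
  next
    case 2
    have "g$2$2 = g$3$3" if "g \<in> \<Gamma>" for g using 2[OF that] by (metis divide_eq_1_iff)
    then show ?thesis using screw_of_abb[OF _ False] by blast
  next
    case 3
    have "g$1$1 = g$3$3" if "g \<in> \<Gamma>" for g
      using 3[OF that] by (auto simp: divide_simps split: if_splits)
    then show ?thesis using screw_of_aba[OF _ False] by blast
  qed
qed simp

end

lemma (in parabolic_lifts) classification: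
  "\<exists>P. invertible P \<and>
     ((\<forall>g\<in>\<Gamma>. upper (conj_by P g)) \<and> finite (diag_ratios ` conj_by P ` \<Gamma>) \<or>
      (\<forall>g\<in>\<Gamma>. screw_form (conj_by P g)))"
proof -
  obtain P where P: "invertible P" "\<And>g. g \<in> \<Gamma> \<Longrightarrow> upper (conj_by P g)"
    using upper_triangularizable by blast
  interpret C: parabolic_lifts "conj_by P ` \<Gamma>"
    by (rule parabolic_lifts_conj_by[OF _ P(1)]) (rule parabolic_lifts_axioms)
  interpret C: upper_lifts "conj_by P ` \<Gamma>"
    by unfold_locales (use P(2) in blast)
  show ?thesis
    using C.finite_ratios_or_screw
  proof
    assume "finite (diag_ratios ` conj_by P ` \<Gamma>)"
    then show ?thesis using P by blast
  next
    assume "\<exists>Q. invertible Q \<and> (\<forall>g\<in>conj_by P ` \<Gamma>. screw_form (conj_by Q g))"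
    then obtain Q where Q: "invertible Q" "\<And>g. g \<in> \<Gamma> \<Longrightarrow> screw_form (conj_by Q (conj_by P g))"
      by blast
    have "screw_form (conj_by (P ** Q) g)" if "g \<in> \<Gamma>" for g
      using Q(2)[OF that] unfolding conj_by_conj_by[OF P(1) Q(1)] .
    then show ?thesis using invertible_mult[OF P(1) Q(1)] by blast
  qed
qed

section \<open>Classes in PSL(3,C)\<close>

lemma PSL3_class_coset: "det A = 1 \<Longrightarrow> PSL3_class A = SL3_scalars #>\<^bsub>SL3\<^esub> A"
  by (rule PSL3_class_eq_coset[where c = 1]) (simp_all add: SL3_def)

text \<open>The class is a class of matrices up to arbitrary scalars. This is why lifts need not be
  normalized to determinant 1 in what follows.\<close>

lemma PSL3_class_scale:
  assumes "c \<noteq> 0" shows "PSL3_class (mat c ** A) = PSL3_class A"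
proof -
  have "(\<exists>d. B = mat d ** (mat c ** A)) \<longleftrightarrow> (\<exists>d. B = mat d ** A)" for B
  proof
    assume "\<exists>d. B = mat d ** (mat c ** A)"
    then show "\<exists>d. B = mat d ** A" by (auto simp: matrix_mul_assoc mat_mult_mat)
  next
    assume "\<exists>d. B = mat d ** A"
    then obtain d where "B = mat d ** A" by blast
    then have "B = mat (d / c) ** (mat c ** A)" using assms by (simp add: matrix_mul_assoc mat_mult_mat)
    then show "\<exists>d. B = mat d ** (mat c ** A)" by blast
  qed
  then show ?thesis by (simp add: PSL3_class_def)
qed

lemma norm_eq_1_of_cube: "cmod c ^ 3 = 1 \<Longrightarrow> cmod c = 1"
  using power_eq_imp_eq_base[of "cmod c" 3 1] by simp

lemma obtain_SL3_multiple:
  fixes A :: "complex^3^3"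
  assumes "invertible A"
  obtains c where "c \<noteq> 0" "det (mat c ** A) = 1" "c ^ 3 * det A = 1"
proof -
  have d: "det A \<noteq> 0" using assms invertible_det_nz by blast
  obtain c where c: "c ^ 3 = inverse (det A)"
    using exists_complex_root[of 3 "inverse (det A)"] by (metis zero_neq_numeral)
  have "c \<noteq> 0" using c d by auto
  moreover have "c ^ 3 * det A = 1" using c d by simp
  ultimately show ?thesis using that[of c] by (simp add: det_mul det_mat3)
qed

lemma mem_PSL3_class: "det (mat c ** A) = 1 \<Longrightarrow> mat c ** A \<in> PSL3_class A"
  by (auto simp: PSL3_class_def SL3_def)

lemma PSL3_class_eq_iff:
  assumes "invertible A" "invertible B"
  shows "PSL3_class A = PSL3_class B \<longleftrightarrow> (\<exists>c. c \<noteq> 0 \<and> A = mat c ** B)"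
proof
  assume e: "PSL3_class A = PSL3_class B"
  obtain c where c: "c \<noteq> 0" "det (mat c ** A) = 1" using obtain_SL3_multiple[OF assms(1)] by blast
  then obtain d where d: "mat c ** A = mat d ** B"
    using mem_PSL3_class[OF c(2)] unfolding e by (auto simp: PSL3_class_def)
  have "A = mat (d / c) ** B"
    using arg_cong[OF d, of "\<lambda>X. mat (inverse c) ** X"] c(1)
    by (simp add: matrix_mul_assoc mat_mult_mat divide_inverse mult.commute)
  moreover have "d \<noteq> 0" using d c(2) by (auto simp: det_mul det_mat3)
  ultimately show "\<exists>c. c \<noteq> 0 \<and> A = mat c ** B" using c(1) by (metis divide_eq_0_iff)
qed (auto simp: PSL3_class_scale)

lemma PSL3_class_mult:
  assumes "invertible A" "invertible B"
  shows "PSL3_class A \<otimes>\<^bsub>PSL3\<^esub> PSL3_class B = PSL3_class (A ** B)"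
proof -
  interpret N: normal SL3_scalars SL3 by (rule normal_SL3_scalars)
  obtain c where c: "c \<noteq> 0" "det (mat c ** A) = 1" using obtain_SL3_multiple[OF assms(1)] by blast
  obtain d where d: "d \<noteq> 0" "det (mat d ** B) = 1" using obtain_SL3_multiple[OF assms(2)] by blast
  have "PSL3_class (mat c ** A) \<otimes>\<^bsub>PSL3\<^esub> PSL3_class (mat d ** B)
      = SL3_scalars #>\<^bsub>SL3\<^esub> ((mat c ** A) \<otimes>\<^bsub>SL3\<^esub> (mat d ** B))"
    unfolding PSL3_class_coset[OF c(2)] PSL3_class_coset[OF d(2)]
    using N.rcos_sum[of "mat c ** A" "mat d ** B"] c(2) d(2)
    by (simp add: PSL3_def FactGroup_def SL3_def)
  also have "(mat c ** A) \<otimes>\<^bsub>SL3\<^esub> (mat d ** B) = mat (c * d) ** (A ** B)"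
    by (metis (no_types, lifting) SL3_def mat_commute mat_mult_mat matrix_mul_assoc monoid.select_convs(1))
  also have "SL3_scalars #>\<^bsub>SL3\<^esub> (mat (c * d) ** (A ** B)) = PSL3_class (mat (c * d) ** (A ** B))"
  proof (rule PSL3_class_coset[symmetric])
    have "det (mat (c * d) ** (A ** B)) = det (mat c ** A) * det (mat d ** B)"
      by (simp add: det_mul det_mat3 power_mult_distrib)
    then show "det (mat (c * d) ** (A ** B)) = 1" using c(2) d(2) by simp
  qed
  finally show ?thesis using c(1) d(1) by (simp add: PSL3_class_scale)
qed

lemma one_PSL3: "\<one>\<^bsub>PSL3\<^esub> = PSL3_class (mat 1)"
proof -
  have "SL3_scalars #>\<^bsub>SL3\<^esub> mat 1 = SL3_scalars"
    using group.coset_mult_one[OF group_SL3, of SL3_scalars]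
      subgroup.subset[OF normal_imp_subgroup[OF normal_SL3_scalars]] by (simp add: SL3_def)
  then show ?thesis by (simp add: PSL3_class_coset PSL3_def FactGroup_def)
qed

lemma invertible_matrix_inv: "invertible A \<Longrightarrow> invertible (matrix_inv A :: complex^'n^'n)"
  unfolding invertible_def using matrix_inv_left matrix_inv_right invertible_def by blast

lemma inv_PSL3_class:
  assumes "invertible A" shows "inv\<^bsub>PSL3\<^esub> PSL3_class A = PSL3_class (matrix_inv A)"
  by (rule group.inv_equality[OF group_PSL3])
    (simp_all add: PSL3_class_mult assms invertible_matrix_inv matrix_inv_left one_PSL3
      PSL3_class_in_PSL3)

lemma mem_carrier_PSL3:
  assumes "g \<in> carrier PSL3" "B \<in> g" shows "det B = 1" "g = PSL3_class B"
proof -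
  obtain A where A: "det A = 1" "g = SL3_scalars #>\<^bsub>SL3\<^esub> A"
    using assms(1) by (auto simp: PSL3_def FactGroup_def RCOSETS_def SL3_def)
  then obtain c where c: "c ^ 3 = 1" "B = mat c ** A"
    using assms(2) by (auto simp: r_coset_def SL3_scalars_def SL3_def)
  then show "det B = 1" using A(1) by (simp add: det_mul det_mat3)
  have "c \<noteq> 0" using c(1) by auto
  then show "g = PSL3_class B" using A c(2) by (simp add: PSL3_class_scale PSL3_class_coset)
qed

lemma carrier_PSL3_nonempty:
  assumes "g \<in> carrier PSL3" obtains B where "B \<in> g" "det B = 1" "g = PSL3_class B"
proof -
  obtain A where A: "det A = 1" "g = SL3_scalars #>\<^bsub>SL3\<^esub> A"
    using assms(1) by (auto simp: PSL3_def FactGroup_def RCOSETS_def SL3_def)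
  then have "g = PSL3_class A" by (simp add: PSL3_class_coset)
  moreover have "mat 1 ** A \<in> PSL3_class A" by (rule mem_PSL3_class) (simp add: A)
  ultimately show ?thesis using that[of A] A(1) by simp
qed

lemma diagonalizable_scale:
  assumes "diagonalizable A" shows "diagonalizable (mat c ** A :: complex^3^3)"
proof -
  obtain P D :: "complex^3^3" where P: "invertible P" and D: "\<And>i j. i \<noteq> j \<Longrightarrow> D $ i $ j = 0"
    and e: "A = P ** D ** matrix_inv P" using assms unfolding diagonalizable_def by blast
  have "A ** P = P ** D"
    by (simp add: e matrix_mul_assoc[symmetric] matrix_inv_left[OF P])
  then have "mat c ** A ** P = P ** (mat c ** D)"
    by (metis mat_commute matrix_mul_assoc)
  then show ?thesis
    by (rule diagonalizableI[OF P]) (simp add: mat_scale_left D)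
qed

lemma mat_eigenvalue_scale: "mat_eigenvalue A k \<Longrightarrow> mat_eigenvalue (mat c ** A) (c * k)"
  unfolding mat_eigenvalue_def
  by (metis mat_mult_vec matrix_vector_mul_assoc vector_smult_assoc)

text \<open>Lifts are normalized up to unimodular scalars only, so that they contain every unimodular scalar
  matrix and not just the cube roots of unity.\<close>

definition lifts :: "(complex^3^3) set set \<Rightarrow> (complex^3^3) set" where
  "lifts G = {A. cmod (det A) = 1 \<and> PSL3_class A \<in> G}"

lemma lifts_invertible: "A \<in> lifts G \<Longrightarrow> invertible A"
  by (auto simp: lifts_def invertible_det_nz)

lemma subgroup_eq_image_lifts:
  assumes "subgroup G PSL3" shows "G = PSL3_class ` lifts G"
proof
  show "G \<subseteq> PSL3_class ` lifts G"
  proof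
    fix g assume g: "g \<in> G"
    then have "g \<in> carrier PSL3" using subgroup.mem_carrier[OF assms] by blast
    then obtain B where "det B = 1" "g = PSL3_class B" using carrier_PSL3_nonempty by blast
    then show "g \<in> PSL3_class ` lifts G" using g by (auto simp: lifts_def)
  qed
qed (auto simp: lifts_def)

lemma tendsto_det_3: "X \<longlonglongrightarrow> (A :: complex^3^3) \<Longrightarrow> (\<lambda>n. det (X n)) \<longlonglongrightarrow> det A"
  unfolding det_3 by (intro tendsto_intros tendsto_vec_nth)

text \<open>The main point is discreteness. If lifts \<open>X n\<close> tend to the identity, rescale them
  by unimodular \<open>c n\<close> into SL(3,C). By compactness of the circle the rescaled matrices tend to a scalar matrix of
  determinant 1 along a subsequence, a point over the identity of PSL(3,C). They eventually enter the preimage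
  of a neighbourhood that isolates the identity in \<open>G\<close>.\<close>

lemma parabolic_lifts_of_subgroup:
  assumes disc: "discrete_subgroup_PSL3 G" and par: "purely_parabolic G"
  shows "parabolic_lifts (lifts G)"
proof -
  have G: "subgroup G PSL3" using disc by (simp add: discrete_subgroup_PSL3_def)
  have one: "PSL3_class (mat 1) \<in> G" using subgroup.one_closed[OF G] by (simp add: one_PSL3)
  have trivial_or_parabolic: "(\<exists>c. c \<noteq> 0 \<and> A = mat c) \<or>
      \<not> diagonalizable A \<and> (\<forall>k. mat_eigenvalue A k \<longrightarrow> cmod k = 1)" if A: "A \<in> lifts G" for A
  proof (cases "PSL3_class A = \<one>\<^bsub>PSL3\<^esub>")
    case True
    then show ?thesis
      using PSL3_class_eq_iff[OF lifts_invertible[OF A] invertible_mat_one] by (auto simp: one_PSL3)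
  next
    case False
    then have p: "parabolic (PSL3_class A)"
      using A par by (simp add: purely_parabolic_def lifts_def)
    obtain c where c: "c \<noteq> 0" "det (mat c ** A) = 1" "c ^ 3 * det A = 1"
      using obtain_SL3_multiple[OF lifts_invertible[OF A]] by blast
    have "cmod (c ^ 3 * det A) = 1" using c(3) by simp
    then have "cmod c ^ 3 = 1" using A by (simp add: norm_mult norm_power lifts_def)
    then have nc: "cmod c = 1" by (rule norm_eq_1_of_cube)
    have np: "\<not> diagonalizable (mat c ** A)" "\<And>k. mat_eigenvalue (mat c ** A) k \<Longrightarrow> cmod k = 1"
      using p mem_PSL3_class[OF c(2)] unfolding parabolic_def by blast+
    have "cmod k = 1" if "mat_eigenvalue A k" for k
      using np(2)[OF mat_eigenvalue_scale[OF that]] nc by (simp add: norm_mult)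
    then show ?thesis using np(1) diagonalizable_scale by blast
  qed
  show ?thesis
  proof
    fix c :: complex assume c: "cmod c = 1"
    then have "c \<noteq> 0" by auto
    then have "PSL3_class (mat c) = PSL3_class (mat 1)" using PSL3_class_scale[of c "mat 1"] by simp
    then show "mat c \<in> lifts G" using one c by (simp add: lifts_def det_mat3 norm_power)
  next
    fix A B assume AB: "A \<in> lifts G" "B \<in> lifts G"
    then have "PSL3_class (A ** B) = PSL3_class A \<otimes>\<^bsub>PSL3\<^esub> PSL3_class B"
      using PSL3_class_mult lifts_invertible by metis
    then have "PSL3_class (A ** B) \<in> G"
      using subgroup.m_closed[OF G] AB by (simp add: lifts_def)
    then show "A ** B \<in> lifts G" using AB by (simp add: lifts_def det_mul norm_mult)
  next
    fix A assume A: "A \<in> lifts G"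
    note i = lifts_invertible[OF A]
    have "cmod (det A) * cmod (det (matrix_inv A)) = 1"
      using arg_cong[OF matrix_inv_right[OF i], of det] by (simp add: det_mul flip: norm_mult)
    then have "matrix_inv A \<in> lifts G"
      using A subgroup.m_inv_closed[OF G, of "PSL3_class A"] inv_PSL3_class[OF i]
      by (simp add: lifts_def)
    then show "\<exists>B\<in>lifts G. A ** B = mat 1" using matrix_inv_right[OF i] by blast
  next
    fix A assume "A \<in> lifts G" "diagonalizable A"
    then show "\<exists>c. A = mat c" using trivial_or_parabolic by blast
  next
    fix A k assume A: "A \<in> lifts G" "mat_eigenvalue A k"
    show "cmod k = 1"
    proof (cases "\<exists>c. c \<noteq> 0 \<and> A = mat c")
      case True
      then obtain c where c: "A = mat c" by blast
      have "cmod c ^ 3 = 1" using A(1) by (simp add: lifts_def c det_mat3 norm_power)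
      then have "cmod c = 1" by (rule norm_eq_1_of_cube)
      moreover have "k = c"
        using A(2) unfolding c mat_eq_utri mat_eigenvalue_utri by simp
      ultimately show ?thesis by simp
    qed (use A trivial_or_parabolic in blast)
  next
    fix X assume X: "\<And>n. X n \<in> lifts G" "X \<longlonglongrightarrow> mat 1"
    have "openin (subtopology PSL3_topology G) {\<one>\<^bsub>PSL3\<^esub>}"
      using disc subgroup.one_closed[OF G] by (simp add: discrete_subgroup_PSL3_def)
    then obtain U where U: "openin PSL3_topology U" "{\<one>\<^bsub>PSL3\<^esub>} = U \<inter> G"
      by (auto simp: openin_subtopology)
    then obtain V where V: "open V" "\<Union>U = carrier SL3 \<inter> V" and UC: "U \<subseteq> carrier PSL3"
      by (auto simp: openin_PSL3_topology openin_open)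
    have "\<exists>c. cmod c = 1 \<and> det (mat c ** X n) = 1" for n
    proof -
      obtain c where c: "det (mat c ** X n) = 1" "c ^ 3 * det (X n) = 1"
        using obtain_SL3_multiple[OF lifts_invertible[OF X(1)]] by blast
      have "cmod (c ^ 3 * det (X n)) = 1" using c(2) by simp
      then have "cmod c ^ 3 = 1" using X(1)[of n] by (simp add: norm_mult norm_power lifts_def)
      then have "cmod c = 1" by (rule norm_eq_1_of_cube)
      with c(1) show ?thesis by blast
    qed
    then obtain c where c: "\<And>n. cmod (c n) = 1" "\<And>n. det (mat (c n) ** X n) = 1" by metis
    have "compact (sphere (0 :: complex) 1)" by simp
    moreover have "\<forall>n. c n \<in> sphere 0 1" using c(1) by simp
    ultimately obtain l r where l: "l \<in> sphere 0 1" "strict_mono (r :: nat \<Rightarrow> nat)" "(c \<circ> r) \<longlonglongrightarrow> l"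
      unfolding compact_def by blast
    define B where "B n = mat (c (r n)) ** X (r n)" for n
    have "(\<lambda>n. utri (c (r n)) (c (r n)) (c (r n)) 0 0 0) \<longlonglongrightarrow> utri l l l 0 0 0"
      using l(3) by (intro tendsto_utri) (auto simp: o_def)
    then have "(\<lambda>n. mat (c (r n)) :: complex^3^3) \<longlonglongrightarrow> mat l" by (simp add: mat_eq_utri)
    moreover have "(\<lambda>n. X (r n)) \<longlonglongrightarrow> mat 1"
      using LIMSEQ_subseq_LIMSEQ[OF X(2) l(2)] by (simp add: o_def)
    ultimately have "B \<longlonglongrightarrow> mat l ** mat 1"
      unfolding B_def matrix_matrix_mult_def
      by (intro vec_tendstoI) (auto intro!: tendsto_intros tendsto_vec_nth)
    then have BL: "B \<longlonglongrightarrow> mat l" by simp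
    have "det (mat l :: complex^3^3) = 1"
      using tendsto_det_3[OF BL] c(2) by (simp add: B_def LIMSEQ_const_iff)
    then have "mat l \<in> SL3_scalars" by (auto simp: SL3_scalars_def det_mat3)
    moreover have "SL3_scalars \<in> U" using U(2) by (auto simp: PSL3_def FactGroup_def)
    ultimately have "mat l \<in> V" using V(2) by blast
    then have "eventually (\<lambda>n. B n \<in> V) sequentially"
      using BL V(1) by (simp add: tendsto_def)
    then obtain n where n: "B n \<in> V" by (meson eventually_sequentially order_refl)
    moreover have dB: "det (B n) = 1" using c(2) by (simp add: B_def)
    ultimately have "B n \<in> \<Union>U" using V(2) by (simp add: SL3_def)
    then obtain u where u: "u \<in> U" "B n \<in> u" by blast
    have cn: "c (r n) \<noteq> 0" using c(1)[of "r n"] by auto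
    have "u = PSL3_class (B n)" using mem_carrier_PSL3 u UC by blast
    also have "\<dots> = PSL3_class (X (r n))" unfolding B_def by (rule PSL3_class_scale[OF cn])
    finally have "PSL3_class (X (r n)) = \<one>\<^bsub>PSL3\<^esub>"
      using u(1) U(2) X(1)[of "r n"] by (auto simp: lifts_def)
    then have "\<exists>d. X (r n) = mat d"
      using PSL3_class_eq_iff[OF lifts_invertible[OF X(1)] invertible_mat_one] by (auto simp: one_PSL3)
    then show "\<exists>n c. X n = mat c" by blast
  qed
qed

section \<open>The virtually unipotent case\<close>

lemma finite_index_subgroup_self:
  assumes "group M" "subgroup G M" shows "finite_index_subgroup G G M"
proof -
  let ?M = "M\<lparr>carrier := G\<rparr>"
  have g: "group ?M" by (rule subgroup.subgroup_is_group[OF assms(2,1)])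
  have s: "subgroup G ?M" using group.subgroup_self[OF g] by simp
  have "rcosets\<^bsub>?M\<^esub> G \<subseteq> {G}"
    using group.coset_join2[OF g _ s] by (auto simp: RCOSETS_def)
  then show ?thesis using s finite_subset unfolding finite_index_subgroup_def by blast
qed

lemma unipotent_of_equal_ratios:
  assumes P: "invertible P" and e: "conj_by P A = utri a a a x y z" and "a \<noteq> 0"
  shows "unipotent (mat (inverse a) ** A)"
proof -
  let ?A = "mat (inverse a) ** A"
  define N where "N = ?A - mat 1"
  have "conj_by P N = utri 1 1 1 (x / a) (y / a) (z / a) - mat 1"
    unfolding N_def conj_by_diff conj_by_scale e conj_by_mat[OF P]
    using assms(3) by (simp add: scale_utri divide_inverse mult.commute)
  also have "\<dots> = utri 0 0 0 (x / a) (y / a) (z / a)"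
    by (simp add: vec_eq_iff forall_3 mat_def)
  finally have c: "conj_by P N = utri 0 0 0 (x / a) (y / a) (z / a)" .
  have "conj_by P (N ** (N ** N)) = utri 0 0 0 0 0 0"
    by (simp add: conj_by_mul[OF P] c utri_mult)
  then have "P ** utri 0 0 0 0 0 0 = N ** (N ** N) ** P"
    using mult_conj_by[OF P, of "N ** (N ** N)"] by simp
  moreover have "P ** utri 0 0 0 0 0 0 = 0"
    by (simp add: vec_eq_iff forall_3 matrix_matrix_mult_def sum_3)
  ultimately have "N ** (N ** N) ** P ** matrix_inv P = 0"
    by (simp add: vec_eq_iff forall_3 matrix_matrix_mult_def sum_3)
  then have "N ** (N ** N) = 0"
    by (simp add: matrix_mul_assoc[symmetric] matrix_inv_right[OF P])
  then have "(((**) (?A - mat 1)) ^^ 3) (mat 1) = 0"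
    by (simp add: N_def numeral_3_eq_3)
  then show ?thesis unfolding unipotent_def by blast
qed

text \<open>The kernel of the homomorphism \<open>diag_ratios\<close> has finite index as the image is finite, and its elements
  have a lift whose triangular form has 1 on the diagonal.\<close>

lemma virtually_unipotent_of_finite_ratios:
  assumes G: "subgroup G PSL3" and lifts: "parabolic_lifts (lifts G)" and P: "invertible P"
    and up: "\<And>A. A \<in> lifts G \<Longrightarrow> upper (conj_by P A)"
    and fin: "finite (diag_ratios ` conj_by P ` lifts G)"
  shows "virtually_unipotent G"
proof -
  interpret parabolic_lifts "lifts G" by fact
  interpret C: parabolic_lifts "conj_by P ` lifts G" by (rule parabolic_lifts_conj_by[OF lifts P])
  interpret C: upper_lifts "conj_by P ` lifts G" by unfold_locales (use up in blast)
  define \<rho> where "\<rho> A = diag_ratios (conj_by P A)" for A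
  note inv = lifts_invertible
  have \<rho>_mult: "\<rho> (A ** B) = (fst (\<rho> A) * fst (\<rho> B), snd (\<rho> A) * snd (\<rho> B))"
    if "A \<in> lifts G" "B \<in> lifts G" for A B
    unfolding \<rho>_def conj_by_mul[OF P] using C.diag_mult[of "conj_by P A" "conj_by P B"] that
    by (simp add: diag_ratios_def)
  have \<rho>_inv: "matrix_inv A \<in> lifts G" "\<rho> A = \<rho> B \<Longrightarrow> \<rho> (B ** matrix_inv A) = (1, 1)"
    if A: "A \<in> lifts G" and B: "B \<in> lifts G" for A B
  proof -
    obtain A' where A': "A' \<in> lifts G" "A ** A' = mat 1" using inverses[OF A] by blast
    have "A' = matrix_inv A"
      using A' matrix_inv_left[OF inv[OF A]] by (metis matrix_mul_assoc matrix_mul_lid matrix_mul_rid)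
    then show i: "matrix_inv A \<in> lifts G" using A'(1) by simp
    have "\<rho> (mat 1) = (1, 1)"
      unfolding \<rho>_def conj_by_one[OF P] by (simp add: mat_eq_utri)
    then have "\<rho> (A ** matrix_inv A) = (1, 1)" by (simp add: matrix_inv_right[OF inv[OF A]])
    then show "\<rho> (B ** matrix_inv A) = (1, 1)" if "\<rho> A = \<rho> B"
      using \<rho>_mult[OF A i] \<rho>_mult[OF B i] that by simp
  qed
  define H where "H = PSL3_class ` {A \<in> lifts G. \<rho> A = (1, 1)}"
  have HG: "H \<subseteq> G" by (auto simp: H_def lifts_def)
  have one1: "mat 1 \<in> lifts G" "\<rho> (mat 1) = (1, 1)"
    using scalars[of 1] by (simp_all add: \<rho>_def conj_by_one[OF P]) (simp add: mat_eq_utri)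
  have H: "subgroup H PSL3"
  proof (rule group.subgroupI[OF group_PSL3])
    show "H \<subseteq> carrier PSL3" using HG subgroup.subset[OF G] by blast
    show "H \<noteq> {}" using one1 by (auto simp: H_def)
  next
    fix h assume "h \<in> H"
    then obtain A where A: "A \<in> lifts G" "\<rho> A = (1, 1)" "h = PSL3_class A" by (auto simp: H_def)
    have "\<rho> (mat 1 ** matrix_inv A) = (1, 1)" using \<rho>_inv(2)[OF A(1) one1(1)] A(2) one1(2) by simp
    then have "\<rho> (matrix_inv A) = (1, 1)" by simp
    moreover have "inv\<^bsub>PSL3\<^esub> h = PSL3_class (matrix_inv A)"
      unfolding A(3) by (rule inv_PSL3_class[OF inv[OF A(1)]])
    ultimately show "inv\<^bsub>PSL3\<^esub> h \<in> H" using \<rho>_inv(1)[OF A(1) A(1)] unfolding H_def by blast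
  next
    fix h k assume "h \<in> H" "k \<in> H"
    then obtain A B where A: "A \<in> lifts G" "\<rho> A = (1, 1)" "h = PSL3_class A"
      and B: "B \<in> lifts G" "\<rho> B = (1, 1)" "k = PSL3_class B" by (auto simp: H_def)
    have "\<rho> (A ** B) = (1, 1)" using \<rho>_mult[OF A(1) B(1)] A(2) B(2) by simp
    moreover have "h \<otimes>\<^bsub>PSL3\<^esub> k = PSL3_class (A ** B)"
      unfolding A(3) B(3) by (rule PSL3_class_mult[OF inv[OF A(1)] inv[OF B(1)]])
    ultimately show "h \<otimes>\<^bsub>PSL3\<^esub> k \<in> H" using mult_closed[OF A(1) B(1)] unfolding H_def by blast
  qed
  let ?M = "PSL3\<lparr>carrier := G\<rparr>"
  have HM: "subgroup H ?M" by (rule group.subgroup_incl[OF group_PSL3 H G HG])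
  \<comment> \<open>The coset of an element depends on its diagonal ratios only: \<open>rep\<close> chooses one lift for each value.\<close>
  define rep where "rep p = (SOME A. A \<in> lifts G \<and> \<rho> A = p)" for p
  have "rcosets\<^bsub>?M\<^esub> H \<subseteq> (\<lambda>p. H #>\<^bsub>PSL3\<^esub> PSL3_class (rep p)) ` diag_ratios ` conj_by P ` lifts G"
  proof
    fix K assume "K \<in> rcosets\<^bsub>?M\<^esub> H"
    then obtain g where g: "g \<in> G" "K = H #>\<^bsub>PSL3\<^esub> g" by (auto simp: RCOSETS_def r_coset_def)
    then obtain A where A: "A \<in> lifts G" "g = PSL3_class A"
      using subgroup_eq_image_lifts[OF G] by blast
    let ?B = "rep (\<rho> A)"
    have "?B \<in> lifts G \<and> \<rho> ?B = \<rho> A"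
      unfolding rep_def by (rule someI[of _ A]) (use A in simp)
    then have B: "?B \<in> lifts G" "\<rho> ?B = \<rho> A" by auto
    have "A ** matrix_inv ?B \<in> lifts G" by (rule mult_closed[OF A(1) \<rho>_inv(1)[OF B(1,1)]])
    moreover have "\<rho> (A ** matrix_inv ?B) = (1, 1)" by (rule \<rho>_inv(2)[OF B(1) A(1) B(2)])
    ultimately have "PSL3_class (A ** matrix_inv ?B) \<in> H" unfolding H_def by blast
    moreover have "PSL3_class (A ** matrix_inv ?B) \<otimes>\<^bsub>PSL3\<^esub> PSL3_class ?B = g"
    proof -
      have "PSL3_class (A ** matrix_inv ?B) \<otimes>\<^bsub>PSL3\<^esub> PSL3_class ?B
          = PSL3_class (A ** matrix_inv ?B ** ?B)"
        using PSL3_class_mult[OF invertible_mult[OF inv[OF A(1)] invertible_matrix_inv[OF inv[OF B(1)]]]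
            inv[OF B(1)]] .
      then show ?thesis
        by (simp add: A(2) matrix_mul_assoc[symmetric] matrix_inv_left[OF inv[OF B(1)]])
    qed
    ultimately have "g \<in> H #>\<^bsub>PSL3\<^esub> PSL3_class ?B" unfolding r_coset_def by blast
    then have "H #>\<^bsub>PSL3\<^esub> PSL3_class ?B = K"
      unfolding g(2)
      by (rule group.repr_independence[OF group_PSL3 _ PSL3_class_in_PSL3[OF inv[OF B(1)]] H])
    moreover have "\<rho> A \<in> diag_ratios ` conj_by P ` lifts G" using A(1) by (simp add: \<rho>_def)
    ultimately show "K \<in> (\<lambda>p. H #>\<^bsub>PSL3\<^esub> PSL3_class (rep p)) ` diag_ratios ` conj_by P ` lifts G"
      by blast
  qed
  then have "finite (rcosets\<^bsub>?M\<^esub> H)" using fin finite_surj by blast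
  then have "finite_index_subgroup H G PSL3" using HM by (simp add: finite_index_subgroup_def)
  moreover have "\<exists>A\<in>h. unipotent A" if h: "h \<in> H" for h
  proof -
    obtain A where A: "A \<in> lifts G" "\<rho> A = (1, 1)" "h = PSL3_class A" using h by (auto simp: H_def)
    obtain a b c x y z where e: "conj_by P A = utri a b c x y z"
      using C.obtain_utri[of "conj_by P A"] A(1) by blast
    have "a \<noteq> 0" "b \<noteq> 0" "c \<noteq> 0" using C.diag_norm(4-6)[of a b c x y z] A(1) e by (metis image_eqI)+
    then have e': "conj_by P A = utri a a a x y z" and a: "a \<noteq> 0"
      using A(2) e by (auto simp: \<rho>_def)
    have "det A = a ^ 3" using det_conj_by[OF P, of A] e' by (simp add: det_utri power3_eq_cube)
    then have "det (mat (inverse a) ** A) = 1" using a by (simp add: det_mul det_mat3 power_inverse)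
    then have "mat (inverse a) ** A \<in> h" unfolding A(3) by (rule mem_PSL3_class)
    then show ?thesis using unipotent_of_equal_ratios[OF P e' a] by blast
  qed
  ultimately show ?thesis unfolding virtually_unipotent_def by blast
qed


section \<open>The screw case\<close>

text \<open>A group of lifts in the normal form. Its translation parts form the group \<open>W\<close> of the conclusion,
  and the rotation part is a function of the translation part.\<close>

locale screw_lifts = parabolic_lifts +
  assumes screw: "g \<in> \<Gamma> \<Longrightarrow> screw_form g"
begin

definition shifts :: "complex set" where
  "shifts = {w. \<exists>e. utri 1 1 e w 0 0 \<in> \<Gamma>}"

definition angle :: "complex \<Rightarrow> complex" where
  "angle w = (SOME e. utri 1 1 e w 0 0 \<in> \<Gamma>)"

lemma angle_in: "w \<in> shifts \<Longrightarrow> utri 1 1 (angle w) w 0 0 \<in> \<Gamma>"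
  unfolding shifts_def angle_def by (auto intro: someI_ex)

lemma shift_norm: "utri 1 1 e w 0 0 \<in> \<Gamma> \<Longrightarrow> cmod e = 1"
  using eigenvalue_norm[of "utri 1 1 e w 0 0" e] by (simp add: mat_eigenvalue_utri)

lemma angle_norm: "w \<in> shifts \<Longrightarrow> cmod (angle w) = 1"
  using angle_in shift_norm by blast

lemma shift_diff:
  assumes "utri 1 1 e w 0 0 \<in> \<Gamma>" "utri 1 1 e' w' 0 0 \<in> \<Gamma>"
  shows "utri 1 1 (e / e') (w - w') 0 0 \<in> \<Gamma>"
proof -
  have "e' \<noteq> 0" using shift_norm[OF assms(2)] by auto
  obtain h where h: "h \<in> \<Gamma>" "utri 1 1 e' w' 0 0 ** h = mat 1" using inverses[OF assms(2)] by blast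
  have "utri 1 1 (inverse e') (- w') 0 0 ** utri 1 1 e' w' 0 0 = mat 1"
    using \<open>e' \<noteq> 0\<close> by (simp add: utri_mult mat_eq_utri)
  then have "utri 1 1 (inverse e') (- w') 0 0 = h"
    by (metis h(2) matrix_mul_assoc matrix_mul_lid matrix_mul_rid)
  then have "utri 1 1 e w 0 0 ** utri 1 1 (inverse e') (- w') 0 0 \<in> \<Gamma>"
    using mult_closed[OF assms(1) h(1)] by simp
  then show ?thesis by (simp add: utri_mult divide_inverse)
qed

text \<open>Two elements with the same translation part differ by a diagonal matrix, which is
  scalar by pure parabolicity.\<close>

lemma angle_eqI:
  assumes "utri 1 1 e w 0 0 \<in> \<Gamma>" shows "angle w = e"
proof -
  have w: "utri 1 1 (angle w) w 0 0 \<in> \<Gamma>" using assms by (intro angle_in) (auto simp: shifts_def)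
  have d: "utri 1 1 (angle w / e) 0 0 0 \<in> \<Gamma>" using shift_diff[OF w assms] by simp
  obtain c where "utri 1 1 (angle w / e) 0 0 0 = mat c"
    using diagonalizable_imp_scalar[OF d diagonalizable_utri_diag] by blast
  then have "angle w / e = 1" by (simp add: mat_eq_utri utri_eq_iff)
  then show ?thesis by (metis divide_eq_1_iff)
qed

lemma shift_add: "w \<in> shifts \<Longrightarrow> w' \<in> shifts \<Longrightarrow> utri 1 1 (angle w * angle w') (w + w') 0 0 \<in> \<Gamma>"
  using mult_closed[OF angle_in angle_in, of w w'] by (simp add: utri_mult add.commute)

lemma angle_add: "w \<in> shifts \<Longrightarrow> w' \<in> shifts \<Longrightarrow> angle (w + w') = angle w * angle w'"
  by (rule angle_eqI[OF shift_add])

lemma subgroup_shifts: "subgroup shifts complex_add"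
proof (rule group.subgroupI[OF group_complex_add])
  show "shifts \<subseteq> carrier complex_add" by (simp add: complex_add_def)
  have "utri 1 1 1 0 0 0 \<in> \<Gamma>" using scalars[of 1] by (simp add: mat_eq_utri)
  then have zero: "0 \<in> shifts" unfolding shifts_def by blast
  then show "shifts \<noteq> {}" by blast
  fix w assume w: "w \<in> shifts"
  have "inv\<^bsub>complex_add\<^esub> w = - w"
    by (rule group.inv_equality[OF group_complex_add]) (simp_all add: complex_add_def)
  then show "inv\<^bsub>complex_add\<^esub> w \<in> shifts"
    using shift_diff[OF angle_in[OF zero] angle_in[OF w]] unfolding shifts_def by auto
  fix w' assume "w' \<in> shifts"
  then show "w \<otimes>\<^bsub>complex_add\<^esub> w' \<in> shifts"
    using shift_add[OF w] unfolding shifts_def complex_add_def by auto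
qed

lemma angle_hom: "angle \<in> hom (complex_add\<lparr>carrier := shifts\<rparr>) unit_circle"
  by (rule homI) (simp_all add: complex_add_def unit_circle_def angle_norm angle_add)

text \<open>The rotation parts of a sequence of elements with translation parts tending to 0 need not tend to 1, but by
  compactness of the circle quotients of elements far along a subsequence do tend to the identity.\<close>

lemma shifts_bounded_away: "\<exists>\<epsilon>>0. \<forall>w\<in>shifts. cmod w < \<epsilon> \<longrightarrow> w = 0"
proof (rule ccontr)
  assume neg: "\<not> ?thesis"
  have "\<exists>w\<in>shifts. cmod w < inverse (real (Suc n)) \<and> w \<noteq> 0" for n
    using neg by (metis inverse_positive_iff_positive of_nat_0_less_iff zero_less_Suc)
  then obtain u where u: "\<And>n. u n \<in> shifts" "\<And>n. cmod (u n) < inverse (real (Suc n))" "\<And>n. u n \<noteq> 0"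
    by metis
  have u0: "u \<longlonglongrightarrow> 0"
    by (rule Lim_null_comparison[OF _ LIMSEQ_inverse_real_of_nat])
      (use u(2) in \<open>auto intro!: always_eventually less_imp_le\<close>)
  have "compact (sphere (0 :: complex) 1)" by simp
  moreover have "\<forall>n. (angle \<circ> u) n \<in> sphere 0 1" using angle_norm[OF u(1)] by simp
  ultimately obtain l r where l: "l \<in> sphere 0 1" "strict_mono (r :: nat \<Rightarrow> nat)"
    "((angle \<circ> u) \<circ> r) \<longlonglongrightarrow> l"
    unfolding compact_def by blast
  define v where "v n = u (r n)" for n
  have v: "v n \<in> shifts" "v n \<noteq> 0" for n using u by (auto simp: v_def)
  have v0: "v \<longlonglongrightarrow> 0" using LIMSEQ_subseq_LIMSEQ[OF u0 l(2)] unfolding v_def o_def .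
  have vl: "(\<lambda>n. angle (v n)) \<longlonglongrightarrow> l" using l(3) unfolding v_def o_def .
  \<comment> \<open>Choosing terms of different modulus keeps the quotients away from the scalar matrices.\<close>
  have "\<exists>m\<ge>n. cmod (v m) < cmod (v n)" for n
  proof -
    have "eventually (\<lambda>m. dist (v m) 0 < cmod (v n)) sequentially"
      using tendstoD[OF v0] v(2) by simp
    then obtain N where "\<And>m. m \<ge> N \<Longrightarrow> cmod (v m) < cmod (v n)"
      by (auto simp: eventually_sequentially)
    then show ?thesis by (meson max.cobounded1 max.cobounded2)
  qed
  then obtain f where f: "\<And>n. f n \<ge> n" "\<And>n. cmod (v (f n)) < cmod (v n)" by metis
  have f_lim: "filterlim f at_top sequentially"
    by (rule filterlim_at_top_mono[OF filterlim_ident]) (simp add: f(1))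
  have s: "utri 1 1 (angle (v n) / angle (v (f n))) (v n - v (f n)) 0 0 \<in> \<Gamma>" for n
    by (rule shift_diff[OF angle_in[OF v(1)] angle_in[OF v(1)]])
  have "l \<noteq> 0" using l(1) by auto
  then have "(\<lambda>n. utri 1 1 (angle (v n) / angle (v (f n))) (v n - v (f n)) 0 0)
      \<longlonglongrightarrow> utri 1 1 (l / l) (0 - 0) 0 0"
    by (intro tendsto_utri tendsto_intros vl v0 filterlim_compose[OF vl f_lim]
        filterlim_compose[OF v0 f_lim])
  then have "(\<lambda>n. utri 1 1 (angle (v n) / angle (v (f n))) (v n - v (f n)) 0 0) \<longlonglongrightarrow> mat 1"
    using \<open>l \<noteq> 0\<close> by (simp add: mat_eq_utri)
  from no_limit[OF s this] obtain n c
    where "utri 1 1 (angle (v n) / angle (v (f n))) (v n - v (f n)) 0 0 = mat c" by blast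
  then have "v n = v (f n)" by (simp add: mat_eq_utri utri_eq_iff)
  then show False using f(2)[of n] by simp
qed

lemma discrete_shifts: "discrete shifts"
  unfolding discrete_def isolated_in_dist_Ex_iff
proof (intro ballI conjI)
  fix w assume w: "w \<in> shifts"
  obtain \<epsilon> where \<epsilon>: "\<epsilon> > 0" "\<And>u. u \<in> shifts \<Longrightarrow> cmod u < \<epsilon> \<Longrightarrow> u = 0"
    using shifts_bounded_away by blast
  have "w' = w" if w': "w' \<in> shifts" "dist w w' < \<epsilon>" for w'
  proof -
    have d: "w - w' \<in> shifts"
      using shift_diff[OF angle_in[OF w] angle_in[OF w'(1)]] unfolding shifts_def by blast
    have "w - w' = 0" by (rule \<epsilon>(2)[OF d]) (use w'(2) in \<open>simp add: dist_norm\<close>)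
    then show ?thesis by simp
  qed
  then show "\<exists>\<epsilon>>0. \<forall>w'\<in>shifts. dist w w' < \<epsilon> \<longrightarrow> w' = w" using \<epsilon>(1) by blast
qed

lemma image_PSL3_class: "PSL3_class ` \<Gamma> = translation_family shifts angle"
proof -
  have fam: "translation_family shifts angle = (\<lambda>w. PSL3_class (utri 1 1 (angle w) w 0 0)) ` shifts"
    by (auto simp: translation_family_def utri_def)
  show ?thesis
    unfolding fam
  proof
    show "PSL3_class ` \<Gamma> \<subseteq> (\<lambda>w. PSL3_class (utri 1 1 (angle w) w 0 0)) ` shifts"
    proof
      fix h assume "h \<in> PSL3_class ` \<Gamma>"
      then obtain g where g: "g \<in> \<Gamma>" "h = PSL3_class g" by blast
      obtain k w e where s: "g = mat k ** utri 1 1 e w 0 0"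
        using screw[OF g(1)] unfolding screw_form_def by blast
      have "mat_eigenvalue g k" by (simp add: s scale_utri mat_eigenvalue_utri)
      then have k: "cmod k = 1" using eigenvalue_norm g(1) by blast
      then have k0: "k \<noteq> 0" by auto
      have "mat (inverse k) ** g \<in> \<Gamma>"
        using scale_closed[OF _ g(1), of "inverse k"] k by (simp add: norm_inverse)
      then have u: "utri 1 1 e w 0 0 \<in> \<Gamma>"
        using k0 by (simp add: s matrix_mul_assoc mat_mult_mat)
      have "h = PSL3_class (utri 1 1 (angle w) w 0 0)"
        unfolding g(2) s PSL3_class_scale[OF k0] angle_eqI[OF u] ..
      moreover have "w \<in> shifts" using u unfolding shifts_def by blast
      ultimately show "h \<in> (\<lambda>w. PSL3_class (utri 1 1 (angle w) w 0 0)) ` shifts" by blast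
    qed
  qed (use angle_in in blast)
qed

end

lemma conjugate_in_translation_family:
  assumes G: "subgroup G PSL3" and lifts: "parabolic_lifts (lifts G)" and P: "invertible P"
    and screw: "\<And>A. A \<in> lifts G \<Longrightarrow> screw_form (conj_by P A)"
  shows "\<exists>W \<eta>. subgroup W complex_add \<and> discrete W \<and>
     \<eta> \<in> hom (complex_add\<lparr>carrier := W\<rparr>) unit_circle \<and>
     conjugate_in PSL3 G (translation_family W \<eta>)"
proof -
  interpret C: parabolic_lifts "conj_by P ` lifts G" by (rule parabolic_lifts_conj_by[OF lifts P])
  interpret C: screw_lifts "conj_by P ` lifts G" by unfold_locales (use screw in blast)
  let ?g = "PSL3_class (matrix_inv P)"
  note i = invertible_matrix_inv[OF P]
  have "matrix_inv (matrix_inv P) = (P ** matrix_inv P) ** matrix_inv (matrix_inv P)"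
    by (simp add: matrix_inv_right[OF P])
  also have "\<dots> = P" by (simp add: matrix_mul_assoc[symmetric] matrix_inv_right[OF i])
  finally have ii: "matrix_inv (matrix_inv P) = P" .
  have "?g \<otimes>\<^bsub>PSL3\<^esub> PSL3_class A \<otimes>\<^bsub>PSL3\<^esub> inv\<^bsub>PSL3\<^esub> ?g = PSL3_class (conj_by P A)"
    if "A \<in> lifts G" for A
  proof -
    note A = lifts_invertible[OF that]
    show ?thesis
      unfolding inv_PSL3_class[OF i] ii PSL3_class_mult[OF i A]
        PSL3_class_mult[OF invertible_mult[OF i A] P] conj_by_def ..
  qed
  then have "(\<lambda>h. ?g \<otimes>\<^bsub>PSL3\<^esub> h \<otimes>\<^bsub>PSL3\<^esub> inv\<^bsub>PSL3\<^esub> ?g) ` PSL3_class ` lifts G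
      = PSL3_class ` conj_by P ` lifts G"
    unfolding image_image by (rule image_cong[OF refl])
  then have "conjugate_in PSL3 G (translation_family C.shifts C.angle)"
    unfolding conjugate_in_def C.image_PSL3_class[symmetric] subgroup_eq_image_lifts[OF G, symmetric]
    using PSL3_class_in_PSL3[OF i] by blast
  then show ?thesis using C.subgroup_shifts C.discrete_shifts C.angle_hom by blast
qed

theorem theorem4p5:
  fixes G :: "(complex^3^3) set set"
  assumes "discrete_subgroup_PSL3 G"
    and "purely_parabolic G"
  shows "virtually_unipotent G \<or>
    (\<exists>H W \<eta>. finite_index_subgroup H G PSL3 \<and>
       subgroup W complex_add \<and> discrete W \<and>
       \<eta> \<in> hom (complex_add\<lparr>carrier := W\<rparr>) unit_circle \<and>
       conjugate_in PSL3 H (translation_family W \<eta>))"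
proof -
  have G: "subgroup G PSL3" using assms(1) by (simp add: discrete_subgroup_PSL3_def)
  have lifts: "parabolic_lifts (lifts G)" by (rule parabolic_lifts_of_subgroup[OF assms])
  obtain P where P: "invertible P"
    and "(\<forall>A\<in>lifts G. upper (conj_by P A)) \<and> finite (diag_ratios ` conj_by P ` lifts G) \<or>
      (\<forall>A\<in>lifts G. screw_form (conj_by P A))"
    using parabolic_lifts.classification[OF lifts] by blast
  from this(2) show ?thesis
  proof
    assume "(\<forall>A\<in>lifts G. upper (conj_by P A)) \<and> finite (diag_ratios ` conj_by P ` lifts G)"
    then have "virtually_unipotent G"
      using virtually_unipotent_of_finite_ratios[OF G lifts P] by blast
    then show ?thesis by blast
  next
    assume "\<forall>A\<in>lifts G. screw_form (conj_by P A)"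
    then show ?thesis
      using conjugate_in_translation_family[OF G lifts P] finite_index_subgroup_self[OF group_PSL3 G]
      by blast
  qed
qed

end
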